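(* There exists a nondecreasing function $\varphi:(0,1)\to(0,1)$ such that if $x\in Q(0,1/2)$ and $B\subseteq Q(0,1)$ is a Borel set with $|B|\in(0,1)$, then $$\mathbb{E}^x\int_0^{\tau_{Q(0,1)}}1_B(X_s)\,ds\ \ge\ \varphi(|B|).$$
   Context: Setting. Let $n(x,h)$ be a function of $x\in\mathbb{R}^d$, $h\in\mathbb{R}^d\setminus\{0\}$, and for $f\in C^2(\mathbb{R}^d)$ bounded with bounded first and second partial derivatives set $$\mathcal{L}f(x)=\int_{\mathbb{R}^d\setminus\{0\}}\left[f(x+h)-f(x)-\nabla f(x)\cdot h\,1_{(|h|\le 1)}\right]n(x,h)\,dh .$$ Standing assumptions on $n$: (a) $n(x,-h)=n(x,h)$ for all $x,h$; (b) there are constants $\kappa\in(0,1)$ and $\alpha\in(0,2)$ such that $\kappa|h|^{-d-\alpha}\le n(x,h)\le\kappa^{-1}|h|^{-d-\alpha}$ for all $x,h$; (c) for $\eta>0$ let $\psi_\eta(r)=(1+\log^+(1/r))^{1+\eta}$, $r>0$, and $\bar n(x,h)=n(x,h)\psi_\eta(|h|)$; there exists $\eta>0$ such that for every $y\in\mathbb{R}^d$ and every $b>0$, $\lim_{x\to y}\sup_{|h|\le b}|\bar n(x,h)-\bar n(y,h)|=0$. A probability measure $\mathbb{P}$ solves the martingale problem for $\mathcal{L}$ started at $x$ if $\mathbb{P}(X_0=x)=1$ and, for every $f\in C^2$ bounded with bounded first and second partial derivatives, $f(X_t)-f(X_0)-\int_0^t\mathcal{L}f(X_s)\,ds$ is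 a $\mathbb{P}$-martingale. It is assumed given that $(\mathbb{P}^x,X_t)$ is a strong Markov process with state space $\mathbb{R}^d$ (with right-continuous paths with left limits) such that for every $x$ the measure $\mathbb{P}^x$ is a solution to the martingale problem for $\mathcal{L}$ started at $x$; $\mathbb{E}^x$ is the corresponding expectation. Notation: $Q(x,r)$ is the cube with center $x$ and side length $r$ (sides parallel to the axes); $|A|$ is the Lebesgue measure of $A$; $\tau_A=\inf\{t>0:X_t\notin A\}$. *)

theory Defs
  imports "HOL-Probability.Probability"
begin

section \<open>The operator\<close>

text \<open>Bounded \<open>C\<^sup>2\<close> functions with bounded gradient \<open>g\<close> and bounded continuous Hessian \<open>H\<close>.\<close>

definition C2_bounded :: "(real^'d::finite \<Rightarrow> real) set" where
  "C2_bounded = {f. \<exists>(g :: real^'d \<Rightarrow> real^'d) (H :: real^'d \<Rightarrow> real^'d^'d).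
     (\<forall>x. GDERIV f x :> g x) \<and>
     (\<forall>x. (g has_derivative (\<lambda>h. H x *v h)) (at x)) \<and>
     continuous_on UNIV H \<and>
     bounded (range f) \<and> bounded (range g) \<and> bounded (range H)}"

definition gradient :: "(real^'d::finite \<Rightarrow> real) \<Rightarrow> real^'d \<Rightarrow> real^'d" where
  "gradient f x = (THE D. GDERIV f x :> D)"

definition generator :: "(real^'d::finite \<Rightarrow> real^'d \<Rightarrow> real) \<Rightarrow> (real^'d \<Rightarrow> real) \<Rightarrow> real^'d \<Rightarrow> real" where
  "generator n f x =
     (LINT h:-{0}|lborel.
        (f (x + h) - f x - (gradient f x \<bullet> h) * indicator {h. norm h \<le> 1} h) * n x h)"

definition log_weight :: "real \<Rightarrow> real \<Rightarrow> real" where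
  "log_weight \<eta> r = (1 + max 0 (ln (1 / r))) powr (1 + \<eta>)"

text \<open>The value of \<open>n x\<close> at \<open>0\<close> is irrelevant throughout. Borel measurability of \<open>n x\<close> is what makes
  the integral defining the operator meaningful. The supremum in the last clause is taken in
  \<^typ>\<open>ennreal\<close>, since a real-valued \<open>SUP\<close> would be unspecified for an unbounded set of values.\<close>

definition stable_like_kernel :: "(real^'d::finite \<Rightarrow> real^'d \<Rightarrow> real) \<Rightarrow> bool" where
  "stable_like_kernel n \<longleftrightarrow>
     (\<forall>x. n x \<in> borel_measurable borel) \<and>
     (\<forall>x h. h \<noteq> 0 \<longrightarrow> n x (- h) = n x h) \<and>
     (\<exists>\<kappa> \<alpha>. 0 < \<kappa> \<and> \<kappa> < 1 \<and> 0 < \<alpha> \<and> \<alpha> < 2 \<and>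
        (\<forall>x h. h \<noteq> 0 \<longrightarrow>
           \<kappa> * norm h powr (- real CARD('d) - \<alpha>) \<le> n x h \<and>
           n x h \<le> inverse \<kappa> * norm h powr (- real CARD('d) - \<alpha>))) \<and>
     (\<exists>\<eta>>0. \<forall>y. \<forall>b>0.
        ((\<lambda>x. SUP h\<in>{h. h \<noteq> 0 \<and> norm h \<le> b}.
            ennreal \<bar>n x h * log_weight \<eta> (norm h) - n y h * log_weight \<eta> (norm h)\<bar>) \<longlongrightarrow> 0) (at y))"

section \<open>Processes\<close>

text \<open>A process is indexed by \<^typ>\<open>real\<close>, only times \<open>t \<ge> 0\<close> being relevant. Filtrations are
  indexed by \<^typ>\<open>ennreal\<close>, so that the library's stopping times may take the value \<open>\<infinity>\<close>.
  The measure \<open>M\<close> only serves as the underlying measurable space.\<close>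

definition natural_filtration ::
  "'w measure \<Rightarrow> (real \<Rightarrow> 'w \<Rightarrow> 'a::topological_space) \<Rightarrow> ennreal \<Rightarrow> 'w measure" where
  "natural_filtration M X t =
     sigma (space M) {X s -` A \<inter> space M | s A. 0 \<le> s \<and> ennreal s \<le> t \<and> A \<in> sets borel}"

text \<open>The right-continuous version \<open>F\<^sub>t\<^sub>+\<close>. The first conjunct is only needed for \<open>t = \<infinity>\<close>, where the
  second one is void. The set displayed is already a \<open>\<sigma>\<close>-algebra.\<close>

definition right_filtration ::
  "'w measure \<Rightarrow> (real \<Rightarrow> 'w \<Rightarrow> 'a::topological_space) \<Rightarrow> ennreal \<Rightarrow> 'w measure" where
  "right_filtration M X t =
     sigma (space M) {A \<in> sets (natural_filtration M X \<infinity>).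
                        \<forall>u>t. A \<in> sets (natural_filtration M X u)}"

definition cadlag :: "(real \<Rightarrow> 'a::topological_space) \<Rightarrow> bool" where
  "cadlag p \<longleftrightarrow> (\<forall>t\<ge>0. (p \<longlongrightarrow> p t) (at_right t)) \<and> (\<forall>t>0. \<exists>l. (p \<longlongrightarrow> l) (at_left t))"

definition martingale ::
  "'w measure \<Rightarrow> (ennreal \<Rightarrow> 'w measure) \<Rightarrow> (real \<Rightarrow> 'w \<Rightarrow> real) \<Rightarrow> bool" where
  "martingale P F Y \<longleftrightarrow>
     (\<forall>t\<ge>0. Y t \<in> borel_measurable (F (ennreal t)) \<and> integrable P (Y t)) \<and>
     (\<forall>s t. 0 \<le> s \<and> s \<le> t \<longrightarrow>
        (AE \<omega> in P. real_cond_exp P (F (ennreal s)) (Y t) \<omega> = Y s \<omega>))"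

definition solves_martingale_problem ::
  "((real^'d::finite \<Rightarrow> real) \<Rightarrow> real^'d \<Rightarrow> real) \<Rightarrow> 'w measure \<Rightarrow> (real \<Rightarrow> 'w \<Rightarrow> real^'d) \<Rightarrow> real^'d \<Rightarrow> bool"
  where
  "solves_martingale_problem L P X x \<longleftrightarrow>
     prob_space P \<and>
     measure P {\<omega> \<in> space P. X 0 \<omega> = x} = 1 \<and>
     (\<forall>f\<in>C2_bounded. martingale P (right_filtration P X)
        (\<lambda>t \<omega>. f (X t \<omega>) - f (X 0 \<omega>) - (LINT s:{0..t}|lborel. L f (X s \<omega>))))"

text \<open>The last clause is the strong Markov property
  \<open>P\<^sup>x(X\<^bsub>T+t\<^esub> \<in> B | F\<^sub>T) = P\<^bsup>X(T)\<^esup>(X\<^sub>t \<in> B)\<close> on \<open>{T < \<infinity>}\<close>, integrated over \<open>A \<in> F\<^sub>T\<close>.\<close>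

definition strong_markov_process ::
  "'w measure \<Rightarrow> ('a::topological_space \<Rightarrow> 'w measure) \<Rightarrow> (real \<Rightarrow> 'w \<Rightarrow> 'a) \<Rightarrow> bool" where
  "strong_markov_process M P X \<longleftrightarrow>
     (\<forall>x. prob_space (P x) \<and> sets (P x) = sets M) \<and>
     (\<forall>t\<ge>0. X t \<in> M \<rightarrow>\<^sub>M borel) \<and>
     (\<forall>\<omega>\<in>space M. cadlag (\<lambda>t. X t \<omega>)) \<and>
     (\<forall>t\<ge>0. (\<lambda>x. distr (P x) borel (X t)) \<in> borel \<rightarrow>\<^sub>M prob_algebra borel) \<and>
     (\<forall>x T t A B.
        stopping_time (right_filtration M X) T \<and> 0 \<le> t \<and>
        A \<in> sets (filtration.pre_sigma (space M) (right_filtration M X) T) \<and> B \<in> sets borel \<longrightarrow>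
        measure (P x) {\<omega> \<in> A. T \<omega> < \<infinity> \<and> X (enn2real (T \<omega>) + t) \<omega> \<in> B} =
        (LINT \<omega>:{\<omega> \<in> A. T \<omega> < \<infinity>}|P x.
           measure (P (X (enn2real (T \<omega>)) \<omega>)) {\<omega>' \<in> space M. X t \<omega>' \<in> B}))"

text \<open>The cubes are taken closed.\<close>

definition cube :: "real^'d::finite \<Rightarrow> real \<Rightarrow> (real^'d) set" where
  "cube x r = {y. \<forall>i. \<bar>y $ i - x $ i\<bar> \<le> r / 2}"

definition exit_time :: "(real \<Rightarrow> 'w \<Rightarrow> 'a) \<Rightarrow> 'a set \<Rightarrow> 'w \<Rightarrow> ennreal" where
  "exit_time X A \<omega> = (INF t\<in>{t. 0 < t \<and> X t \<omega> \<notin> A}. ennreal t)"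

end

theory Submission
  imports Defs
begin

text \<open>Since the logarithmic weight in the continuity condition is at least \<open>1\<close>, the kernels \<open>n x\<close> and
  \<open>n y\<close> differ, for \<open>x\<close> near \<open>y\<close>, by a bounded function near \<open>h = 0\<close>. Locally the operator is
  therefore a translation-invariant operator plus a bounded integral operator. Resolvents of the
  frozen operator, applied to smooth approximations of \<open>1\<^sub>L\<close>, show that a compact set \<open>L\<close> of positive
  measure contains a point from which the process spends a positive expected time in \<open>L\<close>.
  On the other hand, after a jump out of a small ball the law of the process dominates a multiple of
  Lebesgue measure, so by the strong Markov property the expected occupation time of \<open>B\<close> from any
  starting point dominates a multiple of the integral of the expected occupation times of \<open>B\<close> over
  the points outside that ball. A lower bound uniform in \<open>B\<close> follows by a limsup argument.\<close>

section \<open>Twice differentiable functions with controlled remainders\<close>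

text \<open>The bounded perturbation is harmless because the approximate resolvent \<open>u\<close>
  lies between 0 and \<open>1 / l\<close>: its second differences are then at most
  \<open>1 / l\<close> in absolute value, and integrating them against an integrable kernel costs
  \<open>K / l\<close>, however rough \<open>g\<close> is. Derivatives of \<open>g\<close> only
  decide how short the discarded jumps and how long the Neumann series must be. Hence
  \<open>g\<close> can run through smooth approximations of an indicator while \<open>l\<close> and
  the time horizon stay fixed. This yields a single good starting point in \<open>L\<close>, whereas
  the restart after a jump needs a set of them with positive measure. The gap closes by choosing
  \<open>L\<close> inside the set of bad points: if the points of \<open>S\<close> from which
  \<open>S\<close> has zero occupation had positive measure, a compact subset of them would contain
  a point with positive occupation of that subset, hence of \<open>S\<close>. The strong Markov
  property and the measurability in the starting point are given for one later time only. Occupation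
  before an exit involves whole path segments, so both are first carried over to cylinder events and
  then, along rational times, to the event of not having left a closed set.\<close>

definition smooth_bound :: "real \<Rightarrow> (real^'d::finite \<Rightarrow> real) \<Rightarrow> bool" where
  "smooth_bound C f \<longleftrightarrow> (\<exists>(g :: real^'d \<Rightarrow> real^'d) (H :: real^'d \<Rightarrow> real^'d^'d). \<forall>x h.
     \<bar>f x\<bar> \<le> C \<and> norm (g x) \<le> C \<and> norm (H x) \<le> C \<and>
     \<bar>f (x + h) - f x - g x \<bullet> h\<bar> \<le> C * (norm h)\<^sup>2 \<and>
     norm (g (x + h) - g x - H x *v h) \<le> C * (norm h)\<^sup>2 \<and>
     norm (H (x + h) - H x) \<le> C * norm h)"

lemma has_derivative_quadratic_remainder:
  assumes "bounded_linear L" and "\<And>h. norm (f (x + h) - f x - L h) \<le> C * (norm h)\<^sup>2"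
  shows "(f has_derivative L) (at x)"
  unfolding has_derivative_at
proof (intro conjI assms(1))
  have "((\<lambda>h. C * norm h) \<longlongrightarrow> 0) (at (0::'a))"
    using tendsto_mult_right_zero[OF tendsto_norm_zero[OF tendsto_ident_at]] by blast
  then show "(\<lambda>h. norm (f (x + h) - f x - L h) / norm h) \<midarrow>0\<rightarrow> 0"
  proof (rule Lim_null_comparison[rotated])
    show "\<forall>\<^sub>F h in at 0. norm (norm (f (x + h) - f x - L h) / norm h) \<le> C * norm h"
      unfolding eventually_at
    proof (intro exI[of _ 1] conjI ballI impI zero_less_one)
      fix h :: 'a assume "h \<noteq> 0 \<and> dist h 0 < 1"
      then show "norm (norm (f (x + h) - f x - L h) / norm h) \<le> C * norm h"
        using assms(2)[of h] by (simp add: divide_simps power2_eq_square mult.assoc)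
    qed
  qed
qed

lemma norm_matrix_vector_mult_le:
  fixes A :: "real^'n::finite^'m::finite"
  shows "norm (A *v h) \<le> norm A * norm h"
proof -
  have "norm (A *v h) = L2_set (\<lambda>i. \<bar>A $ i \<bullet> h\<bar>) UNIV"
    by (simp add: norm_vec_def matrix_vector_mul_component)
  also have "\<dots> \<le> L2_set (\<lambda>i. norm h * norm (A $ i)) UNIV"
    by (intro L2_set_mono) (auto simp: mult.commute[of "norm h"] Cauchy_Schwarz_ineq2)
  also have "\<dots> = norm A * norm h"
    by (subst L2_set_right_distrib[symmetric]) (simp_all add: norm_vec_def mult.commute)
  finally show ?thesis .
qed

lemma
  assumes "smooth_bound C (f :: real^'d::finite \<Rightarrow> real)"
  shows smooth_bound_nonneg: "0 \<le> C" and smooth_bound_abs_le: "\<bar>f x\<bar> \<le> C"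
  using assms unfolding smooth_bound_def by (metis abs_ge_zero order_trans)+

text \<open>The remainder estimates contain the derivatives: quadratic errors force \<open>g\<close>
  and \<open>H\<close> to be the gradient and the Hessian, and the Lipschitz bound makes
  \<open>H\<close> continuous.\<close>

lemma smooth_boundE:
  assumes "smooth_bound C (f :: real^'d::finite \<Rightarrow> real)"
  obtains g :: "real^'d \<Rightarrow> real^'d" and H :: "real^'d \<Rightarrow> real^'d^'d"
  where "\<And>x. \<bar>f x\<bar> \<le> C" "\<And>x. norm (g x) \<le> C" "\<And>x. norm (H x) \<le> C"
    "\<And>x h. \<bar>f (x + h) - f x - g x \<bullet> h\<bar> \<le> C * (norm h)\<^sup>2"
    "\<And>x h. norm (g (x + h) - g x - H x *v h) \<le> C * (norm h)\<^sup>2"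
    "\<And>x h. norm (H (x + h) - H x) \<le> C * norm h"
    "\<And>x. GDERIV f x :> g x" "\<And>x. (g has_derivative (\<lambda>h. H x *v h)) (at x)"
    "continuous_on UNIV f" "continuous_on UNIV g" "continuous_on UNIV H"
proof -
  obtain g :: "real^'d \<Rightarrow> real^'d" and H :: "real^'d \<Rightarrow> real^'d^'d" where
    b: "\<And>x. \<bar>f x\<bar> \<le> C" "\<And>x. norm (g x) \<le> C" "\<And>x. norm (H x) \<le> C"
    and f: "\<And>x h. \<bar>f (x + h) - f x - g x \<bullet> h\<bar> \<le> C * (norm h)\<^sup>2"
    and g: "\<And>x h. norm (g (x + h) - g x - H x *v h) \<le> C * (norm h)\<^sup>2"
    and H: "\<And>x h. norm (H (x + h) - H x) \<le> C * norm h"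
    using assms unfolding smooth_bound_def by metis
  have f': "GDERIV f x :> g x" for x
    unfolding gderiv_def using f
    by (intro has_derivative_quadratic_remainder[where C = C])
       (auto simp: bounded_linear_inner_left bounded_linear_inner_right inner_commute[of _ "g x"])
  have g': "(g has_derivative (\<lambda>h. H x *v h)) (at x)" for x
    using g by (intro has_derivative_quadratic_remainder[where C = C]) auto
  have "continuous_on UNIV f"
    using f' has_derivative_continuous unfolding gderiv_def
    by (intro continuous_at_imp_continuous_on) blast
  moreover have "continuous_on UNIV g"
    using g' has_derivative_continuous by (intro continuous_at_imp_continuous_on) blast
  moreover have "C-lipschitz_on UNIV H"
    using H[of x "y - x" for x y] order_trans[OF norm_ge_zero b(2)]
    by (intro lipschitz_onI) (auto simp: dist_norm norm_minus_commute)
  then have "continuous_on UNIV H" by (rule lipschitz_on_continuous_on)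
  ultimately show ?thesis using that b f g H f' g' by blast
qed

lemma smooth_bound_C2_bounded:
  assumes "smooth_bound C f" shows "f \<in> C2_bounded"
  using assms by (elim smooth_boundE) (auto simp: C2_bounded_def bounded_iff real_norm_def)

lemma smooth_bound_continuous: "smooth_bound C f \<Longrightarrow> continuous_on UNIV f"
  by (elim smooth_boundE)

lemma smooth_bound_measurable [measurable_dest]: "smooth_bound C f \<Longrightarrow> f \<in> borel_measurable borel"
  by (auto intro: borel_measurable_continuous_onI smooth_bound_continuous)

text \<open>This is the reason for storing remainder estimates instead of derivatives: they are
  inequalities with one constant for all points, so integrating them over \<open>y\<close> gives the
  same inequalities for the average, without differentiating under the integral sign. The lemma
  serves both the mollification of indicators and the convolution operator \<open>A\<close>.\<close>

lemma smooth_bound_integral_translates: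
  fixes f :: "real^'d::finite \<Rightarrow> real" and s :: "'b \<Rightarrow> real^'d"
  assumes f: "smooth_bound C f" and "finite_measure \<nu>" and [measurable]: "s \<in> borel_measurable \<nu>"
  shows "smooth_bound (C * measure \<nu> (space \<nu>)) (\<lambda>x. LINT y|\<nu>. f (x + s y))"
proof -
  interpret finite_measure \<nu> by fact
  let ?m = "measure \<nu> (space \<nu>)"
  obtain g H where *: "\<And>x. \<bar>f x\<bar> \<le> C" "\<And>x. norm (g x) \<le> C" "\<And>x. norm (H x) \<le> C"
    "\<And>x h. \<bar>f (x + h) - f x - g x \<bullet> h\<bar> \<le> C * (norm h)\<^sup>2"
    "\<And>x h. norm (g (x + h) - g x - H x *v h) \<le> C * (norm h)\<^sup>2"
    "\<And>x h. norm (H (x + h) - H x) \<le> C * norm h"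
    and c: "continuous_on UNIV f" "continuous_on UNIV g" "continuous_on UNIV H"
    using f by (elim smooth_boundE) blast
  note [measurable] = c[THEN borel_measurable_continuous_onI]
  have int [simp]: "integrable \<nu> (\<lambda>y. f (x + s y))" "integrable \<nu> (\<lambda>y. g (x + s y))"
      "integrable \<nu> (\<lambda>y. H (x + s y))" for x
    by (rule integrable_const_bound[where B = C]; use *(1-3) in simp)+
  \<comment> \<open>Evaluation at a fixed vector is bounded linear in the matrix, so it commutes
    with the integral over \<open>y\<close>.\<close>
  have bl: "bounded_linear (\<lambda>A :: real^'d^'d. A *v h)" for h
    by (intro bounded_linear_intro[where K="norm h"])
       (auto simp: matrix_vector_mult_add_rdistrib scaleR_matrix_vector_assoc norm_matrix_vector_mult_le)
  have int2 [simp]: "integrable \<nu> (\<lambda>y. H (x + s y) *v h)" for x h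
    by (rule integrable_bounded_linear[OF bl]) simp
  have le: "norm (LINT y|\<nu>. F y) \<le> b * ?m"
    if "integrable \<nu> F" "\<And>y. norm (F y) \<le> b" for F :: "'b \<Rightarrow> 'c::{banach,second_countable_topology}" and b
  proof -
    have "norm (LINT y|\<nu>. F y) \<le> (LINT y|\<nu>. norm (F y))" by (rule integral_norm_bound)
    also have "\<dots> \<le> (LINT y|\<nu>. b)" using that by (intro integral_mono) auto
    finally show ?thesis by (simp add: mult.commute)
  qed
  have mv: "(LINT y|\<nu>. H (x + s y)) *v h = (LINT y|\<nu>. H (x + s y) *v h)" for x h
    by (intro integral_bounded_linear[symmetric] bl) simp
  have f1: "\<bar>(LINT y|\<nu>. f (x + h + s y)) - (LINT y|\<nu>. f (x + s y)) - (LINT y|\<nu>. g (x + s y)) \<bullet> h\<bar>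
      \<le> C * (norm h)\<^sup>2 * ?m" for x h
  proof -
    have "(LINT y|\<nu>. f (x + h + s y)) - (LINT y|\<nu>. f (x + s y)) - (LINT y|\<nu>. g (x + s y)) \<bullet> h
       = (LINT y|\<nu>. f (x + h + s y) - f (x + s y) - g (x + s y) \<bullet> h)"
      by simp
    moreover have "\<bar>f (x + h + s y) - f (x + s y) - g (x + s y) \<bullet> h\<bar> \<le> C * (norm h)\<^sup>2" for y
      using *(4)[of "x + s y" h] by (simp only: ac_simps)
    ultimately show ?thesis
      using le[of "\<lambda>y. f (x + h + s y) - f (x + s y) - g (x + s y) \<bullet> h"] by simp
  qed
  have g1: "norm ((LINT y|\<nu>. g (x + h + s y)) - (LINT y|\<nu>. g (x + s y)) - (LINT y|\<nu>. H (x + s y)) *v h)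
      \<le> C * (norm h)\<^sup>2 * ?m" for x h
  proof -
    have "(LINT y|\<nu>. g (x + h + s y)) - (LINT y|\<nu>. g (x + s y)) - (LINT y|\<nu>. H (x + s y)) *v h
       = (LINT y|\<nu>. g (x + h + s y) - g (x + s y) - H (x + s y) *v h)"
      by (simp add: mv)
    moreover have "norm (g (x + h + s y) - g (x + s y) - H (x + s y) *v h) \<le> C * (norm h)\<^sup>2" for y
      using *(5)[of "x + s y" h] by (simp only: ac_simps)
    ultimately show ?thesis
      using le[of "\<lambda>y. g (x + h + s y) - g (x + s y) - H (x + s y) *v h"] by simp
  qed
  have H1: "norm ((LINT y|\<nu>. H (x + h + s y)) - (LINT y|\<nu>. H (x + s y))) \<le> C * norm h * ?m" for x h
  proof -
    have "(LINT y|\<nu>. H (x + h + s y)) - (LINT y|\<nu>. H (x + s y)) = (LINT y|\<nu>. H (x + h + s y) - H (x + s y))"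
      by simp
    moreover have "norm (H (x + h + s y) - H (x + s y)) \<le> C * norm h" for y
      using *(6)[of "x + s y" h] by (simp only: ac_simps)
    ultimately show ?thesis
      using le[of "\<lambda>y. H (x + h + s y) - H (x + s y)"] by simp
  qed
  have b: "\<bar>LINT y|\<nu>. f (x + s y)\<bar> \<le> C * ?m" "norm (LINT y|\<nu>. g (x + s y)) \<le> C * ?m"
    "norm (LINT y|\<nu>. H (x + s y)) \<le> C * ?m" for x
    using le[OF int(1) *(1)[folded real_norm_def]] le[OF int(2) *(2)] le[OF int(3) *(3)] by auto
  show ?thesis
    unfolding smooth_bound_def
    by (intro exI[of _ "\<lambda>x. LINT y|\<nu>. g (x + s y)"] exI[of _ "\<lambda>x. LINT y|\<nu>. H (x + s y)"] allI conjI)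
       (use f1 g1 H1 b in \<open>simp_all only: mult.assoc mult.commute mult.left_commute\<close>)
qed

section \<open>Algebra of the remainder bounds\<close>

lemma smooth_bound_mono:
  assumes "smooth_bound C f" "C \<le> C'" shows "smooth_bound C' f"
proof -
  obtain g H where *: "\<And>x. \<bar>f x\<bar> \<le> C" "\<And>x. norm (g x) \<le> C" "\<And>x. norm (H x) \<le> C"
    "\<And>x h. \<bar>f (x + h) - f x - g x \<bullet> h\<bar> \<le> C * (norm h)\<^sup>2"
    "\<And>x h. norm (g (x + h) - g x - H x *v h) \<le> C * (norm h)\<^sup>2"
    "\<And>x h. norm (H (x + h) - H x) \<le> C * norm h"
    using assms(1) by (elim smooth_boundE) blast
  show ?thesis unfolding smooth_bound_def
    using * assms(2)
    by (intro exI[of _ g] exI[of _ H])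
       (meson mult_right_mono order_trans norm_ge_zero zero_le_power2)
qed

lemma smooth_bound_const: "smooth_bound \<bar>c\<bar> (\<lambda>_. c)"
  unfolding smooth_bound_def by (intro exI[of _ "\<lambda>_. 0"]) auto

lemma smooth_bound_cmult:
  assumes "smooth_bound C f" shows "smooth_bound (\<bar>c\<bar> * C) (\<lambda>x. c * f x)"
proof -
  obtain g H where *: "\<And>x. \<bar>f x\<bar> \<le> C" "\<And>x. norm (g x) \<le> C" "\<And>x. norm (H x) \<le> C"
    "\<And>x h. \<bar>f (x + h) - f x - g x \<bullet> h\<bar> \<le> C * (norm h)\<^sup>2"
    "\<And>x h. norm (g (x + h) - g x - H x *v h) \<le> C * (norm h)\<^sup>2"
    "\<And>x h. norm (H (x + h) - H x) \<le> C * norm h"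
    using assms(1) by (elim smooth_boundE) blast
  have 1: "c * f (x + h) - c * f x - (c *\<^sub>R g x) \<bullet> h = c * (f (x + h) - f x - g x \<bullet> h)" for x h
    by (simp add: algebra_simps)
  have 2: "c *\<^sub>R g (x + h) - c *\<^sub>R g x - (c *\<^sub>R H x) *v h = c *\<^sub>R (g (x + h) - g x - H x *v h)" for x h
    by (simp add: algebra_simps scaleR_matrix_vector_assoc)
  have 3: "c *\<^sub>R H (x + h) - c *\<^sub>R H x = c *\<^sub>R (H (x + h) - H x)" for x h
    by (simp add: algebra_simps)
  show ?thesis unfolding smooth_bound_def
    by (intro exI[of _ "\<lambda>x. c *\<^sub>R g x"] exI[of _ "\<lambda>x. c *\<^sub>R H x"])
       (unfold 1 2 3, auto simp: abs_mult mult.assoc intro!: mult_left_mono *)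
qed

lemma smooth_bound_add:
  assumes "smooth_bound C f" "smooth_bound C' f'" shows "smooth_bound (C + C') (\<lambda>x. f x + f' x)"
proof -
  obtain g H where *: "\<And>x. \<bar>f x\<bar> \<le> C" "\<And>x. norm (g x) \<le> C" "\<And>x. norm (H x) \<le> C"
    "\<And>x h. \<bar>f (x + h) - f x - g x \<bullet> h\<bar> \<le> C * (norm h)\<^sup>2"
    "\<And>x h. norm (g (x + h) - g x - H x *v h) \<le> C * (norm h)\<^sup>2"
    "\<And>x h. norm (H (x + h) - H x) \<le> C * norm h"
    using assms(1) by (elim smooth_boundE) blast
  obtain g' H' where **: "\<And>x. \<bar>f' x\<bar> \<le> C'" "\<And>x. norm (g' x) \<le> C'" "\<And>x. norm (H' x) \<le> C'"
    "\<And>x h. \<bar>f' (x + h) - f' x - g' x \<bullet> h\<bar> \<le> C' * (norm h)\<^sup>2"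
    "\<And>x h. norm (g' (x + h) - g' x - H' x *v h) \<le> C' * (norm h)\<^sup>2"
    "\<And>x h. norm (H' (x + h) - H' x) \<le> C' * norm h"
    using assms(2) by (elim smooth_boundE) blast
  have 1: "f (x + h) + f' (x + h) - (f x + f' x) - (g x + g' x) \<bullet> h
      = (f (x + h) - f x - g x \<bullet> h) + (f' (x + h) - f' x - g' x \<bullet> h)" for x h
    by (simp add: algebra_simps)
  have 2: "g (x + h) + g' (x + h) - (g x + g' x) - (H x + H' x) *v h
      = (g (x + h) - g x - H x *v h) + (g' (x + h) - g' x - H' x *v h)" for x h
    by (simp add: algebra_simps)
  have 3: "H (x + h) + H' (x + h) - (H x + H' x) = (H (x + h) - H x) + (H' (x + h) - H' x)" for x h
    by (simp add: algebra_simps)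
  show ?thesis unfolding smooth_bound_def
    by (intro exI[of _ "\<lambda>x. g x + g' x"] exI[of _ "\<lambda>x. H x + H' x"])
       (auto simp: 1 2 3 distrib_right intro!: norm_triangle_mono order_trans[OF abs_triangle_ineq] add_mono * **)
qed

lemma smooth_bound_sum:
  assumes "finite I" "\<And>i. i \<in> I \<Longrightarrow> smooth_bound (C i) (f i)"
  shows "smooth_bound (\<Sum>i\<in>I. C i) (\<lambda>x. \<Sum>i\<in>I. f i x)"
  using assms
proof (induction I rule: finite_induct)
  case empty
  then show ?case using smooth_bound_const[of 0] by simp
next
  case (insert i I)
  then show ?case using smooth_bound_add[of "C i" "f i" "sum C I" "\<lambda>x. \<Sum>i\<in>I. f i x"] by simp
qed

lemma smooth_bound_translate:
  assumes "smooth_bound C f" shows "smooth_bound C (\<lambda>x. f (x - a))"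
proof -
  obtain g H where *: "\<And>x. \<bar>f x\<bar> \<le> C" "\<And>x. norm (g x) \<le> C" "\<And>x. norm (H x) \<le> C"
    "\<And>x h. \<bar>f (x + h) - f x - g x \<bullet> h\<bar> \<le> C * (norm h)\<^sup>2"
    "\<And>x h. norm (g (x + h) - g x - H x *v h) \<le> C * (norm h)\<^sup>2"
    "\<And>x h. norm (H (x + h) - H x) \<le> C * norm h"
    using assms(1) by (elim smooth_boundE) blast
  have eq: "x + h - a = x - a + h" for x h by simp
  show ?thesis unfolding smooth_bound_def
    by (intro exI[of _ "\<lambda>x. g (x - a)"] exI[of _ "\<lambda>x. H (x - a)"])
       (unfold eq, auto intro!: *)
qed

text \<open>The gradient scales with \<open>c\<close>, the Hessian with the square and its Lipschitz
  constant with the cube of \<open>c\<close>; since \<open>c\<close> is at least 1, the cube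
  dominates all of them.\<close>

lemma smooth_bound_scale:
  fixes f :: "real^'d::finite \<Rightarrow> real"
  assumes "smooth_bound C f" "1 \<le> c" shows "smooth_bound (c ^ 3 * C) (\<lambda>x. f (c *\<^sub>R x))"
proof -
  obtain g :: "real^'d \<Rightarrow> real^'d" and H :: "real^'d \<Rightarrow> real^'d^'d"
    where *: "\<And>x. \<bar>f x\<bar> \<le> C" "\<And>x. norm (g x) \<le> C" "\<And>x. norm (H x) \<le> C"
    "\<And>x h. \<bar>f (x + h) - f x - g x \<bullet> h\<bar> \<le> C * (norm h)\<^sup>2"
    "\<And>x h. norm (g (x + h) - g x - H x *v h) \<le> C * (norm h)\<^sup>2"
    "\<And>x h. norm (H (x + h) - H x) \<le> C * norm h"
    using assms(1) by (elim smooth_boundE) blast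
  have C: "0 \<le> C" using assms(1) by (rule smooth_bound_nonneg)
  have c: "c ^ k \<le> c ^ 3" if "k \<le> 3" for k using assms(2) that by (intro power_increasing)
  have up: "z \<le> c ^ 3 * y" if "z \<le> c ^ k * y" "k \<le> 3" "0 \<le> y" for z y k
    using that c[of k] by (meson mult_right_mono order_trans)
  let ?g = "\<lambda>x. c *\<^sub>R g (c *\<^sub>R x)" and ?H = "\<lambda>x. c\<^sup>2 *\<^sub>R H (c *\<^sub>R x)"
  have "\<bar>f (c *\<^sub>R x)\<bar> \<le> c ^ 3 * C" for x
    by (rule up[of _ 0]) (use * C in auto)
  moreover have "norm (?g x) \<le> c ^ 3 * C" for x
    by (rule up[of _ 1]) (use * C assms(2) in \<open>auto intro!: mult_left_mono\<close>)
  moreover have "norm (?H x) \<le> c ^ 3 * C" for x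
    by (rule up[of _ 2]) (use * C assms(2) in \<open>auto intro!: mult_left_mono\<close>)
  moreover have "\<bar>f (c *\<^sub>R (x + h)) - f (c *\<^sub>R x) - ?g x \<bullet> h\<bar> \<le> c ^ 3 * (C * (norm h)\<^sup>2)" for x h
    by (rule up[of _ 2]) (use *(4)[of "c *\<^sub>R x" "c *\<^sub>R h"] C in \<open>auto simp: scaleR_add_right power_mult_distrib mult_ac\<close>)
  moreover have "norm (?g (x + h) - ?g x - ?H x *v h) \<le> c ^ 3 * (C * (norm h)\<^sup>2)" for x h
  proof -
    have "?g (x + h) - ?g x - ?H x *v h = c *\<^sub>R (g (c *\<^sub>R x + c *\<^sub>R h) - g (c *\<^sub>R x) - H (c *\<^sub>R x) *v (c *\<^sub>R h))"
      by (simp add: algebra_simps power2_eq_square matrix_vector_mult_scaleR flip: scaleR_matrix_vector_assoc)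
    also have "norm \<dots> \<le> c * (C * (norm (c *\<^sub>R h))\<^sup>2)"
      using assms(2) *(5)[of "c *\<^sub>R x" "c *\<^sub>R h"] by (auto intro!: mult_left_mono)
    also have "\<dots> = c ^ 3 * (C * (norm h)\<^sup>2)"
      by (simp add: power_mult_distrib power3_eq_cube power2_eq_square)
    finally show ?thesis .
  qed
  moreover have "norm (?H (x + h) - ?H x) \<le> c ^ 3 * (C * norm h)" for x h
  proof -
    have "?H (x + h) - ?H x = c\<^sup>2 *\<^sub>R (H (c *\<^sub>R x + c *\<^sub>R h) - H (c *\<^sub>R x))"
      by (simp add: algebra_simps)
    also have "norm \<dots> \<le> c\<^sup>2 * (C * norm (c *\<^sub>R h))"
      using *(6)[of "c *\<^sub>R x" "c *\<^sub>R h"] by (auto intro!: mult_left_mono)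
    also have "\<dots> = c ^ 3 * (C * norm h)"
      using assms(2) by (simp add: power3_eq_cube power2_eq_square)
    finally show ?thesis .
  qed
  ultimately show ?thesis
    unfolding smooth_bound_def by (intro exI[of _ ?g] exI[of _ ?H]) (simp add: mult.assoc)
qed

text \<open>Mean value inequality on the segment from \<open>x\<close> to \<open>x + h\<close>: the
  bound on \<open>H\<close> makes \<open>g\<close> Lipschitz, which controls the remainder of
  \<open>f\<close>, and the Lipschitz bound on \<open>H\<close> controls the remainder of
  \<open>g\<close> in the same way.\<close>

lemma smooth_boundI:
  fixes f :: "real^'d::finite \<Rightarrow> real" and H :: "real^'d \<Rightarrow> real^'d^'d"
  assumes b: "\<And>x. \<bar>f x\<bar> \<le> C" "\<And>x. norm (g x) \<le> C" "\<And>x. norm (H x) \<le> C"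
    and f': "\<And>x. GDERIV f x :> g x" and g': "\<And>x. (g has_derivative (\<lambda>h. H x *v h)) (at x)"
    and H: "\<And>x y. norm (H x - H y) \<le> C * norm (x - y)"
  shows "smooth_bound C f"
proof -
  have C: "0 \<le> C" using order_trans[OF norm_ge_zero b(2)] .
  have seg: "norm (z - x) \<le> norm h" if "z \<in> closed_segment x (x + h)" for x z h :: "real^'d"
    using segment_bound1[OF that] by simp
  have gl: "norm (g x - g y) \<le> C * norm (x - y)" for x y
    by (rule differentiable_bound[of UNIV g "\<lambda>x h. H x *v h"])
       (use g' in \<open>auto intro!: onorm_le order_trans[OF norm_matrix_vector_mult_le] mult_right_mono b(3)\<close>)
  have "norm (g (x + h) - g x - H x *v (x + h - x)) \<le> norm (x + h - x) * (C * norm h)" for x h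
  proof (rule differentiable_bound_linearization[where S = "closed_segment x (x + h)" and f' = "\<lambda>x h. H x *v h"])
    fix z assume z: "z \<in> closed_segment x (x + h)"
    have "norm ((H z - H x) *v k) \<le> C * norm h * norm k" for k
      by (rule order_trans[OF norm_matrix_vector_mult_le], intro mult_right_mono order_trans[OF H])
         (use seg[OF z] C in \<open>auto intro: mult_left_mono\<close>)
    then show "onorm ((\<lambda>k. H z *v k) - (\<lambda>k. H x *v k)) \<le> C * norm h"
      by (intro onorm_le) (simp add: matrix_vector_mult_diff_rdistrib)
  qed (use g' in \<open>auto simp: closed_segment_def algebra_simps intro: has_derivative_at_withinI\<close>)
  moreover have "norm (f (x + h) - f x - (g x \<bullet> (x + h - x))) \<le> norm (x + h - x) * (C * norm h)" for x h
  proof (rule differentiable_bound_linearization[where S = "closed_segment x (x + h)" and f' = "\<lambda>x h. g x \<bullet> h"])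
    fix z assume z: "z \<in> closed_segment x (x + h)"
    have "\<bar>(g z - g x) \<bullet> k\<bar> \<le> C * norm h * norm k" for k
      by (rule order_trans[OF Cauchy_Schwarz_ineq2], intro mult_right_mono order_trans[OF gl])
         (use seg[OF z] C in \<open>auto intro: mult_left_mono\<close>)
    then show "onorm ((\<lambda>k. g z \<bullet> k) - (\<lambda>k. g x \<bullet> k)) \<le> C * norm h"
      by (intro onorm_le) (simp add: inner_diff_left)
  qed (use f' in \<open>auto simp: closed_segment_def algebra_simps gderiv_def inner_commute intro: has_derivative_at_withinI\<close>)
  ultimately show ?thesis
    unfolding smooth_bound_def
    by (intro exI[of _ g] exI[of _ H] allI conjI b order_trans[OF H])
       (auto simp: power2_eq_square mult_ac)
qed

text \<open>The squared positive part has remainder at most \<open>h\<^sup>2\<close>, also across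
  the kink. Higher powers need no further case distinction, since a power of the positive part times
  \<open>t\<close> is the next power, so the product rule applies.\<close>

lemma DERIV_pos_part_power:
  "((\<lambda>t::real. max 0 t ^ Suc (Suc n)) has_real_derivative real (Suc (Suc n)) * max 0 t ^ Suc n) (at t)"
proof (induction n)
  case 0
  have "\<bar>(max 0 (t + h))\<^sup>2 - (max 0 t)\<^sup>2 - 2 * max 0 t * h\<bar> \<le> 1 * h\<^sup>2" for h
  proof -
    consider "0 \<le> t" "0 \<le> t + h" | "0 \<le> t" "t + h \<le> 0" | "t \<le> 0" "0 \<le> t + h" | "t \<le> 0" "t + h \<le> 0"
      by linarith
    then show ?thesis
    proof cases
      case 1 then show ?thesis by (simp add: power2_eq_square algebra_simps)
    next
      case 2
      then have "t * (- t - h) \<ge> 0" "(t + h)\<^sup>2 \<ge> 0" "t * t \<ge> 0" "t * h \<le> 0" by (auto intro: mult_nonneg_nonneg mult_nonneg_nonpos)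
      with 2 show ?thesis by (auto simp: max_def power2_eq_square algebra_simps abs_le_iff)
    next
      case 3
      then have "0 \<le> t + h" "t + h \<le> h" by auto
      then have "(t + h)\<^sup>2 \<le> h\<^sup>2" by (intro power_mono)
      with 3 show ?thesis by simp
    qed simp
  qed
  then have "((\<lambda>t. (max 0 t)\<^sup>2) has_derivative (\<lambda>h. 2 * max 0 t * h)) (at t)"
    by (intro has_derivative_quadratic_remainder[where C = 1]) (auto intro: bounded_linear_mult_right)
  then show ?case by (simp add: has_field_derivative_def numeral_2_eq_2 mult_commute_abs)
next
  case (Suc n)
  have "t * max 0 t = max 0 t * max 0 t" for t :: real by (simp add: max_def)
  then have eq: "t * max 0 t ^ Suc n = max 0 t ^ Suc (Suc n)" for t :: real and n
    by (simp add: mult.assoc[symmetric])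
  have "((\<lambda>t. t * max 0 t ^ Suc (Suc n)) has_real_derivative
     1 * max 0 t ^ Suc (Suc n) + real (Suc (Suc n)) * max 0 t ^ Suc n * t) (at t)"
    by (rule DERIV_mult[OF DERIV_ident Suc])
  also have "1 * max 0 t ^ Suc (Suc n) + real (Suc (Suc n)) * max 0 t ^ Suc n * t
      = max 0 t ^ Suc (Suc n) + real (Suc (Suc n)) * (t * max 0 t ^ Suc n)"
    by (simp only: mult_1 mult_ac)
  also have "\<dots> = real (Suc (Suc (Suc n))) * max 0 t ^ Suc (Suc n)"
    unfolding eq by (simp add: distrib_right)
  finally show ?case unfolding eq .
qed

section \<open>A compactly supported bump and its second-order bounds\<close>

definition bump :: "real^'d::finite \<Rightarrow> real" where
  "bump x = max 0 (1 - x \<bullet> x) ^ 4"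

lemma bump_0 [simp]: "bump 0 = 1"
  and bump_nonneg: "0 \<le> bump x" and bump_le_1: "bump x \<le> 1"
  and bump_minus [simp]: "bump (- x) = bump x"
  and bump_eq_0: "1 \<le> norm x \<Longrightarrow> bump x = 0"
  and bump_pos: "norm x < 1 \<Longrightarrow> 0 < bump x"
proof -
  show "bump x \<le> 1" unfolding bump_def by (rule power_le_one) auto
  have *: "x \<bullet> x = (norm x)\<^sup>2" by (simp add: power2_norm_eq_inner)
  show "bump x = 0" if "1 \<le> norm x" unfolding bump_def * using one_le_power[OF that, of 2] by simp
  show "0 < bump x" if "norm x < 1"
    unfolding bump_def * using that abs_square_less_1[of "norm x"] by (auto intro!: zero_less_power simp: less_max_iff_disj simp del: zero_less_power_eq_numeral)
qed (auto simp: bump_def)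

lemma smooth_bound_bump: "\<exists>C. smooth_bound C (bump :: real^'d::finite \<Rightarrow> real)"
proof -
  \<comment> \<open>Each derivative lowers the exponent by one. Starting from 4, the Hessian
    contains the exponents 3 and 2, which are still differentiable, so its Lipschitz constant can be
    read off from one more derivative.\<close>
  define P where "P k x = max 0 (1 - x \<bullet> x) ^ k" for k and x :: "real^'d"
  have P0: "0 \<le> P k x" and P1: "P k x \<le> 1" for k x
    by (auto simp: P_def intro!: power_le_one)
  have Pz: "P k x = 0" if "1 \<le> norm x" "0 < k" for k x
  proof -
    have "1 \<le> x \<bullet> x" using that(1) by (simp add: dot_square_norm)
    then show ?thesis using that(2) by (simp add: P_def)
  qed
  have P': "(P (Suc (Suc k)) has_derivative (\<lambda>h. - (2 * real (Suc (Suc k)) * P (Suc k) x * (x \<bullet> h)))) (at x)" for k x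
  proof -
    have "((\<lambda>x. 1 - x \<bullet> x) has_derivative (\<lambda>h. - (2 * (x \<bullet> h)))) (at x)"
      by (auto intro!: derivative_eq_intros simp: inner_commute)
    from has_derivative_compose[OF this DERIV_pos_part_power[unfolded has_field_derivative_def]]
    show ?thesis unfolding P_def by (rule has_derivative_eq_rhs) (simp add: fun_eq_iff)
  qed
  define g where "g x = (- 8 * P 3 x) *\<^sub>R x" for x
  define H :: "real^'d \<Rightarrow> real^'d^'d" where
    "H x = (\<chi> i j. - 8 * P 3 x * of_bool (i = j) + 48 * P 2 x * (x $ i * x $ j))" for x
  have small: "\<bar>x $ i\<bar> \<le> 1" "\<bar>x \<bullet> h\<bar> \<le> norm h" if "norm x < 1" for x h :: "real^'d" and i
  proof -
    show "\<bar>x $ i\<bar> \<le> 1" using component_le_norm_cart[of x i] that by simp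
    show "\<bar>x \<bullet> h\<bar> \<le> norm h"
      using Cauchy_Schwarz_ineq2[of x h] mult_right_mono[of "norm x" 1 "norm h"] that by simp
  qed
  have GH: "GDERIV bump x :> g x" for x
    using P'[of 2 x] unfolding gderiv_def bump_def[abs_def] P_def[abs_def] g_def
    by (simp add: eval_nat_numeral mult_ac inner_commute)
  have gH: "(g has_derivative (\<lambda>h. H x *v h)) (at x)" for x
  proof -
    have "(g has_derivative (\<lambda>h. (- 8 * P 3 x) *\<^sub>R h + (- 8 * - (2 * 3 * P 2 x * (x \<bullet> h))) *\<^sub>R x)) (at x)"
      unfolding g_def using P'[of 1 x]
      by (intro has_derivative_scaleR has_derivative_ident has_derivative_mult_right)
         (simp add: eval_nat_numeral)
    moreover have "(- 8 * P 3 x) *\<^sub>R h + (- 8 * - (2 * 3 * P 2 x * (x \<bullet> h))) *\<^sub>R x = H x *v h" for h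
      unfolding vec_eq_iff
    proof
      fix i
      have "(H x *v h) $ i = (\<Sum>j\<in>UNIV. (if i = j then - 8 * P 3 x * h $ j else 0) + 48 * P 2 x * x $ i * (x $ j * h $ j))"
        unfolding matrix_vector_mult_def H_def vec_lambda_beta
        by (intro sum.cong) (auto simp: algebra_simps)
      also have "\<dots> = - 8 * P 3 x * h $ i + 48 * P 2 x * x $ i * (x \<bullet> h)"
        by (simp only: sum.distrib sum.delta finite inner_vec_def sum_distrib_left inner_real_def) simp
      finally show "((- 8 * P 3 x) *\<^sub>R h + (- 8 * - (2 * 3 * P 2 x * (x \<bullet> h))) *\<^sub>R x) $ i = (H x *v h) $ i"
        by simp
    qed
    ultimately show ?thesis by simp
  qed
  \<comment> \<open>The constant is 48 + 48 + 48 + 192: after expanding the derivative of an entry,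
    four terms remain, and inside the unit ball each of their factors other than \<open>h\<close> is
    at most 1. Outside, all of them vanish.\<close>
  have Hl: "\<bar>H x $ i $ j - H y $ i $ j\<bar> \<le> 336 * norm (x - y)" for x y i j
  proof -
    have "norm (H x $ i $ j - H y $ i $ j) \<le> 336 * norm (x - y)"
    proof (rule differentiable_bound[where f' = "\<lambda>x h. - 8 * - (2 * 3 * P 2 x * (x \<bullet> h)) * of_bool (i = j)
        + (48 * P 2 x * (x $ i * h $ j + h $ i * x $ j) + 48 * - (2 * 2 * P 1 x * (x \<bullet> h)) * (x $ i * x $ j))"])
      fix x :: "real^'d"
      have c: "((\<lambda>x. x $ i) has_derivative (\<lambda>h. h $ i)) (at x)" for i
        by (rule bounded_linear_imp_has_derivative[OF bounded_linear_vec_nth])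
      show "((\<lambda>x. H x $ i $ j) has_derivative (\<lambda>h. - 8 * - (2 * 3 * P 2 x * (x \<bullet> h)) * of_bool (i = j)
        + (48 * P 2 x * (x $ i * h $ j + h $ i * x $ j) + 48 * - (2 * 2 * P 1 x * (x \<bullet> h)) * (x $ i * x $ j)))) (at x)"
        unfolding H_def vec_lambda_beta using P'[of 0 x] P'[of 1 x]
        by (intro has_derivative_add has_derivative_mult_left has_derivative_mult has_derivative_mult_right c)
           (simp_all add: eval_nat_numeral)
      show "onorm (\<lambda>h. - 8 * - (2 * 3 * P 2 x * (x \<bullet> h)) * of_bool (i = j)
        + (48 * P 2 x * (x $ i * h $ j + h $ i * x $ j) + 48 * - (2 * 2 * P 1 x * (x \<bullet> h)) * (x $ i * x $ j))) \<le> 336"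
      proof (rule onorm_le)
        fix h
        show "norm (- 8 * - (2 * 3 * P 2 x * (x \<bullet> h)) * of_bool (i = j)
        + (48 * P 2 x * (x $ i * h $ j + h $ i * x $ j) + 48 * - (2 * 2 * P 1 x * (x \<bullet> h)) * (x $ i * x $ j))) \<le> 336 * norm h"
        proof (cases "norm x < 1")
          case False
          then show ?thesis by (simp add: Pz)
        next
          case True
          have m: "\<bar>a * b\<bar> \<le> c" if "\<bar>a\<bar> \<le> 1" "\<bar>b\<bar> \<le> c" for a b c :: real
            using mult_mono[OF that] that by (simp add: abs_mult)
          have PP: "\<bar>P k x\<bar> \<le> 1" for k using P0[of k x] P1[of k x] by simp
          have t1: "\<bar>P 2 x * (x \<bullet> h)\<bar> \<le> norm h" by (intro m PP small True)
          have t2: "\<bar>P 2 x * (x $ i * h $ j)\<bar> \<le> norm h" "\<bar>P 2 x * (x $ j * h $ i)\<bar> \<le> norm h"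
            by (intro m PP small True component_le_norm_cart)+
          have t3: "\<bar>P 1 x * (x $ i * (x $ j * (x \<bullet> h)))\<bar> \<le> norm h" by (intro m PP small True)
          have t1': "\<bar>48 * P 2 x * (x \<bullet> h) * of_bool (i = j)\<bar> \<le> 48 * norm h"
            using t1 by (auto simp: abs_mult)
          have eq: "- 8 * - (2 * 3 * P 2 x * (x \<bullet> h)) * of_bool (i = j)
        + (48 * P 2 x * (x $ i * h $ j + h $ i * x $ j) + 48 * - (2 * 2 * P 1 x * (x \<bullet> h)) * (x $ i * x $ j))
        = 48 * P 2 x * (x \<bullet> h) * of_bool (i = j) + 48 * (P 2 x * (x $ i * h $ j)) + 48 * (P 2 x * (x $ j * h $ i))
         - 192 * (P 1 x * (x $ i * (x $ j * (x \<bullet> h))))"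
            by (simp add: algebra_simps)
          show ?thesis unfolding eq real_norm_def using t1' t2 t3 by linarith
        qed
      qed
    qed auto
    then show ?thesis by simp
  qed
  have mat: "norm A \<le> (real CARD('d))\<^sup>2 * b" if "\<And>i j. \<bar>A $ i $ j\<bar> \<le> b" for A :: "real^'d^'d" and b
  proof -
    have "norm A \<le> (\<Sum>i\<in>UNIV. norm (A $ i))" unfolding norm_vec_def by (rule L2_set_le_sum) simp
    also have "\<dots> \<le> (\<Sum>i\<in>(UNIV::'d set). \<Sum>j\<in>(UNIV::'d set). b)"
      by (intro sum_mono order_trans[OF norm_le_l1_cart] that)
    finally show ?thesis by (simp add: power2_eq_square mult_ac)
  qed
  define C where "C = (real CARD('d))\<^sup>2 * 336"
  have card: "1 \<le> (real CARD('d))\<^sup>2" by (simp add: Suc_leI)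
  then have C336: "336 \<le> C" by (simp add: C_def)
  have "smooth_bound C (bump :: real^'d \<Rightarrow> real)"
  proof (rule smooth_boundI[OF _ _ _ GH gH])
    show "\<bar>bump x\<bar> \<le> C" for x
      using bump_nonneg[of x] bump_le_1[of x] C336 by linarith
    have "norm (g x) \<le> 8" for x
    proof (cases "norm x < 1")
      case True
      then have "P 3 x * norm x \<le> 1" using P0[of 3 x] P1[of 3 x] by (intro mult_le_one) auto
      then show ?thesis using P0[of 3 x] by (simp add: g_def)
    qed (simp add: g_def Pz)
    then show "norm (g x) \<le> C" for x using C336 by (smt (verit))
    show "norm (H x) \<le> C" for x unfolding C_def
    proof (rule mat)
      fix i j
      show "\<bar>H x $ i $ j\<bar> \<le> 336"
      proof (cases "norm x < 1")
        case True
        have "\<bar>P 2 x * (x $ i * x $ j)\<bar> \<le> 1"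
          unfolding abs_mult using True P0[of 2 x] P1[of 2 x] by (intro mult_le_one small) auto
        moreover have "\<bar>- 8 * P 3 x * of_bool (i = j)\<bar> \<le> 8" using P0[of 3 x] P1[of 3 x] by auto
        ultimately show ?thesis by (simp add: H_def)
      qed (simp add: H_def Pz)
    qed
    show "norm (H x - H y) \<le> C * norm (x - y)" for x y
      unfolding C_def mult.assoc by (rule mat) (use Hl in auto)
  qed
  then show ?thesis by blast
qed

section \<open>Translations and reflections of Lebesgue measure; mollified indicators\<close>

lemma lborel_integral_translation:
  fixes f :: "'a::euclidean_space \<Rightarrow> real"
  assumes [measurable]: "f \<in> borel_measurable borel"
  shows "(LINT y|lborel. f (a + y)) = (LINT y|lborel. f y)"
proof -
  have "(LINT y|lborel. f y) = (LINT y|distr lborel borel ((+) a). f y)"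
    by (simp add: lborel_distr_plus)
  then show ?thesis by (simp add: integral_distr)
qed

lemma lborel_distr_reflection: "distr lborel borel uminus = (lborel :: 'a::euclidean_space measure)"
  using lborel_affine[of "- 1" "0 :: 'a"] by (simp add: density_1)

lemma lborel_integral_reflection:
  fixes f :: "'a::euclidean_space \<Rightarrow> real"
  assumes [measurable]: "f \<in> borel_measurable borel"
  shows "(LINT y|lborel. f (- y)) = (LINT y|lborel. f y)"
  by (subst (2) lborel_distr_reflection[symmetric]) (simp add: integral_distr)

lemma lborel_integrable_reflection:
  fixes f :: "'a::euclidean_space \<Rightarrow> real"
  assumes "integrable lborel f" shows "integrable lborel (\<lambda>y. f (- y))"
proof -
  have [measurable]: "f \<in> borel_measurable borel" using borel_measurable_integrable[OF assms] by simp
  have "integrable (distr lborel borel uminus) f" using assms by (simp add: lborel_distr_reflection)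
  then show ?thesis by (simp add: integrable_distr_eq)
qed

text \<open>Mollification: the indicator of the \<open>e\<close>-neighbourhood \<open>N\<close> of
  \<open>K\<close> is convolved with a bump of radius \<open>e\<close> and divided by the mass
  \<open>c\<close> of the bump. Over a point of \<open>K\<close> the whole bump lies in
  \<open>N\<close>; over a point outside \<open>U\<close> it misses \<open>N\<close>.\<close>

lemma smooth_cutoff:
  fixes K U :: "(real^'d::finite) set"
  assumes "compact K" "open U" "K \<subseteq> U"
  obtains f C where "smooth_bound C f" "\<And>x. 0 \<le> f x" "\<And>x. f x \<le> 1"
    "\<And>x. x \<in> K \<Longrightarrow> f x = 1" "\<And>x. x \<notin> U \<Longrightarrow> f x = 0"
proof -
  obtain r where r: "r > 0" "(\<Union>x\<in>K. ball x r) \<subseteq> U"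
    using compact_subset_open_imp_ball_epsilon_subset[OF assms] by metis
  \<comment> \<open>Half of \<open>r\<close> leaves room for both the neighbourhood and the bump;
    the cap 1 makes the scaling factor \<open>1 / e\<close> at least 1.\<close>
  define e where "e = min 1 (r / 2)"
  have e: "0 < e" "e \<le> 1" "2 * e \<le> r" using r by (auto simp: e_def)
  define N where "N = (\<Union>x\<in>K. ball x e)"
  obtain R where R: "\<And>k. k \<in> K \<Longrightarrow> norm k \<le> R"
    using compact_imp_bounded[OF assms(1)] by (auto simp: bounded_iff)
  have "bounded N" unfolding bounded_iff
  proof (intro exI[of _ "R + e"] ballI)
    fix x assume "x \<in> N"
    then obtain k where "k \<in> K" "dist k x < e" by (auto simp: N_def)
    then show "norm x \<le> R + e"
      using R[of k] norm_triangle_sub[of x k] by (simp add: dist_norm norm_minus_commute)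
  qed
  have N [measurable]: "N \<in> sets borel" unfolding N_def by (intro borel_open open_UN) auto
  define b :: "real^'d \<Rightarrow> real" where "b x = bump ((1 / e) *\<^sub>R x)" for x
  obtain C0 where "smooth_bound C0 (bump :: real^'d \<Rightarrow> real)" using smooth_bound_bump by blast
  from smooth_bound_scale[OF this, of "1 / e"] e obtain C where C: "smooth_bound C b"
    unfolding b_def by auto
  have [measurable]: "b \<in> borel_measurable borel" using C by measurable
  have b0: "0 \<le> b x" "b x \<le> 1" "b (- x) = b x" for x
    using bump_nonneg bump_le_1 bump_minus[of "(1 / e) *\<^sub>R x"] by (auto simp: b_def)
  have bz: "b x = 0" if "e \<le> norm x" for x
    unfolding b_def using that e by (intro bump_eq_0) (simp add: divide_simps)
  have bp: "0 < b x" if "norm x < e" for x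
    unfolding b_def using that e by (intro bump_pos) (simp add: divide_simps)
  have ib: "integrable lborel (\<lambda>y. b (x - y))" for x
  proof (rule Bochner_Integration.integrable_bound)
    show "integrable lborel (indicator (cball x e) :: _ \<Rightarrow> real)"
      by (intro integrable_real_indicator emeasure_bounded_finite) auto
    show "AE y in lborel. norm (b (x - y)) \<le> norm (indicator (cball x e) y :: real)"
    proof (rule AE_I2)
      fix y show "norm (b (x - y)) \<le> norm (indicator (cball x e) y :: real)"
        using bz[of "x - y"] b0[of "x - y"] by (cases "y \<in> cball x e") (simp_all add: dist_norm)
    qed
  qed measurable
  define c where "c = (LINT y|lborel. b y)"
  have cx: "(LINT y|lborel. b (x - y)) = c" for x
    using lborel_integral_reflection[of "\<lambda>y. b (x + y)"] lborel_integral_translation[of b x]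
    by (simp add: c_def)
  have ib0: "integrable lborel b" using ib[of 0] b0(3) by simp
  have "c \<noteq> 0"
  proof
    assume "c = 0"
    then have "AE y in lborel. b y = 0"
      unfolding c_def using integral_nonneg_eq_0_iff_AE[OF ib0] b0 by simp
    then have "AE y in lborel. y \<notin> ball (0::real^'d) e"
    proof (rule eventually_mono)
      fix y assume "b y = 0"
      then show "y \<notin> ball 0 e" using bp[of y] by auto
    qed
    then have "emeasure lborel {y \<in> space lborel. y \<in> ball (0::real^'d) e} = 0"
      by (rule emeasure_eq_0_AE)
    then have "emeasure lborel (ball (0::real^'d) e) = 0"
      by (simp only: space_lborel space_borel UNIV_I simp_thms Collect_mem_eq)
    moreover have "emeasure lborel (ball (0::real^'d) e) \<noteq> 0"
      using e(1) content_ball_pos[of e "0::real^'d"] by (auto simp: measure_def)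
    ultimately show False by simp
  qed
  moreover have "0 \<le> c" unfolding c_def using b0 by (intro Bochner_Integration.integral_nonneg) auto
  ultimately have c: "0 < c" by simp
  define F where "F x = (LINT y|restrict_space lborel N. b (x + - y))" for x
  have Fx: "F x = (LINT y|lborel. indicator N y * b (x - y))" for x
    unfolding F_def by (subst integral_restrict_space) auto
  have iN: "integrable lborel (\<lambda>y. indicator N y * b (x - y))" for x
    using integrable_real_mult_indicator[OF _ ib, of N] by (simp add: mult.commute)
  show ?thesis
  proof (rule that[of "\<bar>1 / c\<bar> * (C * measure (restrict_space lborel N) (space (restrict_space lborel N)))" "\<lambda>x. 1 / c * F x"])
    have "finite_measure (restrict_space lborel N)"
      using emeasure_bounded_finite[OF \<open>bounded N\<close>]
      by (intro finite_measureI) (simp add: space_restrict_space emeasure_restrict_space)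
    then show "smooth_bound (\<bar>1 / c\<bar> * (C * measure (restrict_space lborel N) (space (restrict_space lborel N)))) (\<lambda>x. 1 / c * F x)"
      unfolding F_def by (intro smooth_bound_cmult smooth_bound_integral_translates C measurable_restrict_space1) auto
    fix x
    show "0 \<le> 1 / c * F x" unfolding Fx using c b0 by (intro mult_nonneg_nonneg Bochner_Integration.integral_nonneg) auto
    have "F x \<le> c" unfolding Fx cx[of x, symmetric]
      using b0 by (intro integral_mono ib iN) (simp add: indicator_def)
    then show "1 / c * F x \<le> 1" using c by (simp add: divide_simps)
    show "1 / c * F x = 1" if "x \<in> K"
    proof -
      have "indicator N y * b (x - y) = b (x - y)" for y
        using that bz[of "x - y"] by (cases "y \<in> N") (auto simp: N_def dist_norm not_less)
      then have "F x = c" by (simp only: Fx cx)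
      then show ?thesis using c by simp
    qed
    show "1 / c * F x = 0" if "x \<notin> U"
    proof -
      have "indicator N y * b (x - y) = 0" for y
      proof (cases "y \<in> N")
        case True
        then obtain k where k: "k \<in> K" "dist k y < e" by (auto simp: N_def)
        then have "x \<notin> ball k r" using r that by blast
        then have "e \<le> norm (x - y)"
          using k e dist_triangle[of k x y] by (auto simp: dist_norm norm_minus_commute)
        then show ?thesis using bz by simp
      qed simp
      then have "F x = 0" by (simp only: Fx) simp
      then show ?thesis by simp
    qed
  qed
qed

text \<open>The supports shrink to \<open>K\<close> because a point off the closed set
  \<open>K\<close> has positive distance from it. The smoothness constants may grow with
  \<open>k\<close>, so whatever is derived from the sequence must not depend on them.\<close>

lemma smooth_cutoff_sequence:
  fixes K U :: "(real^'d::finite) set"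
  assumes "compact K" "open U" "K \<subseteq> U"
  obtains g :: "nat \<Rightarrow> real^'d \<Rightarrow> real"
  where "\<And>k. \<exists>C. smooth_bound C (g k)" "\<And>k x. 0 \<le> g k x" "\<And>k x. g k x \<le> 1"
    "\<And>k x. x \<in> K \<Longrightarrow> g k x = 1" "\<And>k x. x \<notin> U \<Longrightarrow> g k x = 0"
    "\<And>x. (\<lambda>k. g k x) \<longlonglongrightarrow> indicator K x"
proof (cases "K = {}")
  case True
  show ?thesis by (rule that[of "\<lambda>_ _. 0"]) (use True smooth_bound_const[of 0] in auto)
next
  case False
  have "\<exists>g. (\<exists>C. smooth_bound C g) \<and> (\<forall>x. 0 \<le> g x \<and> g x \<le> 1) \<and> (\<forall>x\<in>K. g x = 1) \<and>
      (\<forall>x. x \<notin> U \<or> 1 / Suc k \<le> infdist x K \<longrightarrow> g x = 0)" for k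
  proof -
    have o: "open (U \<inter> {x. infdist x K < 1 / Suc k})"
      by (intro open_Int assms open_Collect_less continuous_intros)
    have s: "K \<subseteq> U \<inter> {x. infdist x K < 1 / Suc k}" using assms(3) by auto
    obtain g C where "smooth_bound C g" "\<And>x. 0 \<le> g x" "\<And>x. g x \<le> 1"
       "\<And>x. x \<in> K \<Longrightarrow> g x = 1" "\<And>x. x \<notin> U \<inter> {x. infdist x K < 1 / Suc k} \<Longrightarrow> g x = 0"
      by (rule smooth_cutoff[OF assms(1) o s]) blast
    then show ?thesis by (intro exI[of _ g]) (auto simp: not_less)
  qed
  then obtain g where g: "\<And>k. \<exists>C. smooth_bound C (g k)" "\<And>k x. 0 \<le> g k x" "\<And>k x. g k x \<le> 1"
      "\<And>k x. x \<in> K \<Longrightarrow> g k x = 1" "\<And>k x. x \<notin> U \<Longrightarrow> g k x = 0"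
      "\<And>k x. 1 / Suc k \<le> infdist x K \<Longrightarrow> g k x = 0"
    by metis
  have "(\<lambda>k. g k x) \<longlonglongrightarrow> indicator K x" for x
  proof (cases "x \<in> K")
    case True
    then show ?thesis using g(4) by simp
  next
    case F: False
    then have "0 < infdist x K"
      using in_closed_iff_infdist_zero[OF compact_imp_closed[OF assms(1)] False] infdist_nonneg[of x K]
      by (simp add: less_le)
    then have "\<forall>\<^sub>F k in sequentially. 1 / Suc k < infdist x K"
      using order_tendstoD(2)[OF LIMSEQ_inverse_real_of_nat] by (simp add: inverse_eq_divide)
    then have "\<forall>\<^sub>F k in sequentially. g k x = indicator K x"
      by eventually_elim (use g(6) F in auto)
    then show ?thesis by (rule tendsto_eventually)
  qed
  then show ?thesis by (intro that[of g] g(1-5))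
qed

section \<open>The operator\<close>

text \<open>Dyadic shells: the part with norm at least 1 is dominated by a geometric series with
  ratio \<open>2 powr - a\<close>, the part near 0 by one with ratio \<open>2 powr (a - 2)\<close>.
  The two bounds on \<open>a\<close> are exactly what makes both converge.\<close>

lemma integrable_levy_tail:
  fixes a :: real
  assumes "0 < a" "a < 2"
  shows "integrable lborel (\<lambda>h :: real^'d::finite. min 1 ((norm h)\<^sup>2) * norm h powr (- real CARD('d) - a))"
    (is "integrable lborel ?f")
proof (rule integrableI_bounded)
  let ?d = "real CARD('d)"
  let ?v = "unit_ball_vol ?d"
  have vol: "emeasure lborel (cball (0::real^'d) r) = ennreal (?v * r powr ?d)" if "0 < r" for r
    using emeasure_cball[of r "0::real^'d"] that by (simp add: powr_realpow)
  \<comment> \<open>\<open>A k\<close> covers the shell between radii \<open>2 powr k\<close> and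
    \<open>2 powr (k + 1)\<close>, and \<open>B k\<close> the one between
    \<open>2 powr (- k - 1)\<close> and \<open>2 powr (- k)\<close>. Full balls replace shells,
    which costs only a constant factor and makes the volumes explicit.\<close>
  define A where "A k h = ennreal (2 powr (real k * (- ?d - a))) * indicator (cball 0 (2 powr (real k + 1))) h" for k and h :: "real^'d"
  define B where "B k h = ennreal (2 powr (- 2 * real k) * 2 powr ((- real k - 1) * (- ?d - a))) * indicator (cball 0 (2 powr (- real k))) h" for k and h :: "real^'d"
  have le: "ennreal (norm (?f h)) \<le> (\<Sum>k. A k h) + (\<Sum>k. B k h)" for h
  proof (cases "h = 0")
    case False
    define l where "l = log 2 (norm h)"
    have l: "norm h = 2 powr l" using False by (simp add: l_def)
    show ?thesis
    proof (cases "1 \<le> norm h")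
      case True
      then have l0: "0 \<le> l" using False by (simp add: l_def)
      define k where "k = nat \<lfloor>l\<rfloor>"
      have k: "real k \<le> l" "l \<le> real k + 1" using l0 by (auto simp: k_def; linarith)+
      have "norm (?f h) = 2 powr (l * (- ?d - a))" using True by (simp add: l powr_powr)
      also have "\<dots> \<le> 2 powr (real k * (- ?d - a))"
        using k(1) assms by (intro powr_mono mult_right_mono_neg) auto
      finally have "ennreal (norm (?f h)) \<le> A k h"
        using k(2) by (simp add: A_def l ennreal_leI)
      also have "\<dots> \<le> (\<Sum>k. A k h)" using sum_le_suminf[of "\<lambda>k. A k h" "{k}"] by simp
      finally show ?thesis by (simp add: add_increasing2)
    next
      case F: False
      then have l0: "l < 0" using False by (simp add: l_def)
      define k where "k = nat \<lfloor>- l\<rfloor>"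
      have k: "real k \<le> - l" "- l \<le> real k + 1" using l0 by (auto simp: k_def; linarith)+
      have sq: "(norm h)\<^sup>2 = 2 powr (2 * l)"
        by (simp add: l power2_eq_square flip: powr_add)
      have lt: "(norm h)\<^sup>2 \<le> 1" using F by (intro power_le_one) auto
      have "norm (?f h) = 2 powr (2 * l) * 2 powr (l * (- ?d - a))"
        unfolding sq[symmetric] using lt by (simp add: l powr_powr abs_mult)
      also have "\<dots> \<le> 2 powr (- 2 * real k) * 2 powr ((- real k - 1) * (- ?d - a))"
      proof -
        have e: "2 * l \<le> - 2 * real k" "l * (- ?d - a) \<le> (- real k - 1) * (- ?d - a)"
          using k assms by (auto intro: mult_right_mono_neg)
        show ?thesis by (rule mult_mono[OF powr_mono[OF e(1)] powr_mono[OF e(2)]]) auto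
      qed
      finally have "ennreal (norm (?f h)) \<le> B k h"
        using k(1) by (simp add: B_def l ennreal_leI)
      also have "\<dots> \<le> (\<Sum>k. B k h)" using sum_le_suminf[of "\<lambda>k. B k h" "{k}"] by simp
      finally show ?thesis by (simp add: add_increasing)
    qed
  qed simp
  have [measurable]: "A k \<in> borel_measurable borel" "B k \<in> borel_measurable borel" for k
  proof -
    have "(\<lambda>h. c * indicator (cball (0::real^'d) r) h) \<in> borel_measurable borel" for c :: ennreal and r :: real
      by (intro borel_measurable_times_ennreal borel_measurable_const borel_measurable_indicator borel_closed) auto
    then show "A k \<in> borel_measurable borel" "B k \<in> borel_measurable borel"
      unfolding A_def B_def by blast+
  qed
  have eA: "(\<integral>\<^sup>+h. A k h \<partial>lborel) = ennreal (?v * 2 powr ?d * (2 powr - a) ^ k)" for k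
  proof -
    have "(\<integral>\<^sup>+h. A k h \<partial>lborel) = ennreal (2 powr (real k * (- ?d - a)) * (?v * (2 powr (real k + 1)) powr ?d))"
      unfolding A_def by (subst nn_integral_cmult_indicator) (auto simp: vol ennreal_mult)
    also have "2 powr (real k * (- ?d - a)) * (?v * (2 powr (real k + 1)) powr ?d)
       = ?v * (2 powr (real k * (- ?d - a)) * 2 powr ((real k + 1) * ?d))"
      by (simp add: powr_powr)
    also have "\<dots> = ?v * 2 powr (?d + - a * real k)"
      by (simp only: powr_add[symmetric]) (simp add: algebra_simps)
    also have "\<dots> = ?v * 2 powr ?d * (2 powr - a) ^ k"
      by (simp only: powr_add powr_realpow[symmetric] powr_powr) (simp add: powr_powr flip: powr_realpow)
    finally show ?thesis .
  qed
  have eB: "(\<integral>\<^sup>+h. B k h \<partial>lborel) = ennreal (?v * 2 powr (?d + a) * (2 powr (a - 2)) ^ k)" for k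
  proof -
    have "(\<integral>\<^sup>+h. B k h \<partial>lborel) = ennreal (2 powr (- 2 * real k) * 2 powr ((- real k - 1) * (- ?d - a)) * (?v * (2 powr (- real k)) powr ?d))"
      unfolding B_def by (subst nn_integral_cmult_indicator) (auto simp: vol ennreal_mult)
    also have "2 powr (- 2 * real k) * 2 powr ((- real k - 1) * (- ?d - a)) * (?v * (2 powr (- real k)) powr ?d)
       = ?v * (2 powr (- 2 * real k) * 2 powr ((- real k - 1) * (- ?d - a)) * 2 powr (- real k * ?d))"
      by (simp add: powr_powr)
    also have "\<dots> = ?v * 2 powr ((?d + a) + (a - 2) * real k)"
      by (simp only: powr_add[symmetric]) (simp add: algebra_simps)
    also have "\<dots> = ?v * 2 powr (?d + a) * (2 powr (a - 2)) ^ k"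
      by (simp only: powr_add powr_realpow[symmetric] powr_powr) (simp add: powr_powr flip: powr_realpow)
    finally show ?thesis .
  qed
  have "(\<integral>\<^sup>+h. ennreal (norm (?f h)) \<partial>lborel) \<le> (\<integral>\<^sup>+h. (\<Sum>k. A k h) + (\<Sum>k. B k h) \<partial>lborel)"
    by (intro nn_integral_mono le)
  also have "\<dots> = (\<Sum>k. \<integral>\<^sup>+h. A k h \<partial>lborel) + (\<Sum>k. \<integral>\<^sup>+h. B k h \<partial>lborel)"
    by (simp add: nn_integral_add nn_integral_suminf)
  also have "\<dots> = (\<Sum>k. ennreal (?v * 2 powr ?d * (2 powr - a) ^ k)) + (\<Sum>k. ennreal (?v * 2 powr (?d + a) * (2 powr (a - 2)) ^ k))"
    by (simp only: eA eB)
  also have "\<dots> < \<infinity>"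
  proof -
    have "summable (\<lambda>k. ?v * 2 powr ?d * (2 powr - a) ^ k)" "summable (\<lambda>k. ?v * 2 powr (?d + a) * (2 powr (a - 2)) ^ k)"
      using assms powr_less_mono[of "- a" 0 2] powr_less_mono[of "a - 2" 0 2]
      by (auto intro!: summable_mult summable_geometric)
    then have "(\<Sum>k. ennreal (?v * 2 powr ?d * (2 powr - a) ^ k)) \<noteq> top" "(\<Sum>k. ennreal (?v * 2 powr (?d + a) * (2 powr (a - 2)) ^ k)) \<noteq> top"
      by (auto simp: suminf_ennreal2)
    then show ?thesis by (simp add: less_top)
  qed
  finally show "(\<integral>\<^sup>+h. ennreal (norm (?f h)) \<partial>lborel) < \<infinity>" .
qed measurable

text \<open>The even part in \<open>h\<close> of the increment of \<open>f\<close>. A first-order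
  term is odd and drops out, so against an even kernel this replaces the compensated increment and
  needs no gradient.\<close>

definition second_diff :: "(real^'d::finite \<Rightarrow> real) \<Rightarrow> real^'d \<Rightarrow> real^'d \<Rightarrow> real" where
  "second_diff f x h = (f (x + h) + f (x - h)) / 2 - f x"

lemma second_diff_bounds:
  assumes "\<And>x. l \<le> f x" "\<And>x. f x \<le> u" shows "\<bar>second_diff f x h\<bar> \<le> u - l"
proof -
  have "\<bar>(a + b) / 2 - c\<bar> \<le> u - l" if "l \<le> a" "l \<le> b" "l \<le> c" "a \<le> u" "b \<le> u" "c \<le> u" for a b c :: real
    using that by (intro abs_leI) (simp_all add: field_simps)
  then show ?thesis unfolding second_diff_def using assms by blast
qed

lemma second_diff_le:
  assumes "smooth_bound C f" shows "\<bar>second_diff f x h\<bar> \<le> 2 * C * min 1 ((norm h)\<^sup>2)"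
proof -
  obtain g where g: "\<And>x h. \<bar>f (x + h) - f x - g x \<bullet> h\<bar> \<le> C * (norm h)\<^sup>2"
    using assms by (elim smooth_boundE) blast
  have *: "0 \<le> C * (norm h)\<^sup>2" using smooth_bound_nonneg[OF assms] by simp
  have "\<bar>second_diff f x h\<bar> \<le> C * (norm h)\<^sup>2"
    using abs_le_D1[OF g[of x h]] abs_le_D2[OF g[of x h]] abs_le_D1[OF g[of x "- h"]] abs_le_D2[OF g[of x "- h"]]
    unfolding second_diff_def by (intro abs_leI) (simp_all add: field_simps)
  moreover have "\<bar>second_diff f x h\<bar> \<le> 2 * C"
    using second_diff_bounds[of "- C" f C x h] smooth_bound_abs_le[OF assms] by (simp add: abs_le_iff minus_le_iff)
  ultimately show ?thesis using * by (cases "1 \<le> (norm h)\<^sup>2") (simp_all add: min_def)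
qed

lemma measurable_second_diff [measurable]:
  assumes [measurable]: "f \<in> borel_measurable borel" shows "second_diff f x \<in> borel_measurable borel"
  unfolding second_diff_def[abs_def] by measurable

lemma smooth_bound_gradient:
  assumes "smooth_bound C f"
  shows "\<bar>f (x + h) - f x - gradient f x \<bullet> h\<bar> \<le> C * (norm h)\<^sup>2"
proof -
  obtain g where g: "\<And>x h. \<bar>f (x + h) - f x - g x \<bullet> h\<bar> \<le> C * (norm h)\<^sup>2" "\<And>x. GDERIV f x :> g x"
    using assms by (elim smooth_boundE) blast
  have "gradient f x = g x" unfolding gradient_def
  proof (rule the_equality)
    fix D assume "GDERIV f x :> D"
    then have "(\<lambda>h. D \<bullet> h) = (\<lambda>h. g x \<bullet> h)"
      using g(2)[of x] has_derivative_unique unfolding gderiv_def by (metis (no_types) inner_commute)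
    then show "D = g x" by (metis vector_eq_rdot)
  qed (rule g(2))
  then show ?thesis using g(1)[of x h] by simp
qed

locale stable_like =
  fixes n :: "real^'d::finite \<Rightarrow> real^'d \<Rightarrow> real" and \<kappa> \<alpha> :: real
  assumes n_meas [measurable]: "n x \<in> borel_measurable borel"
    and n_sym: "h \<noteq> 0 \<Longrightarrow> n x (- h) = n x h"
    and kappa: "0 < \<kappa>" and alpha: "0 < \<alpha>" "\<alpha> < 2"
    and n_lower: "h \<noteq> 0 \<Longrightarrow> \<kappa> * norm h powr (- real CARD('d) - \<alpha>) \<le> n x h"
    and n_upper: "h \<noteq> 0 \<Longrightarrow> n x h \<le> inverse \<kappa> * norm h powr (- real CARD('d) - \<alpha>)"
    and n_close: "0 < b \<Longrightarrow> 0 < e \<Longrightarrow> \<exists>\<delta>>0. \<forall>x. dist x y < \<delta> \<longrightarrow> (\<forall>h. h \<noteq> 0 \<and> norm h \<le> b \<longrightarrow> \<bar>n x h - n y h\<bar> \<le> e)"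
begin

text \<open>An integrable majorant, common to all \<open>x\<close>, of the kernel weighted by
  \<open>min 1 ((norm h)\<^sup>2)\<close>. The weight is indispensable: the kernels themselves are
  not integrable near 0.\<close>

definition levy :: "real^'d \<Rightarrow> real" where
  "levy h = inverse \<kappa> * (min 1 ((norm h)\<^sup>2) * norm h powr (- real CARD('d) - \<alpha>))"

lemma levy_integrable: "integrable lborel levy"
  unfolding levy_def[abs_def] using alpha by (intro integrable_mult_right integrable_levy_tail)

lemma levy_measurable [measurable]: "levy \<in> borel_measurable borel"
  using borel_measurable_integrable[OF levy_integrable] by simp

lemma levy_nonneg: "0 \<le> levy h" using kappa by (simp add: levy_def)

lemma n_nonneg: "h \<noteq> 0 \<Longrightarrow> 0 \<le> n x h"
  using n_lower[of h x] kappa by (meson mult_nonneg_nonneg less_imp_le order_trans powr_ge_zero)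

lemma n_levy: "h \<noteq> 0 \<Longrightarrow> min 1 ((norm h)\<^sup>2) * n x h \<le> levy h"
  using mult_left_mono[OF n_upper[of h x], of "min 1 ((norm h)\<^sup>2)"] by (simp add: levy_def mult_ac)

lemma AE_lborel_nonzero: "AE h in lborel. (h::real^'d) \<noteq> 0"
  by (rule AE_lborel_singleton)

lemma second_diff_n_le:
  assumes "smooth_bound C f" shows "\<bar>second_diff f x h * n y h\<bar> \<le> 2 * C * levy h"
proof (cases "h = 0")
  case True
  then show ?thesis using smooth_bound_nonneg[OF assms(1)] levy_nonneg by (simp add: second_diff_def)
next
  case False
  have "\<bar>second_diff f x h * n y h\<bar> = \<bar>second_diff f x h\<bar> * n y h"
    using n_nonneg[OF False] by (simp add: abs_mult)
  also have "\<dots> \<le> 2 * C * min 1 ((norm h)\<^sup>2) * n y h"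
    by (intro mult_right_mono second_diff_le assms n_nonneg False)
  also have "\<dots> \<le> 2 * C * levy h"
    unfolding mult.assoc using n_levy[OF False, of y] smooth_bound_nonneg[OF assms(1)]
    by (intro mult_left_mono) auto
  finally show ?thesis .
qed

lemma second_diff_n_integrable:
  assumes "smooth_bound C f" shows "integrable lborel (\<lambda>h. second_diff f x h * n y h)"
proof (rule Bochner_Integration.integrable_bound)
  note [measurable] = smooth_bound_measurable[OF assms]
  show "integrable lborel (\<lambda>h. 2 * C * levy h)" using levy_integrable by simp
  show "(\<lambda>h. second_diff f x h * n y h) \<in> borel_measurable lborel" by measurable
  show "AE h in lborel. norm (second_diff f x h * n y h) \<le> norm (2 * C * levy h)"
    by (intro AE_I2) (use second_diff_n_le[OF assms] smooth_bound_nonneg[OF assms] levy_nonneg in \<open>simp add: abs_mult\<close>)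
qed

definition sym_generator :: "(real^'d \<Rightarrow> real) \<Rightarrow> real^'d \<Rightarrow> real" where
  "sym_generator f x = (LINT h|lborel. second_diff f x h * n x h)"

text \<open>Averaging the integrand \<open>G\<close> over \<open>h\<close> and \<open>- h\<close>
  leaves the integral unchanged and cancels the gradient term, because \<open>n x\<close> is even.
  Splitting the integral requires \<open>G\<close> to be integrable, which follows from the
  quadratic remainder for short \<open>h\<close> and boundedness for long \<open>h\<close>.\<close>

lemma generator_eq:
  assumes "smooth_bound C f" shows "generator n f x = sym_generator f x"
proof -
  note [measurable] = smooth_bound_measurable[OF assms]
  define G where "G h = indicator (- {0}) h *\<^sub>R ((f (x + h) - f x - (gradient f x \<bullet> h) * indicator {h. norm h \<le> 1} h) * n x h)" for h
  have [measurable]: "G \<in> borel_measurable borel" unfolding G_def by measurable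
  have C: "0 \<le> C" by (rule smooth_bound_nonneg[OF assms])
  have "\<bar>f (x + h) - f x - (gradient f x \<bullet> h) * indicator {h. norm h \<le> 1} h\<bar> \<le> 2 * C * min 1 ((norm h)\<^sup>2)" for h
  proof (cases "norm h \<le> 1")
    case True
    then have "(norm h)\<^sup>2 \<le> 1" by (simp add: power_le_one)
    moreover have "0 \<le> C * (norm h)\<^sup>2" using C by simp
    ultimately show ?thesis using True smooth_bound_gradient[OF assms, of x h] by (simp add: min_def)
  next
    case False
    then have "1 \<le> (norm h)\<^sup>2" by (simp add: one_le_power)
    moreover have "\<bar>f (x + h) - f x\<bar> \<le> 2 * C"
      using smooth_bound_abs_le[OF assms, of x] smooth_bound_abs_le[OF assms, of "x + h"] by linarith
    ultimately show ?thesis using False by (simp add: min_def)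
  qed
  then have "\<bar>G h\<bar> \<le> 2 * C * levy h" for h
  proof (cases "h = 0")
    case False
    have "\<bar>G h\<bar> = \<bar>f (x + h) - f x - (gradient f x \<bullet> h) * indicator {h. norm h \<le> 1} h\<bar> * n x h"
      using n_nonneg[OF False] False by (simp add: G_def abs_mult)
    also have "\<dots> \<le> 2 * C * min 1 ((norm h)\<^sup>2) * n x h"
      by (intro mult_right_mono n_nonneg False) fact
    also have "\<dots> \<le> 2 * C * levy h"
      unfolding mult.assoc using n_levy[OF False, of x] C by (intro mult_left_mono) auto
    finally show ?thesis .
  qed (use C levy_nonneg in \<open>simp add: G_def\<close>)
  then have int: "integrable lborel G"
    by (intro Bochner_Integration.integrable_bound[OF integrable_mult_right[OF levy_integrable, of "2 * C"]])
       (use C levy_nonneg in \<open>auto simp: abs_mult\<close>)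
  have int': "integrable lborel (\<lambda>h. G (- h))"
    using int by (rule lborel_integrable_reflection)
  have "generator n f x = (LINT h|lborel. G h)"
    by (simp add: generator_def set_lebesgue_integral_def G_def)
  also have "\<dots> = ((LINT h|lborel. G h) + (LINT h|lborel. G (- h))) / 2"
    by (simp add: lborel_integral_reflection)
  also have "\<dots> = (LINT h|lborel. (G h + G (- h)) / 2)"
    using int int' by simp
  also have "\<dots> = sym_generator f x" unfolding sym_generator_def
  proof (rule integral_cong_AE)
    show "AE h in lborel. (G h + G (- h)) / 2 = second_diff f x h * n x h"
      using AE_lborel_nonzero
    proof eventually_elim
      fix h :: "real^'d" assume "h \<noteq> 0"
      then show "(G h + G (- h)) / 2 = second_diff f x h * n x h"
        using n_sym[of h x] by (simp add: G_def second_diff_def field_simps indicator_def)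
    qed
  qed auto
  finally show ?thesis .
qed

definition levy_mass :: real where "levy_mass = (LINT h|lborel. levy h)"

lemma levy_mass_nonneg: "0 \<le> levy_mass"
  unfolding levy_mass_def by (intro Bochner_Integration.integral_nonneg levy_nonneg)

lemma sym_generator_bound: assumes "smooth_bound C f" shows "\<bar>sym_generator f x\<bar> \<le> 2 * C * levy_mass"
proof -
  have "norm (sym_generator f x) \<le> (LINT h|lborel. 2 * C * levy h)" unfolding sym_generator_def
  proof (rule Bochner_Integration.integral_norm_bound_integral)
    show "norm (second_diff f x h * n x h) \<le> 2 * C * levy h" for h
      using second_diff_n_le[OF assms] by simp
  qed (use levy_integrable second_diff_n_integrable[OF assms] in auto)
  then show ?thesis by (simp add: levy_mass_def)
qed

lemma n_continuous:
  assumes "h \<noteq> 0" shows "continuous_on UNIV (\<lambda>x. n x h)"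
proof (rule continuous_at_imp_continuous_on, safe)
  fix y show "isCont (\<lambda>x. n x h) y"
    unfolding continuous_at_eps_delta
  proof (intro allI impI)
    fix e :: real assume "0 < e"
    from n_close[of "norm h" "e / 2" y] assms this obtain \<delta> where "0 < \<delta>"
      "\<forall>x. dist x y < \<delta> \<longrightarrow> \<bar>n x h - n y h\<bar> \<le> e / 2" by auto
    then show "\<exists>d>0. \<forall>x. dist x y < d \<longrightarrow> dist (n x h) (n y h) < e"
      using \<open>0 < e\<close> by (intro exI[of _ \<delta>]) (force simp: dist_real_def)
  qed
qed

text \<open>Needed for the measurability of the drift along paths. Dominated convergence applies
  because the majorant \<open>2 * C * levy\<close> does not depend on the point.\<close>

lemma sym_generator_continuous: assumes "smooth_bound C f" shows "continuous_on UNIV (sym_generator f)"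
  unfolding continuous_on_sequentially
proof (intro allI ballI impI)
  fix X :: "nat \<Rightarrow> real^'d" and x assume X: "(\<forall>i. X i \<in> UNIV) \<and> X \<longlonglongrightarrow> x"
  note [measurable] = smooth_bound_measurable[OF assms]
  have "(\<lambda>i. LINT h|lborel. second_diff f (X i) h * n (X i) h) \<longlonglongrightarrow> (LINT h|lborel. second_diff f x h * n x h)"
  proof (rule integral_dominated_convergence[where w = "\<lambda>h. 2 * C * levy h"])
    show "AE h in lborel. (\<lambda>i. second_diff f (X i) h * n (X i) h) \<longlonglongrightarrow> second_diff f x h * n x h"
      using AE_lborel_nonzero
    proof eventually_elim
      fix h :: "real^'d" assume h: "h \<noteq> 0"
      have f: "continuous_on UNIV f" using assms by (rule smooth_bound_continuous)
      have lim: "(\<lambda>i. F (Y i)) \<longlonglongrightarrow> F y" if "continuous_on UNIV F" "Y \<longlonglongrightarrow> y" for F :: "real^'d \<Rightarrow> real" and Y y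
        using continuous_on_tendsto_compose[OF that] by simp
      show "(\<lambda>i. second_diff f (X i) h * n (X i) h) \<longlonglongrightarrow> second_diff f x h * n x h"
        unfolding second_diff_def using X
        by (intro tendsto_intros lim[OF f] lim[OF n_continuous[OF h]]) auto
    qed
    show "AE h in lborel. norm (second_diff f (X i) h * n (X i) h) \<le> 2 * C * levy h" for i
      using second_diff_n_le[OF assms] by simp
  qed (use levy_integrable in auto)
  then show "(sym_generator f \<circ> X) \<longlonglongrightarrow> sym_generator f x" by (simp add: sym_generator_def o_def)
qed

end

text \<open>The logarithmic weight is at least 1, so a bound on the weighted difference also bounds
  the unweighted one. The case \<open>x = y\<close> is separate because the limit is taken over
  punctured neighbourhoods.\<close>

lemma stable_like_kernel_imp:
  assumes "stable_like_kernel n" obtains \<kappa> \<alpha> where "stable_like n \<kappa> \<alpha>"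
proof -
  obtain \<kappa> \<alpha> where ka: "0 < \<kappa> \<and> \<kappa> < 1 \<and> 0 < \<alpha> \<and> \<alpha> < 2 \<and>
        (\<forall>x h. h \<noteq> 0 \<longrightarrow>
           \<kappa> * norm h powr (- real CARD('a) - \<alpha>) \<le> n x h \<and>
           n x h \<le> inverse \<kappa> * norm h powr (- real CARD('a) - \<alpha>))"
    using assms unfolding stable_like_kernel_def by blast
  obtain \<eta> where eta: "0 < \<eta>" and lim': "\<forall>y. \<forall>b>0.
        ((\<lambda>x. SUP h\<in>{h. h \<noteq> 0 \<and> norm h \<le> b}.
            ennreal \<bar>n x h * log_weight \<eta> (norm h) - n y h * log_weight \<eta> (norm h)\<bar>) \<longlongrightarrow> 0) (at y)"
    using assms unfolding stable_like_kernel_def by blast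
  have lim: "((\<lambda>x. SUP h\<in>{h. h \<noteq> 0 \<and> norm h \<le> b}.
            ennreal \<bar>n x h * log_weight \<eta> (norm h) - n y h * log_weight \<eta> (norm h)\<bar>) \<longlongrightarrow> 0) (at y)"
    if "0 < b" for b y using lim' that by blast
  have 1: "n x \<in> borel_measurable borel" "h \<noteq> 0 \<Longrightarrow> n x (- h) = n x h" for x h
    using assms unfolding stable_like_kernel_def by blast+
  have "\<exists>\<delta>>0. \<forall>x. dist x y < \<delta> \<longrightarrow> (\<forall>h. h \<noteq> 0 \<and> norm h \<le> b \<longrightarrow> \<bar>n x h - n y h\<bar> \<le> e)"
    if "0 < b" "0 < e" for b e y
  proof -
    have "\<forall>\<^sub>F x in at y. (SUP h\<in>{h. h \<noteq> 0 \<and> norm h \<le> b}.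
            ennreal \<bar>n x h * log_weight \<eta> (norm h) - n y h * log_weight \<eta> (norm h)\<bar>) < ennreal e"
      using order_tendstoD(2)[OF lim[OF that(1)], of "ennreal e" y] that(2) by simp
    then obtain \<delta> where \<delta>: "0 < \<delta>" "\<And>x. x \<noteq> y \<Longrightarrow> dist x y < \<delta> \<Longrightarrow> (SUP h\<in>{h. h \<noteq> 0 \<and> norm h \<le> b}.
            ennreal \<bar>n x h * log_weight \<eta> (norm h) - n y h * log_weight \<eta> (norm h)\<bar>) < ennreal e"
      unfolding eventually_at by blast
    have "\<bar>n x h - n y h\<bar> \<le> e" if x: "dist x y < \<delta>" and h: "h \<noteq> 0" "norm h \<le> b" for x h
    proof (cases "x = y")
      case False
      have w: "1 \<le> log_weight \<eta> (norm h)"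
        unfolding log_weight_def using eta by (intro ge_one_powr_ge_zero) auto
      have "ennreal \<bar>n x h * log_weight \<eta> (norm h) - n y h * log_weight \<eta> (norm h)\<bar> \<le> ennreal e"
        using \<delta>(2)[OF False x] h by (intro order_trans[OF SUP_upper less_imp_le]) auto
      then have "\<bar>n x h * log_weight \<eta> (norm h) - n y h * log_weight \<eta> (norm h)\<bar> \<le> e"
        using \<open>0 < e\<close> by simp
      moreover have "n x h * log_weight \<eta> (norm h) - n y h * log_weight \<eta> (norm h) = (n x h - n y h) * log_weight \<eta> (norm h)"
        by (simp add: algebra_simps)
      ultimately show ?thesis
        using mult_left_mono[OF w, of "\<bar>n x h - n y h\<bar>"] w by (simp add: abs_mult)
    qed (use \<open>0 < e\<close> in simp)
    then show ?thesis using \<delta>(1) by blast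
  qed
  then show ?thesis
    using 1 ka by (intro that[of \<kappa> \<alpha>]) (unfold_locales; blast)
qed

section \<open>Approximate resolvents\<close>

definition bounded_measurable :: "('a::topological_space \<Rightarrow> real) \<Rightarrow> bool" where
  "bounded_measurable f \<longleftrightarrow> f \<in> borel_measurable borel \<and> (\<exists>b. \<forall>x. \<bar>f x\<bar> \<le> b)"

lemma bounded_measurableI: "f \<in> borel_measurable borel \<Longrightarrow> (\<And>x. \<bar>f x\<bar> \<le> b) \<Longrightarrow> bounded_measurable f"
  by (auto simp: bounded_measurable_def)

lemma smooth_bound_bounded_measurable: "smooth_bound C f \<Longrightarrow> bounded_measurable f"
  by (intro bounded_measurableI[of _ C] smooth_bound_measurable smooth_bound_abs_le)

locale jump_operator = finite_measure \<nu> for \<nu> :: "'a::euclidean_space measure" +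
  assumes sets_nu [measurable_cong, simp]: "sets \<nu> = sets borel"
begin

text \<open>The operator \<open>f \<mapsto> A f - m * f\<close> generates the compound Poisson process with jump measure \<open>\<nu>\<close>,
  and \<open>U l N\<close> below is the truncated Neumann series of its resolvent \<open>(l + m - A)\<^sup>-\<^sup>1\<close>.\<close>

definition m :: real where "m = measure \<nu> (space \<nu>)"

definition A :: "('a \<Rightarrow> real) \<Rightarrow> 'a \<Rightarrow> real" where "A f x = (LINT h|\<nu>. f (x + h))"

lemma m_nonneg: "0 \<le> m" by (simp add: m_def)

lemma integrable_translate:
  assumes "bounded_measurable f" shows "integrable \<nu> (\<lambda>h. f (x + h))"
proof -
  obtain b where b: "\<And>x. \<bar>f x\<bar> \<le> b" and [measurable]: "f \<in> borel_measurable borel"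
    using assms by (auto simp: bounded_measurable_def)
  show ?thesis by (rule integrable_const_bound[of _ b]) (use b in auto)
qed

lemma A_mono:
  assumes "bounded_measurable f" "bounded_measurable g" "\<And>x. f x \<le> g x"
  shows "A f x \<le> A g x"
  unfolding A_def using assms by (intro integral_mono integrable_translate) auto

lemma A_const: "A (\<lambda>_. c) x = c * m"
  by (simp add: A_def m_def mult.commute)

lemma A_abs_le:
  assumes "bounded_measurable f" "\<And>x. \<bar>f x\<bar> \<le> b" shows "\<bar>A f x\<bar> \<le> b * m"
proof -
  have c: "bounded_measurable (\<lambda>_::'a. c)" for c by (rule bounded_measurableI[of _ "\<bar>c\<bar>"]) auto
  have "A f x \<le> A (\<lambda>_. b) x" "A (\<lambda>_. - b) x \<le> A f x"
    using assms(2) by (auto intro!: A_mono assms(1) c simp: abs_le_iff minus_le_iff)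
  then show ?thesis by (simp add: A_const abs_le_iff minus_le_iff)
qed

lemma A_measurable [measurable]:
  assumes [measurable]: "f \<in> borel_measurable borel" shows "A f \<in> borel_measurable borel"
  unfolding A_def[abs_def] by (rule borel_measurable_lebesgue_integral) measurable

lemma bounded_measurable_A: assumes "bounded_measurable f" shows "bounded_measurable (A f)"
proof -
  obtain b where "\<And>x. \<bar>f x\<bar> \<le> b" "f \<in> borel_measurable borel"
    using assms by (auto simp: bounded_measurable_def)
  then show ?thesis by (intro bounded_measurableI[of _ "b * m"] A_abs_le assms) auto
qed

lemma bounded_measurable_pow: "bounded_measurable f \<Longrightarrow> bounded_measurable ((A ^^ k) f)"
  by (induction k) (auto intro: bounded_measurable_A)

lemma A_cmult: "A (\<lambda>x. c * f x) x = c * A f x"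
  by (simp add: A_def)

lemma A_sum:
  assumes "\<And>i. i \<in> I \<Longrightarrow> bounded_measurable (f i)"
  shows "A (\<lambda>x. \<Sum>i\<in>I. f i x) x = (\<Sum>i\<in>I. A (f i) x)"
  unfolding A_def using assms by (intro Bochner_Integration.integral_sum integrable_translate)

lemma pow_mono:
  assumes "bounded_measurable f" "bounded_measurable g" "\<And>x. f x \<le> g x"
  shows "(A ^^ k) f x \<le> (A ^^ k) g x"
  using assms
  by (induction k arbitrary: x) (auto intro!: A_mono bounded_measurable_pow)

lemma pow_abs_le:
  assumes "bounded_measurable f" "\<And>x. \<bar>f x\<bar> \<le> b"
  shows "\<bar>(A ^^ k) f x\<bar> \<le> b * m ^ k"
  using assms
proof (induction k arbitrary: x)
  case (Suc k)
  then have "\<bar>A ((A ^^ k) f) x\<bar> \<le> b * m ^ k * m" by (intro A_abs_le bounded_measurable_pow) auto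
  then show ?case by (simp add: mult_ac)
qed auto

lemma A_diff:
  assumes "bounded_measurable f" "bounded_measurable g"
  shows "A (\<lambda>x. f x - g x) x = A f x - A g x"
  unfolding A_def using assms by (intro Bochner_Integration.integral_diff integrable_translate)

lemma pow_diff:
  assumes "bounded_measurable f" "bounded_measurable g"
  shows "(A ^^ k) (\<lambda>x. f x - g x) = (\<lambda>x. (A ^^ k) f x - (A ^^ k) g x)"
proof (induction k)
  case (Suc k)
  show ?case
    by (rule ext) (simp add: Suc A_diff bounded_measurable_pow assms)
qed auto

text \<open>Tonelli and translation invariance: every shift preserves the Lebesgue integral. Errors
  can thus be tracked in Lebesgue measure as well as in the supremum norm.\<close>

lemma nn_integral_A:
  assumes "bounded_measurable f" "\<And>x. 0 \<le> f x"
  shows "(\<integral>\<^sup>+x. ennreal (A f x) \<partial>lborel) = ennreal m * (\<integral>\<^sup>+x. ennreal (f x) \<partial>lborel)"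
proof -
  have [measurable]: "f \<in> borel_measurable borel" using assms by (auto simp: bounded_measurable_def)
  interpret pair_sigma_finite lborel \<nu> ..
  have "(\<integral>\<^sup>+x. ennreal (A f x) \<partial>lborel) = (\<integral>\<^sup>+x. (\<integral>\<^sup>+h. ennreal (f (x + h)) \<partial>\<nu>) \<partial>lborel)"
    unfolding A_def using assms by (intro nn_integral_cong nn_integral_eq_integral[symmetric] integrable_translate) auto
  also have "\<dots> = (\<integral>\<^sup>+h. (\<integral>\<^sup>+x. ennreal (f (x + h)) \<partial>lborel) \<partial>\<nu>)"
    by (rule Fubini'[symmetric]) measurable
  also have "\<dots> = (\<integral>\<^sup>+h. (\<integral>\<^sup>+x. ennreal (f x) \<partial>lborel) \<partial>\<nu>)"
  proof (rule nn_integral_cong)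
    fix h show "(\<integral>\<^sup>+x. ennreal (f (x + h)) \<partial>lborel) = (\<integral>\<^sup>+x. ennreal (f x) \<partial>lborel)"
      by (subst (2) lborel_distr_plus[of h, symmetric]) (simp add: nn_integral_distr add.commute)
  qed
  finally show ?thesis by (simp add: m_def emeasure_eq_measure mult.commute)
qed

lemma nn_integral_pow:
  assumes "bounded_measurable f" "\<And>x. 0 \<le> f x"
  shows "(\<integral>\<^sup>+x. ennreal ((A ^^ k) f x) \<partial>lborel) = ennreal (m ^ k) * (\<integral>\<^sup>+x. ennreal (f x) \<partial>lborel)"
proof (induction k)
  case (Suc k)
  have "0 \<le> (A ^^ k) f x" for x
  proof -
    have "bounded_measurable (\<lambda>_::'a. 0)" by (rule bounded_measurableI[of _ 0]) auto
    from pow_mono[OF this assms(1), of k x] assms(2)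
    have "(A ^^ k) (\<lambda>_. 0) x \<le> (A ^^ k) f x" by simp
    moreover have "(A ^^ k) (\<lambda>_. 0) x = 0"
      using pow_abs_le[of "\<lambda>_. 0" 0 k x] bounded_measurableI[of "\<lambda>_. 0" 0] by simp
    ultimately show ?thesis by simp
  qed
  then show ?case
    using Suc nn_integral_A[OF bounded_measurable_pow[OF assms(1), of k]] m_nonneg
    by (simp add: ennreal_mult mult.assoc)
qed simp

definition U :: "real \<Rightarrow> nat \<Rightarrow> ('a \<Rightarrow> real) \<Rightarrow> 'a \<Rightarrow> real" where
  "U l N f x = (\<Sum>k\<le>N. 1 / (l + m) ^ Suc k * (A ^^ k) f x)"

lemma sum_weights:
  assumes "0 < l" shows "(\<Sum>k\<le>N. 1 / (l + m) ^ Suc k * m ^ k) = (1 - (m / (l + m)) ^ Suc N) / l"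
proof -
  have c: "0 < l + m" using assms m_nonneg by simp
  have "(\<Sum>k\<le>N. 1 / (l + m) ^ Suc k * m ^ k) = (\<Sum>k<Suc N. (m / (l + m)) ^ k) / (l + m)"
    unfolding sum_divide_distrib by (intro sum.cong) (auto simp: power_divide mult_ac)
  also have "\<dots> = (1 - (m / (l + m)) ^ Suc N) / (1 - m / (l + m)) / (l + m)"
    using assms c by (subst sum_gp_strict) (auto simp: divide_simps)
  also have "\<dots> = (1 - (m / (l + m)) ^ Suc N) / l"
  proof -
    have "1 - m / (l + m) = l / (l + m)" using c by (simp add: field_simps)
    then show ?thesis using c by simp
  qed
  finally show ?thesis .
qed

lemma sum_weights_le:
  assumes "0 < l" shows "(\<Sum>k\<le>N. 1 / (l + m) ^ Suc k * m ^ k) \<le> 1 / l"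
  unfolding sum_weights[OF assms] using assms m_nonneg by (intro divide_right_mono) auto

lemma bounded_measurable_U:
  assumes "0 < l" "bounded_measurable f" shows "bounded_measurable (U l N f)"
proof -
  obtain b where b: "\<And>x. \<bar>f x\<bar> \<le> b" and [measurable]: "f \<in> borel_measurable borel"
    using assms by (auto simp: bounded_measurable_def)
  have [measurable]: "(A ^^ k) f \<in> borel_measurable borel" for k by (induction k) auto
  show ?thesis unfolding U_def[abs_def]
  proof (rule bounded_measurableI[of _ "\<Sum>k\<le>N. \<bar>1 / (l + m) ^ Suc k\<bar> * (b * m ^ k)"])
    show "\<bar>\<Sum>k\<le>N. 1 / (l + m) ^ Suc k * (A ^^ k) f x\<bar> \<le> (\<Sum>k\<le>N. \<bar>1 / (l + m) ^ Suc k\<bar> * (b * m ^ k))" for x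
      by (intro order_trans[OF sum_abs] sum_mono) (simp only: abs_mult, intro mult_left_mono pow_abs_le assms b, auto)
  qed measurable
qed

lemma U_abs_le:
  assumes "0 < l" "bounded_measurable f" "\<And>x. \<bar>f x\<bar> \<le> b" shows "\<bar>U l N f x\<bar> \<le> b / l"
proof -
  have c: "0 < l + m" using assms m_nonneg by simp
  have b: "0 \<le> b" using assms(3) order_trans[OF abs_ge_zero] by blast
  have "\<bar>U l N f x\<bar> \<le> (\<Sum>k\<le>N. 1 / (l + m) ^ Suc k * (b * m ^ k))"
    unfolding U_def using c
    by (intro order_trans[OF sum_abs] sum_mono) (simp only: abs_mult, intro mult_mono pow_abs_le assms, auto)
  also have "\<dots> = b * (\<Sum>k\<le>N. 1 / (l + m) ^ Suc k * m ^ k)"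
    by (simp add: sum_distrib_left mult_ac)
  also have "\<dots> \<le> b * (1 / l)" by (intro mult_left_mono sum_weights_le assms b)
  finally show ?thesis by simp
qed

lemma U_mono:
  assumes "0 < l" "bounded_measurable f" "bounded_measurable g" "\<And>x. f x \<le> g x"
  shows "U l N f x \<le> U l N g x"
proof -
  have c: "0 < l + m" using assms m_nonneg by simp
  show ?thesis unfolding U_def using c
    by (intro sum_mono mult_left_mono pow_mono assms) auto
qed

lemma U_nonneg:
  assumes "0 < l" "bounded_measurable f" "\<And>x. 0 \<le> f x" shows "0 \<le> U l N f x"
proof -
  have *: "bounded_measurable (\<lambda>_::'a. 0)" by (rule bounded_measurableI[of _ 0]) auto
  have "\<bar>U l N (\<lambda>_. 0) x\<bar> \<le> 0 / l" by (rule U_abs_le[OF assms(1) *]) simp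
  then show ?thesis using U_mono[OF assms(1) * assms(2,3), of N x] by simp
qed

lemma U_diff:
  assumes "bounded_measurable f" "bounded_measurable g"
  shows "U l N (\<lambda>x. f x - g x) x = U l N f x - U l N g x"
  unfolding U_def pow_diff[OF assms] by (simp add: right_diff_distrib sum_subtractf)

lemma U_cmult: "U l N (\<lambda>x. c * f x) x = c * U l N f x"
proof -
  have "(A ^^ k) (\<lambda>x. c * f x) = (\<lambda>x. c * (A ^^ k) f x)" for k
  proof (induction k)
    case (Suc k)
    show ?case by (rule ext) (simp add: Suc A_cmult)
  qed auto
  then show ?thesis by (simp add: U_def sum_distrib_left mult_ac)
qed

lemma A_U:
  assumes "bounded_measurable f" shows "A (U l N f) x = U l N (A f) x"
proof -
  have bm: "bounded_measurable (\<lambda>x. c * (A ^^ k) f x)" for c k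
  proof -
    obtain b where b: "\<And>x. \<bar>(A ^^ k) f x\<bar> \<le> b" and [measurable]: "(A ^^ k) f \<in> borel_measurable borel"
      using bounded_measurable_pow[OF assms, of k] by (auto simp: bounded_measurable_def)
    show ?thesis by (rule bounded_measurableI[of _ "\<bar>c\<bar> * b"]) (auto simp: abs_mult intro!: mult_left_mono b)
  qed
  have "A (U l N f) x = (\<Sum>k\<le>N. A (\<lambda>x. 1 / (l + m) ^ Suc k * (A ^^ k) f x) x)"
    unfolding U_def[abs_def] using bm by (intro A_sum)
  also have "\<dots> = (\<Sum>k\<le>N. 1 / (l + m) ^ Suc k * (A ^^ k) (A f) x)"
    unfolding A_cmult by (simp add: funpow_swap1)
  finally show ?thesis by (simp add: U_def)
qed

text \<open>The sum telescopes, so the only defect of the truncated series is its last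
  power.\<close>

lemma U_resolvent:
  assumes "0 < l" "bounded_measurable f"
  shows "(l + m) * U l N f x - A (U l N f) x = f x - (A ^^ Suc N) f x / (l + m) ^ Suc N"
proof -
  have c: "0 < l + m" using assms m_nonneg by simp
  have "(l + m) * U l N f x = (\<Sum>k\<le>N. 1 / (l + m) ^ k * (A ^^ k) f x)"
    unfolding U_def sum_distrib_left using c by (intro sum.cong) auto
  moreover have "A (U l N f) x = (\<Sum>k\<le>N. 1 / (l + m) ^ Suc k * (A ^^ Suc k) f x)"
    unfolding A_U[OF assms(2)] U_def by (simp add: funpow_swap1)
  ultimately have "(l + m) * U l N f x - A (U l N f) x
      = (\<Sum>k\<le>N. 1 / (l + m) ^ k * (A ^^ k) f x - 1 / (l + m) ^ Suc k * (A ^^ Suc k) f x)"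
    by (simp add: sum_subtractf)
  also have "\<dots> = f x - 1 / (l + m) ^ Suc N * (A ^^ Suc N) f x"
    by (subst sum_telescope) simp
  finally show ?thesis by simp
qed

text \<open>\<open>l * U l N\<close> is almost the identity on functions with bounded generator: by
  the resolvent identity the difference is \<open>U l N\<close> applied to
  \<open>A f - m * f\<close>, at most \<open>M / l\<close>, up to the truncation error.\<close>

lemma U_ge:
  assumes "0 < l" and f: "bounded_measurable f" "\<And>x. 0 \<le> f x" "\<And>x. f x \<le> 1"
    and M: "\<And>x. \<bar>A f x - m * f x\<bar> \<le> M"
  shows "l * U l N f x \<ge> f x - (m / (l + m)) ^ Suc N - M / l"
proof -
  have c: "0 < l + m" using assms m_nonneg by simp
  have bm: "bounded_measurable (\<lambda>x. m * f x)"
    using f m_nonneg by (intro bounded_measurableI[of _ m]) (auto simp: bounded_measurable_def abs_mult mult_left_le)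
  have bd: "bounded_measurable (\<lambda>x. A f x - m * f x)"
    using M bounded_measurable_A[OF f(1)] bm by (intro bounded_measurableI[of _ M]) (auto simp: bounded_measurable_def)
  have "l * U l N f x = f x - (A ^^ Suc N) f x / (l + m) ^ Suc N + (A (U l N f) x - m * U l N f x)"
    using U_resolvent[OF assms(1) f(1), of N x] by (simp add: algebra_simps)
  moreover have "A (U l N f) x - m * U l N f x = U l N (\<lambda>x. A f x - m * f x) x"
    using U_diff[OF bounded_measurable_A[OF f(1)] bm, of l N x] by (simp add: A_U[OF f(1)] U_cmult)
  moreover have "U l N (\<lambda>x. A f x - m * f x) x \<ge> - (M / l)"
    using U_abs_le[OF assms(1) bd M, of N x] by (simp add: abs_le_iff minus_le_iff)
  moreover have "(A ^^ Suc N) f x / (l + m) ^ Suc N \<le> (m / (l + m)) ^ Suc N"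
    unfolding power_divide using pow_abs_le[OF f(1), of 1 "Suc N" x] f(2,3) c
    by (intro divide_right_mono) (auto simp del: funpow.simps power_Suc)
  ultimately show ?thesis by linarith
qed

text \<open>The operator \<open>l * U l N\<close> combines the normalised convolution powers with
  weights of total at most 1, hence contracts Lebesgue integrals. With Chebyshev's inequality this
  bounds the measure of the set where the image of a function of small integral is large.\<close>

lemma nn_integral_U:
  assumes "0 < l" "bounded_measurable f" "\<And>x. 0 \<le> f x"
  shows "(\<integral>\<^sup>+x. ennreal (l * U l N f x) \<partial>lborel) \<le> (\<integral>\<^sup>+x. ennreal (f x) \<partial>lborel)"
proof -
  have c: "0 < l + m" using assms m_nonneg by simp
  have [measurable]: "f \<in> borel_measurable borel" using assms by (auto simp: bounded_measurable_def)
  have [measurable]: "(A ^^ k) f \<in> borel_measurable borel" for k by (induction k) auto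
  have nn: "0 \<le> (A ^^ k) f x" for k x
    using U_nonneg[OF assms, of 0] pow_mono[of "\<lambda>_. 0" f k x] pow_abs_le[of "\<lambda>_. 0" 0 k x] assms
      bounded_measurableI[of "\<lambda>_. 0" 0] by simp
  have "ennreal (l * U l N f x) = (\<Sum>k\<le>N. ennreal (l * (1 / (l + m) ^ Suc k)) * ennreal ((A ^^ k) f x))" for x
  proof -
    have "ennreal (l * U l N f x) = ennreal (\<Sum>k\<le>N. l * (1 / (l + m) ^ Suc k) * (A ^^ k) f x)"
      by (simp add: U_def sum_distrib_left mult_ac)
    also have "\<dots> = (\<Sum>k\<le>N. ennreal (l * (1 / (l + m) ^ Suc k) * (A ^^ k) f x))"
      using c assms(1) nn by (intro sum_ennreal[symmetric]) auto
    also have "\<dots> = (\<Sum>k\<le>N. ennreal (l * (1 / (l + m) ^ Suc k)) * ennreal ((A ^^ k) f x))"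
      using c assms(1) nn by (intro sum.cong refl ennreal_mult) auto
    finally show ?thesis .
  qed
  then have "(\<integral>\<^sup>+x. ennreal (l * U l N f x) \<partial>lborel)
      = (\<Sum>k\<le>N. ennreal (l * (1 / (l + m) ^ Suc k)) * (\<integral>\<^sup>+x. ennreal ((A ^^ k) f x) \<partial>lborel))"
    by (simp add: nn_integral_sum nn_integral_cmult del: power_Suc)
  also have "\<dots> = (\<Sum>k\<le>N. ennreal (l * (1 / (l + m) ^ Suc k * m ^ k))) * (\<integral>\<^sup>+x. ennreal (f x) \<partial>lborel)"
    unfolding sum_distrib_right
  proof (intro sum.cong refl)
    fix k
    have "ennreal (l * (1 / (l + m) ^ Suc k * m ^ k)) = ennreal (l * (1 / (l + m) ^ Suc k)) * ennreal (m ^ k)"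
      using c assms(1) m_nonneg by (subst ennreal_mult[symmetric]) (auto simp: mult.assoc)
    then show "ennreal (l * (1 / (l + m) ^ Suc k)) * (\<integral>\<^sup>+x. ennreal ((A ^^ k) f x) \<partial>lborel)
        = ennreal (l * (1 / (l + m) ^ Suc k * m ^ k)) * (\<integral>\<^sup>+x. ennreal (f x) \<partial>lborel)"
      by (simp only: nn_integral_pow[OF assms(2,3)] mult.assoc)
  qed
  also have "(\<Sum>k\<le>N. ennreal (l * (1 / (l + m) ^ Suc k * m ^ k))) = ennreal (l * (\<Sum>k\<le>N. 1 / (l + m) ^ Suc k * m ^ k))"
    using c assms(1) m_nonneg by (subst sum_ennreal) (auto simp: sum_distrib_left)
  also have "\<dots> \<le> 1"
    using mult_left_mono[OF sum_weights_le[OF assms(1), of N], of l] assms(1) by (simp del: power_Suc)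
  finally show ?thesis by (simp add: mult_right_mono)
qed

end

text \<open>The constant involves neither \<open>N\<close> nor the total mass of
  \<open>\<nu>\<close>, which may be arbitrarily large when short jumps are retained. The length of
  the discarded jumps can therefore be chosen from \<open>C\<close> alone.\<close>

lemma smooth_bound_U:
  fixes \<nu> :: "(real^'d::finite) measure"
  assumes "jump_operator \<nu>" and "0 < l" and f: "smooth_bound C f"
  shows "smooth_bound (C / l) (jump_operator.U \<nu> l N f)"
proof -
  interpret jump_operator \<nu> by fact
  have c: "0 < l + m" using assms m_nonneg by simp
  have sA: "smooth_bound (C * m) (A f)" if "smooth_bound C f" for C f
    using smooth_bound_integral_translates[OF that finite_measure_axioms, of "\<lambda>h. h"]
    by (simp add: A_def[abs_def] m_def)
  have "smooth_bound (C * m ^ k) ((A ^^ k) f)" for k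
  proof (induction k)
    case (Suc k)
    from sA[OF this] show ?case by (simp add: mult_ac)
  qed (use f in simp)
  then have "smooth_bound (\<Sum>k\<le>N. \<bar>1 / (l + m) ^ Suc k\<bar> * (C * m ^ k)) (U l N f)"
    unfolding U_def[abs_def] by (intro smooth_bound_sum smooth_bound_cmult) auto
  moreover have "(\<Sum>k\<le>N. \<bar>1 / (l + m) ^ Suc k\<bar> * (C * m ^ k)) \<le> C / l"
  proof -
    have "(\<Sum>k\<le>N. \<bar>1 / (l + m) ^ Suc k\<bar> * (C * m ^ k)) = C * (\<Sum>k\<le>N. 1 / (l + m) ^ Suc k * m ^ k)"
      unfolding sum_distrib_left using c by (intro sum.cong) auto
    also have "\<dots> \<le> C * (1 / l)"
      by (intro mult_left_mono sum_weights_le assms smooth_bound_nonneg[OF f])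
    finally show ?thesis by simp
  qed
  ultimately show ?thesis by (rule smooth_bound_mono)
qed

section \<open>The operator frozen at a point, with short jumps removed\<close>

context stable_like
begin

definition big_jump :: "real^'d \<Rightarrow> real \<Rightarrow> real^'d \<Rightarrow> real" where
  "big_jump y \<delta> h = n y h * indicator {h. \<delta> < norm h} h"

definition jumps :: "real^'d \<Rightarrow> real \<Rightarrow> (real^'d) measure" where
  "jumps y \<delta> = density lborel (\<lambda>h. ennreal (big_jump y \<delta> h))"

lemma big_jump_measurable [measurable]: "big_jump y \<delta> \<in> borel_measurable borel"
  unfolding big_jump_def[abs_def] by measurable

lemma big_jump_nonneg: "0 < \<delta> \<Longrightarrow> 0 \<le> big_jump y \<delta> h"
  using n_nonneg[of h y] by (cases "h = 0") (auto simp: big_jump_def)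

lemma big_jump_sym: "0 < \<delta> \<Longrightarrow> big_jump y \<delta> (- h) = big_jump y \<delta> h"
  using n_sym[of h y] by (cases "h = 0") (auto simp: big_jump_def indicator_def)

lemma big_jump_le:
  assumes "0 < \<delta>" shows "big_jump y \<delta> h \<le> inverse (min 1 (\<delta>\<^sup>2)) * levy h"
proof (cases "\<delta> < norm h")
  case True
  then have h: "h \<noteq> 0" and "\<delta>\<^sup>2 \<le> (norm h)\<^sup>2" using assms by (auto intro!: power_mono)
  then have "min 1 (\<delta>\<^sup>2) * n y h \<le> min 1 ((norm h)\<^sup>2) * n y h"
    by (intro mult_right_mono n_nonneg) auto
  also have "\<dots> \<le> levy h" by (rule n_levy[OF h])
  finally have "min 1 (\<delta>\<^sup>2) * n y h \<le> levy h" .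
  moreover have "0 < min 1 (\<delta>\<^sup>2)" using assms by simp
  ultimately show ?thesis using True by (simp add: big_jump_def divide_simps mult.commute)
qed (use assms levy_nonneg in \<open>simp add: big_jump_def\<close>)

lemma big_jump_integrable: assumes "0 < \<delta>" shows "integrable lborel (big_jump y \<delta>)"
proof (rule Bochner_Integration.integrable_bound)
  show "integrable lborel (\<lambda>h. inverse (min 1 (\<delta>\<^sup>2)) * levy h)" using levy_integrable by simp
  show "AE h in lborel. norm (big_jump y \<delta> h) \<le> norm (inverse (min 1 (\<delta>\<^sup>2)) * levy h)"
    using big_jump_le[OF assms] big_jump_nonneg[OF assms]
    by (intro AE_I2) (metis abs_ge_self abs_of_nonneg order_trans real_norm_def)
qed simp

lemma jump_operator_jumps: assumes "0 < \<delta>" shows "jump_operator (jumps y \<delta>)"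
proof -
  have "emeasure (jumps y \<delta>) (space (jumps y \<delta>)) = (\<integral>\<^sup>+h. ennreal (big_jump y \<delta> h) \<partial>lborel)"
    by (simp add: jumps_def emeasure_density)
  also have "\<dots> < \<infinity>"
    using big_jump_integrable[OF assms, of y] big_jump_nonneg[OF assms]
    by (subst nn_integral_eq_integral) auto
  finally interpret finite_measure "jumps y \<delta>" by (intro finite_measureI) auto
  show ?thesis by unfold_locales (simp add: jumps_def)
qed

lemma jumps_integral:
  assumes "0 < \<delta>" and [measurable]: "f \<in> borel_measurable borel"
  shows "(LINT h|jumps y \<delta>. f h) = (LINT h|lborel. big_jump y \<delta> h * f h)"
  unfolding jumps_def using big_jump_nonneg[OF assms(1)] by (subst integral_real_density) auto

text \<open>Since the jump density is even, the compound Poisson generator also becomes an integral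
  of \<open>second_diff\<close> and can be compared with \<open>sym_generator\<close> under one
  integral sign.\<close>

lemma jumps_second_diff:
  fixes y :: "real^'d"
  assumes f: "smooth_bound C f" and \<delta>: "0 < \<delta>"
  defines "w \<equiv> big_jump y \<delta>"
  shows "jump_operator.A (jumps y \<delta>) f x - jump_operator.m (jumps y \<delta>) * f x = (LINT h|lborel. second_diff f x h * w h)"
    and "integrable lborel (\<lambda>h. second_diff f x h * w h)"
proof -
  interpret jump_operator "jumps y \<delta>" using \<delta> by (rule jump_operator_jumps)
  note [measurable] = smooth_bound_measurable[OF f]
  have w [measurable]: "w \<in> borel_measurable borel" "integrable lborel w"
    unfolding w_def using big_jump_integrable[OF \<delta>] by auto
  have wf: "integrable lborel (\<lambda>h. w h * f (x + c *\<^sub>R h))" for c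
  proof (rule Bochner_Integration.integrable_bound)
    show "integrable lborel (\<lambda>h. C * w h)" using w by simp
    show "AE h in lborel. norm (w h * f (x + c *\<^sub>R h)) \<le> norm (C * w h)"
      using smooth_bound_abs_le[OF f] smooth_bound_nonneg[OF f]
      by (intro AE_I2) (simp add: abs_mult mult.commute[of C] mult_left_mono)
  qed measurable
  have A: "A f x = (LINT h|lborel. w h * f (x + h))"
    unfolding A_def w_def by (rule jumps_integral[OF \<delta>]) measurable
  have A': "A f x = (LINT h|lborel. w h * f (x - h))"
    using lborel_integral_reflection[of "\<lambda>h. w h * f (x + h)"] by (simp add: A w_def big_jump_sym[OF \<delta>])
  have M: "m = (LINT h|lborel. w h)"
    using jumps_integral[OF \<delta>, of "\<lambda>_. 1" y] by (simp add: m_def w_def)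
  have eq: "second_diff f x h * w h = (w h * f (x + h) + w h * f (x - h)) / 2 - w h * f x" for h
    by (simp add: second_diff_def algebra_simps)
  show "integrable lborel (\<lambda>h. second_diff f x h * w h)"
    unfolding eq using wf[of 1] wf[of "- 1"] wf[of 0] by simp
  have "(LINT h|lborel. second_diff f x h * w h) = (A f x + A f x) / 2 - m * f x"
    unfolding eq using wf[of 1] wf[of "- 1"] wf[of 0] w(2) A A' M by simp
  then show "A f x - m * f x = (LINT h|lborel. second_diff f x h * w h)" by simp
qed

text \<open>Uniform in \<open>\<delta>\<close>, although the jump intensity is not:
  \<open>second_diff\<close> is quadratic near 0 and compensates the singularity.\<close>

lemma jumps_generator_bound:
  assumes f: "smooth_bound C f" and \<delta>: "0 < \<delta>"
  shows "\<bar>jump_operator.A (jumps y \<delta>) f x - jump_operator.m (jumps y \<delta>) * f x\<bar> \<le> 2 * C * levy_mass"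
proof -
  have "norm (LINT h|lborel. second_diff f x h * big_jump y \<delta> h) \<le> (LINT h|lborel. 2 * C * levy h)"
  proof (rule Bochner_Integration.integral_norm_bound_integral)
    show "norm (second_diff f x h * big_jump y \<delta> h) \<le> 2 * C * levy h" for h
      using second_diff_n_le[OF f, of x h y] levy_nonneg[of h] smooth_bound_nonneg[OF f]
      by (cases "\<delta> < norm h") (auto simp: big_jump_def)
  qed (use levy_integrable jumps_second_diff[OF f \<delta>] in auto)
  then show ?thesis using jumps_second_diff[OF f \<delta>] by (simp add: levy_mass_def)
qed

lemma levy_small_jumps:
  assumes "0 < (e::real)" obtains \<delta> where "0 < \<delta>" "(LINT h|lborel. levy h * indicator (cball 0 \<delta>) h) \<le> e"
proof -
  have "(\<lambda>k. LINT h|lborel. levy h * indicator (cball 0 (1 / Suc k)) h) \<longlonglongrightarrow> (LINT (h::real^'d)|lborel. 0)"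
  proof (rule integral_dominated_convergence[where w = levy])
    show "AE h in lborel. (\<lambda>k. levy h * indicator (cball 0 (1 / Suc k)) h) \<longlonglongrightarrow> 0"
      using AE_lborel_nonzero
    proof eventually_elim
      fix h :: "real^'d" assume "h \<noteq> 0"
      then have "\<forall>\<^sub>F k in sequentially. 1 / Suc k < norm h"
        using order_tendstoD(2)[OF LIMSEQ_inverse_real_of_nat, of "norm h"] by (simp add: inverse_eq_divide)
      then have "\<forall>\<^sub>F k in sequentially. levy h * indicator (cball 0 (1 / Suc k)) h = 0"
        by eventually_elim auto
      then show "(\<lambda>k. levy h * indicator (cball 0 (1 / Suc k)) h) \<longlonglongrightarrow> 0" by (rule tendsto_eventually)
    qed
    show "AE h in lborel. norm (levy h * indicator (cball 0 (1 / Suc k)) h) \<le> levy h" for k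
      using levy_nonneg by (intro AE_I2) (simp add: indicator_def)
    show "(\<lambda>h. levy h * indicator (cball 0 (1 / Suc k)) h) \<in> borel_measurable lborel" for k
      by (intro borel_measurable_times borel_measurable_indicator) auto
  qed (use levy_integrable in auto)
  then have "\<forall>\<^sub>F k in sequentially. (LINT h|lborel. levy h * indicator (cball 0 (1 / Suc k)) h) < e"
    using order_tendstoD(2) assms by fastforce
  then obtain k :: nat where "(LINT h|lborel. levy h * indicator (cball 0 (1 / Suc k)) h) < e"
    using eventually_happens' sequentially_bot by blast
  then show ?thesis using that[of "1 / Suc k"] by simp
qed

text \<open>Near \<open>y\<close>, the operator differs from its constant-coefficient freezing at \<open>y\<close> by an integral
  operator with integrable kernel. A truncated Neumann series for the resolvent of the frozen
  operator, with the jumps shorter than \<open>\<delta>\<close> removed, therefore almost solves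
  \<open>l u - L u = g\<close>, with an error \<open>O(1 / l)\<close> that does not depend on the smoothness of \<open>g\<close>.\<close>

lemma approximate_resolvent:
  assumes close: "\<And>x h. x \<in> cball y r \<Longrightarrow> h \<noteq> 0 \<Longrightarrow> norm h \<le> 1 \<Longrightarrow> \<bar>n x h - n y h\<bar> \<le> 1"
  obtains K where "0 \<le> K"
    and "\<And>l (g :: real^'d \<Rightarrow> real) Cg. \<lbrakk>0 < l; smooth_bound Cg g; \<And>x. 0 \<le> g x; \<And>x. g x \<le> 1\<rbrakk> \<Longrightarrow>
      \<exists>u Cu. smooth_bound Cu u \<and> (\<forall>x. 0 \<le> u x \<and> u x \<le> 1 / l) \<and>
        (\<forall>x\<in>cball y r. \<bar>sym_generator u x - l * u x + g x\<bar> \<le> K / l) \<and>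
        (\<forall>\<phi> C B \<epsilon>. smooth_bound C \<phi> \<and> (\<forall>x. 0 \<le> \<phi> x \<and> \<phi> x \<le> 1) \<and> (\<forall>x\<in>B. \<phi> x = 1) \<and>
           B \<in> sets borel \<and> (\<forall>x. indicator B x \<le> g x) \<and> 0 < \<epsilon> \<longrightarrow>
           (\<exists>E\<in>sets borel. ennreal \<epsilon> * emeasure lborel E \<le> (\<integral>\<^sup>+x. ennreal \<bar>\<phi> x - indicator B x\<bar> \<partial>lborel) \<and>
              (\<forall>x\<in>B - E. 1 - \<epsilon> - (1 + 2 * C * levy_mass) / l \<le> l * u x)))"
proof -
  \<comment> \<open>\<open>k0\<close> dominates the difference of the kernels at \<open>x\<close>
    and \<open>y\<close>: on the unit ball by the closeness assumption, outside it because each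
    kernel is at most \<open>levy\<close>. The summand 2 in \<open>K\<close> pays once for the
    discarded short jumps and once for the truncation of the series.\<close>
  define k0 where "k0 h = indicator (cball 0 1) h + 2 * levy h" for h :: "real^'d"
  define K where "K = (LINT h|lborel. k0 h) + 2"
  have ik0: "integrable lborel k0" unfolding k0_def
    using levy_integrable by (intro Bochner_Integration.integrable_add integrable_real_indicator emeasure_bounded_finite) auto
  have k00: "0 \<le> k0 h" for h using levy_nonneg by (simp add: k0_def)
  have nk: "\<bar>n x h - n y h\<bar> \<le> k0 h" if "x \<in> cball y r" "h \<noteq> 0" for x h
  proof (cases "norm h \<le> 1")
    case True
    then show ?thesis using close[OF that True] levy_nonneg[of h] by (simp add: k0_def)
  next
    case False
    then have "min 1 ((norm h)\<^sup>2) = 1" using one_le_power[of "norm h" 2] by simp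
    then show ?thesis
      using n_levy[OF that(2), of x] n_levy[OF that(2), of y] n_nonneg[OF that(2), of x] n_nonneg[OF that(2), of y] False
      by (simp add: k0_def)
  qed
  show ?thesis
  proof (rule that)
    show "0 \<le> K" unfolding K_def using k00 by (simp add: Bochner_Integration.integral_nonneg)
    fix l :: real and g :: "real^'d \<Rightarrow> real" and Cg assume l: "0 < l" and g: "smooth_bound Cg g" "\<And>x. 0 \<le> g x" "\<And>x. g x \<le> 1"
    have Cg: "0 \<le> Cg" using g(1) by (rule smooth_bound_nonneg)
    \<comment> \<open>Discarding jumps up to \<open>\<delta>\<close> will cost
      \<open>2 * Cg / l\<close> times this integral, hence at most \<open>1 / l\<close>.\<close>
    obtain \<delta> where \<delta>: "0 < \<delta>" "(LINT h|lborel. levy h * indicator (cball 0 \<delta>) h) \<le> 1 / (2 * Cg + 1)"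
      by (rule levy_small_jumps[of "1 / (2 * Cg + 1)"]) (use Cg in auto)
    interpret jump_operator "jumps y \<delta>" using \<delta>(1) by (rule jump_operator_jumps)
    define q where "q = m / (l + m)"
    have q: "0 \<le> q" "q < 1" using l m_nonneg by (auto simp: q_def)
    \<comment> \<open>\<open>N\<close> can only be chosen after \<open>\<delta>\<close>, because the
      ratio \<open>q\<close> contains the jump intensity \<open>m\<close>.\<close>
    obtain N where N: "q ^ N < 1 / l" using real_arch_pow_inv[of "1 / l" q] q l by auto
    have N': "q ^ Suc N \<le> 1 / l" using N mult_left_le_one_le[of "q ^ N" q] q by simp
    define u where "u = U l N g"
    have bg: "bounded_measurable g" using g(1) by (rule smooth_bound_bounded_measurable)
    have su: "smooth_bound (Cg / l) u" unfolding u_def by (rule smooth_bound_U[OF jump_operator_axioms l g(1)])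
    have u0: "0 \<le> u x" for x unfolding u_def by (rule U_nonneg[OF l bg g(2)])
    have u1: "u x \<le> 1 / l" for x
      using U_abs_le[OF l bg, of 1 N x] g(2,3) unfolding u_def by (simp add: abs_le_iff)
    have res: "0 \<le> A u x - m * u x - l * u x + g x" "A u x - m * u x - l * u x + g x \<le> 1 / l" for x
    proof -
      have eq: "A u x - m * u x - l * u x + g x = (A ^^ Suc N) g x / (l + m) ^ Suc N"
        using U_resolvent[OF l bg, of N x] unfolding u_def by (simp add: algebra_simps)
      have c: "0 < l + m" using l m_nonneg by simp
      have b0: "bounded_measurable (\<lambda>_::real^'d. 0)" by (rule bounded_measurableI[of _ 0]) auto
      have "(A ^^ Suc N) g x \<ge> (A ^^ Suc N) (\<lambda>_. 0) x" by (rule pow_mono[OF b0 bg g(2)])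
      moreover have "(A ^^ Suc N) (\<lambda>_. 0) x = 0" using pow_abs_le[OF b0, of 0 "Suc N" x] by simp
      ultimately show "0 \<le> A u x - m * u x - l * u x + g x" unfolding eq using c by simp
      have "\<bar>(A ^^ Suc N) g x\<bar> \<le> 1 * m ^ Suc N" by (rule pow_abs_le[OF bg]) (use g in auto)
      then have "(A ^^ Suc N) g x / (l + m) ^ Suc N \<le> q ^ Suc N"
        unfolding q_def power_divide using c by (intro divide_right_mono) auto
      with N' show "A u x - m * u x - l * u x + g x \<le> 1 / l" unfolding eq by simp
    qed
    have Lu: "\<bar>sym_generator u x - (A u x - m * u x)\<bar> \<le> ((LINT h|lborel. k0 h) + 1) / l" if x: "x \<in> cball y r" for x
    proof -
      let ?w = "big_jump y \<delta>"
      note js = jumps_second_diff[OF su \<delta>(1), where y = y and x = x]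
      have "sym_generator u x - (A u x - m * u x) = (LINT h|lborel. second_diff u x h * n x h - second_diff u x h * ?w h)"
        unfolding js(1) sym_generator_def using second_diff_n_integrable[OF su, of x x] js(2) by simp
      moreover have "norm (LINT h|lborel. second_diff u x h * n x h - second_diff u x h * ?w h)
         \<le> (LINT h|lborel. 1 / l * k0 h + 2 * Cg / l * (levy h * indicator (cball 0 \<delta>) h))"
      proof (rule Bochner_Integration.integral_norm_bound_integral)
        fix h
        show "norm (second_diff u x h * n x h - second_diff u x h * ?w h)
          \<le> 1 / l * k0 h + 2 * Cg / l * (levy h * indicator (cball 0 \<delta>) h)"
        proof (cases "h = 0")
          case True
          then show ?thesis using l k00[of h] levy_nonneg[of h] Cg by (simp add: second_diff_def)
        next
          case False
          \<comment> \<open>The variation of the kernel is paired with the supremum bound of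
            \<open>u\<close>, the short jumps with its smoothness. Only the second error sees
            \<open>Cg\<close>, and \<open>\<delta>\<close> was chosen to absorb it.\<close>
          have s1: "\<bar>second_diff u x h * (n x h - n y h)\<bar> \<le> 1 / l * k0 h"
            unfolding abs_mult using second_diff_bounds[of 0 u "1 / l" x h] u0 u1 nk[OF x False] l
            by (intro mult_mono) auto
          have s2: "\<bar>second_diff u x h * (n y h - ?w h)\<bar> \<le> 2 * Cg / l * (levy h * indicator (cball 0 \<delta>) h)"
            using second_diff_n_le[OF su, of x h y] by (auto simp: big_jump_def indicator_def)
          have "second_diff u x h * n x h - second_diff u x h * ?w h
            = second_diff u x h * (n x h - n y h) + second_diff u x h * (n y h - ?w h)"
            by (simp add: algebra_simps)
          then show ?thesis using s1 s2 abs_triangle_ineq[of "second_diff u x h * (n x h - n y h)" "second_diff u x h * (n y h - ?w h)"]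
            by simp
        qed
      next
        show "integrable lborel (\<lambda>h. second_diff u x h * n x h - second_diff u x h * ?w h)"
          using second_diff_n_integrable[OF su, of x x] js(2) by simp
        show "integrable lborel (\<lambda>h. 1 / l * k0 h + 2 * Cg / l * (levy h * indicator (cball 0 \<delta>) h))"
          using integrable_real_mult_indicator[OF _ levy_integrable, of "cball 0 \<delta>"] ik0 by simp
      qed
      moreover have "(LINT h|lborel. 1 / l * k0 h + 2 * Cg / l * (levy h * indicator (cball 0 \<delta>) h))
         = 1 / l * (LINT h|lborel. k0 h) + 2 * Cg / l * (LINT h|lborel. levy h * indicator (cball 0 \<delta>) h)"
        using integrable_real_mult_indicator[OF _ levy_integrable, of "cball 0 \<delta>"] ik0 by simp
      moreover have "2 * Cg / l * (LINT h|lborel. levy h * indicator (cball 0 \<delta>) h) \<le> 1 / l"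
      proof -
        have "2 * Cg / l * (LINT h|lborel. levy h * indicator (cball 0 \<delta>) h) \<le> 2 * Cg / l * (1 / (2 * Cg + 1))"
          using \<delta>(2) Cg l by (intro mult_left_mono) auto
        also have "\<dots> \<le> 1 / l" using Cg l by (simp add: divide_simps)
        finally show ?thesis .
      qed
      ultimately show ?thesis by (simp add: add_divide_distrib)
    qed
    show "\<exists>u Cu. smooth_bound Cu u \<and> (\<forall>x. 0 \<le> u x \<and> u x \<le> 1 / l) \<and>
        (\<forall>x\<in>cball y r. \<bar>sym_generator u x - l * u x + g x\<bar> \<le> K / l) \<and>
        (\<forall>\<phi> C B \<epsilon>. smooth_bound C \<phi> \<and> (\<forall>x. 0 \<le> \<phi> x \<and> \<phi> x \<le> 1) \<and> (\<forall>x\<in>B. \<phi> x = 1) \<and>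
           B \<in> sets borel \<and> (\<forall>x. indicator B x \<le> g x) \<and> 0 < \<epsilon> \<longrightarrow>
           (\<exists>E\<in>sets borel. ennreal \<epsilon> * emeasure lborel E \<le> (\<integral>\<^sup>+x. ennreal \<bar>\<phi> x - indicator B x\<bar> \<partial>lborel) \<and>
              (\<forall>x\<in>B - E. 1 - \<epsilon> - (1 + 2 * C * levy_mass) / l \<le> l * u x)))"
    proof (intro exI conjI allI ballI impI)
      show "smooth_bound (Cg / l) u" by (rule su)
      show "0 \<le> u x" "u x \<le> 1 / l" for x by (rule u0, rule u1)
      show "\<bar>sym_generator u x - l * u x + g x\<bar> \<le> K / l" if "x \<in> cball y r" for x
        using Lu[OF that] res[of x] unfolding K_def by (simp add: add_divide_distrib abs_le_iff)
    next
      fix \<phi> C B and \<epsilon> :: real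
      assume "smooth_bound C \<phi> \<and> (\<forall>x. 0 \<le> \<phi> x \<and> \<phi> x \<le> 1) \<and> (\<forall>x\<in>B. \<phi> x = 1) \<and>
           B \<in> sets borel \<and> (\<forall>x. indicator B x \<le> g x) \<and> 0 < \<epsilon>"
      then have phi: "smooth_bound C \<phi>" "\<And>x. 0 \<le> \<phi> x" "\<And>x. \<phi> x \<le> 1" "\<And>x. x \<in> B \<Longrightarrow> \<phi> x = 1"
        and B [measurable]: "B \<in> sets borel" and gB: "\<And>x. indicator B x \<le> g x" by auto
      note [measurable] = smooth_bound_measurable[OF phi(1)]
      define \<psi> where "\<psi> x = \<phi> x - indicator B x" for x
      have psi: "0 \<le> \<psi> x" "\<psi> x \<le> 1" "\<bar>\<phi> x - indicator B x\<bar> = \<psi> x" for x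
        using phi(2,3)[of x] phi(4)[of x] by (auto simp: \<psi>_def indicator_def)
      have bphi: "bounded_measurable \<phi>" using phi(1) by (rule smooth_bound_bounded_measurable)
      have bpsi: "bounded_measurable \<psi>"
        using psi(1,2) by (intro bounded_measurableI[of _ 1]) (auto simp: \<psi>_def[abs_def])
      have bB: "bounded_measurable (indicator B :: real^'d \<Rightarrow> real)"
        by (intro bounded_measurableI[of _ 1]) auto
      \<comment> \<open>Since \<open>g\<close> dominates the indicator of \<open>B\<close>, the
        lower bound for \<open>u\<close> comes from \<open>U l N (indicator B)\<close>, which is the
        image of \<open>\<phi>\<close> minus the image of \<open>\<psi>\<close>. The first is
        handled by smoothness of \<open>\<phi>\<close>, not of \<open>g\<close>; the second is small
        in integral, so it exceeds \<open>\<epsilon> / l\<close> only on a set \<open>E\<close>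
        controlled by Chebyshev's inequality.\<close>
      define E where "E = {x. \<epsilon> \<le> l * U l N \<psi> x}"
      have [measurable]: "U l N \<psi> \<in> borel_measurable borel"
        using bounded_measurable_U[OF l bpsi] by (auto simp: bounded_measurable_def)
      have E [measurable]: "E \<in> sets borel" unfolding E_def by measurable
      show "\<exists>E\<in>sets borel. ennreal \<epsilon> * emeasure lborel E \<le> (\<integral>\<^sup>+x. ennreal \<bar>\<phi> x - indicator B x\<bar> \<partial>lborel) \<and>
              (\<forall>x\<in>B - E. 1 - \<epsilon> - (1 + 2 * C * levy_mass) / l \<le> l * u x)"
      proof (intro bexI[of _ E] conjI ballI E)
        have "ennreal \<epsilon> * emeasure lborel E = (\<integral>\<^sup>+x. ennreal \<epsilon> * indicator E x \<partial>lborel)"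
          by (simp add: nn_integral_cmult_indicator)
        also have "\<dots> \<le> (\<integral>\<^sup>+x. ennreal (l * U l N \<psi> x) \<partial>lborel)"
          by (intro nn_integral_mono) (auto simp: E_def indicator_def intro: ennreal_leI)
        also have "\<dots> \<le> (\<integral>\<^sup>+x. ennreal (\<psi> x) \<partial>lborel)" by (rule nn_integral_U[OF l bpsi psi(1)])
        finally show "ennreal \<epsilon> * emeasure lborel E \<le> (\<integral>\<^sup>+x. ennreal \<bar>\<phi> x - indicator B x\<bar> \<partial>lborel)"
          unfolding psi(3) .
        fix x assume x: "x \<in> B - E"
        have "U l N (indicator B) x \<le> u x" unfolding u_def by (rule U_mono[OF l bB bg gB])
        moreover have "U l N (indicator B) x = U l N \<phi> x - U l N \<psi> x"
          using U_diff[OF bphi bpsi, of l N x] by (simp add: \<psi>_def)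
        moreover have "\<phi> x - q ^ Suc N - (2 * C * levy_mass) / l \<le> l * U l N \<phi> x"
          unfolding q_def using jumps_generator_bound[OF phi(1) \<delta>(1)] by (intro U_ge[OF l bphi phi(2,3)])
        moreover have "\<phi> x = 1" "l * U l N \<psi> x < \<epsilon>" using x phi(4) by (auto simp: E_def)
        ultimately have "1 - q ^ Suc N - (2 * C * levy_mass) / l - \<epsilon> \<le> l * u x"
          using mult_left_mono[of "U l N \<phi> x - U l N \<psi> x" "u x" l] l by (simp add: right_diff_distrib)
        then show "1 - \<epsilon> - (1 + 2 * C * levy_mass) / l \<le> l * u x" using N' by (simp add: add_divide_distrib)
      qed
    qed
  qed
qed

end

section \<open>Filtrations and exit times\<close>

text \<open>Times are rounded to the next grid point strictly above, because right-continuity is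
  stated along times different from \<open>t\<close>. Each approximation takes countably many times,
  and \<open>max 0\<close> extends the process to all real times.\<close>

lemma measurable_right_continuous:
  fixes f :: "real \<Rightarrow> 'a \<Rightarrow> 'b::metric_space"
  assumes meas: "\<And>t. 0 \<le> t \<Longrightarrow> f t \<in> N \<rightarrow>\<^sub>M borel"
    and cont: "\<And>t \<omega>. 0 \<le> t \<Longrightarrow> \<omega> \<in> space N \<Longrightarrow> ((\<lambda>s. f s \<omega>) \<longlongrightarrow> f t \<omega>) (at_right t)"
  shows "(\<lambda>p. f (max 0 (fst p)) (snd p)) \<in> borel \<Otimes>\<^sub>M N \<rightarrow>\<^sub>M borel"
proof (rule borel_measurable_LIMSEQ_metric)
  let ?r = "\<lambda>k t. (of_int \<lfloor>real (Suc k) * max 0 t\<rfloor> + 1) / real (Suc k)"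
  fix k
  have [measurable]: "(\<lambda>p. f (max 0 ((of_int i + 1) / real (Suc k))) (snd p)) \<in> borel \<Otimes>\<^sub>M N \<rightarrow>\<^sub>M borel" for i :: int
    by (rule measurable_compose[OF measurable_snd meas]) simp
  have "(\<lambda>p. f (max 0 ((of_int \<lfloor>real (Suc k) * max 0 (fst p)\<rfloor> + 1) / real (Suc k))) (snd p)) \<in> (borel :: real measure) \<Otimes>\<^sub>M N \<rightarrow>\<^sub>M borel"
    by (rule measurable_compose_countable[where g = "\<lambda>p. \<lfloor>real (Suc k) * max 0 (fst p)\<rfloor>"
        and f = "\<lambda>i p. f (max 0 ((of_int i + 1) / real (Suc k))) (snd p)"]) measurable
  moreover have "max 0 (?r k t) = ?r k t" for t by simp
  ultimately show "(\<lambda>p. f (?r k (fst p)) (snd p)) \<in> borel \<Otimes>\<^sub>M N \<rightarrow>\<^sub>M borel" by simp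
next
  let ?r = "\<lambda>k t. (of_int \<lfloor>real (Suc k) * max 0 t\<rfloor> + 1) / real (Suc k)"
  fix p :: "real \<times> 'a" assume p: "p \<in> space (borel \<Otimes>\<^sub>M N)"
  define t where "t = max 0 (fst p)"
  have "?r k (fst p) > t \<and> ?r k (fst p) \<le> t + 1 / real (Suc k)" for k
  proof -
    define N where "N = real (Suc k)"
    have N: "0 < N" by (simp add: N_def)
    have f: "N * t < of_int \<lfloor>N * t\<rfloor> + 1" "of_int \<lfloor>N * t\<rfloor> \<le> N * t" by linarith+
    have "t < (of_int \<lfloor>N * t\<rfloor> + 1) / N" using f N by (simp add: pos_less_divide_eq mult.commute)
    moreover have "(of_int \<lfloor>N * t\<rfloor> + 1) / N \<le> t + 1 / N"
      using f N by (simp add: add_divide_distrib pos_divide_le_eq mult.commute)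
    ultimately show ?thesis by (simp add: t_def[symmetric] N_def[symmetric] del: of_nat_Suc)
  qed
  then have r: "\<And>k. ?r k (fst p) > t" "\<And>k. ?r k (fst p) \<le> t + 1 / real (Suc k)" by auto
  have "(\<lambda>k. t + inverse (real (Suc k))) \<longlonglongrightarrow> t + 0"
    by (intro tendsto_intros LIMSEQ_inverse_real_of_nat)
  then have inv: "(\<lambda>k. t + 1 / real (Suc k)) \<longlonglongrightarrow> t" by (simp add: inverse_eq_divide)
  have "(\<lambda>k. ?r k (fst p)) \<longlonglongrightarrow> t"
  proof (rule real_tendsto_sandwich[OF _ _ tendsto_const inv])
    show "\<forall>\<^sub>F k in sequentially. t \<le> ?r k (fst p)" by (intro always_eventually allI less_imp_le r(1))
    show "\<forall>\<^sub>F k in sequentially. ?r k (fst p) \<le> t + 1 / real (Suc k)" by (intro always_eventually allI r(2))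
  qed
  moreover have "?r k (fst p) \<in> {t<..} \<and> ?r k (fst p) \<noteq> t" for k using r(1)[of k] by force
  ultimately have L1: "filterlim (\<lambda>k. ?r k (fst p)) (at_right t) sequentially"
    unfolding filterlim_at by (intro conjI always_eventually allI) blast+
  have L2: "((\<lambda>s. f s (snd p)) \<longlongrightarrow> f t (snd p)) (at_right t)"
    using p by (intro cont) (auto simp: t_def space_pair_measure)
  show "(\<lambda>k. f (?r k (fst p)) (snd p)) \<longlonglongrightarrow> f (max 0 (fst p)) (snd p)"
    using filterlim_compose[OF L2 L1] by (simp only: t_def)
qed

lemma measurable_natural_filtration:
  assumes "0 \<le> s" "ennreal s \<le> t" shows "X s \<in> natural_filtration M X t \<rightarrow>\<^sub>M borel"
  unfolding natural_filtration_def
  by (rule measurableI) (use assms in \<open>auto simp: space_measure_of_conv intro!: sigma_sets.Basic\<close>)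

lemma space_natural_filtration [simp]: "space (natural_filtration M X t) = space M"
  by (simp add: natural_filtration_def space_measure_of_conv)

lemma sets_natural_filtration:
  "sets (natural_filtration M X t) =
    sigma_sets (space M) {X s -` A \<inter> space M | s A. 0 \<le> s \<and> ennreal s \<le> t \<and> A \<in> sets borel}"
  unfolding natural_filtration_def by (intro sets_measure_of) auto

lemma natural_filtration_mono:
  assumes "s \<le> t" shows "sets (natural_filtration M X s) \<subseteq> sets (natural_filtration M X t)"
  unfolding sets_natural_filtration by (intro sigma_sets_mono') (use assms order_trans in blast)

lemma space_right_filtration [simp]: "space (right_filtration M X t) = space M"
  by (simp add: right_filtration_def space_measure_of_conv)

lemma sets_right_filtration:
  "sets (right_filtration M X t) = {A \<in> sets (natural_filtration M X \<infinity>). \<forall>u>t. A \<in> sets (natural_filtration M X u)}"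
  unfolding right_filtration_def
proof (intro sigma_algebra.sets_measure_of_eq)
  let ?N = "natural_filtration M X"
  have "A \<subseteq> space M" if "A \<in> sets (?N u)" for A u using sets.sets_into_space[OF that] by simp
  moreover have "space M - A \<in> sets (?N u)" if "A \<in> sets (?N u)" for A u using sets.compl_sets[OF that] by simp
  moreover have "(\<Union>i::nat. A i) \<in> sets (?N u)" if "\<And>i. A i \<in> sets (?N u)" for A u using that by auto
  ultimately show "sigma_algebra (space M) {A \<in> sets (?N \<infinity>). \<forall>u>t. A \<in> sets (?N u)}"
    unfolding sigma_algebra_iff2 by (auto simp: image_subset_iff)
qed

lemma right_filtration_in_natural:
  "t < u \<Longrightarrow> sets (right_filtration M X t) \<subseteq> sets (natural_filtration M X u)"
  "sets (right_filtration M X t) \<subseteq> sets (natural_filtration M X \<infinity>)"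
  by (auto simp: sets_right_filtration)

lemma filtration_right: "filtration (space M) (right_filtration M X)"
  by unfold_locales (auto simp: sets_right_filtration)

lemma exit_time_less_iff:
  assumes "0 < t" shows "exit_time X A \<omega> < ennreal t \<longleftrightarrow> (\<exists>s>0. s < t \<and> X s \<omega> \<notin> A)"
  unfolding exit_time_def INF_less_iff using assms by (auto simp: ennreal_less_iff)

text \<open>The complement of \<open>A\<close> is open and the path right-continuous, so a path
  found outside \<open>A\<close> remains outside for a short while, which contains a rational time.
  The event becomes a countable union.\<close>

lemma exit_time_less_iff_rational:
  assumes "0 < t" "closed A" "cadlag (\<lambda>s. X s \<omega>)"
  shows "exit_time X A \<omega> < ennreal t \<longleftrightarrow> (\<exists>q\<in>\<rat>. 0 < q \<and> q < t \<and> X q \<omega> \<notin> A)"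
proof
  assume "exit_time X A \<omega> < ennreal t"
  then obtain s where s: "0 < s" "s < t" "X s \<omega> \<in> - A" using exit_time_less_iff[OF assms(1), of X A \<omega>] by auto
  have "((\<lambda>u. X u \<omega>) \<longlongrightarrow> X s \<omega>) (at_right s)" using assms(3) s by (simp add: cadlag_def)
  then have "\<forall>\<^sub>F u in at_right s. X u \<omega> \<in> - A"
    by (rule topological_tendstoD) (use s assms(2) in \<open>auto simp: open_Compl\<close>)
  then obtain b where b: "s < b" "\<And>u. s < u \<Longrightarrow> u < b \<Longrightarrow> X u \<omega> \<in> - A"
    unfolding eventually_at_right_field by blast
  obtain q where "q \<in> \<rat>" "s < q" "q < min b t" using Rats_dense_in_real[of s "min b t"] b s by auto
  then show "\<exists>q\<in>\<rat>. 0 < q \<and> q < t \<and> X q \<omega> \<notin> A" using b(2)[of q] s by (intro bexI[of _ q]) auto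
qed (auto simp: exit_time_less_iff[OF assms(1)])

lemma before_exit_time:
  assumes "ennreal s < exit_time X A \<omega>" "0 < u" "u \<le> s" shows "X u \<omega> \<in> A"
proof (rule ccontr)
  assume "X u \<omega> \<notin> A"
  then have "exit_time X A \<omega> \<le> ennreal u" unfolding exit_time_def using assms(2) by (intro INF_lower) auto
  then show False using assms by (metis ennreal_leI leD order_trans)
qed

lemma exit_time_ge:
  assumes "\<And>u. 0 < u \<Longrightarrow> u \<le> s \<Longrightarrow> X u \<omega> \<in> A" shows "ennreal s \<le> exit_time X A \<omega>"
  unfolding exit_time_def
proof (rule INF_greatest)
  fix t assume "t \<in> {t. 0 < t \<and> X t \<omega> \<notin> A}"
  then have "s < t" using assms[of t] by force
  then show "ennreal s \<le> ennreal t" by (intro ennreal_leI) simp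
qed

text \<open>At the exit time itself the path may still sit on the boundary of \<open>A\<close>. It
  cannot be in the interior, since it would then stay there for a while and the infimum would be
  later.\<close>

lemma at_exit_time:
  assumes c: "cadlag (\<lambda>s. X s \<omega>)" and e: "exit_time X A \<omega> = ennreal e" "0 \<le> e"
  shows "X e \<omega> \<notin> interior A"
proof
  assume i: "X e \<omega> \<in> interior A"
  have "((\<lambda>u. X u \<omega>) \<longlongrightarrow> X e \<omega>) (at_right e)" using c e by (simp add: cadlag_def)
  then have "\<forall>\<^sub>F u in at_right e. X u \<omega> \<in> interior A" by (rule topological_tendstoD) (use i in auto)
  then obtain b where b: "e < b" "\<And>u. e < u \<Longrightarrow> u < b \<Longrightarrow> X u \<omega> \<in> interior A"
    unfolding eventually_at_right_field by blast
  have "exit_time X A \<omega> < ennreal b" using b e by (simp add: ennreal_less_iff)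
  then obtain s where s: "0 < s" "s < b" "X s \<omega> \<notin> A" using exit_time_less_iff[of b X A \<omega>] b e by auto
  then have "\<not> e < s" "s \<noteq> e" using b(2)[of s] i interior_subset[of A] by auto
  then have "s < e" by simp
  have "exit_time X A \<omega> \<le> ennreal s" unfolding exit_time_def using s by (intro INF_lower) auto
  then show False using e \<open>s < e\<close> s by (simp add: ennreal_le_iff2)
qed

text \<open>The event that the exit occurs by time \<open>t\<close> is the intersection of the
  events that it occurs before \<open>v\<close>, for \<open>v\<close> decreasing to
  \<open>t\<close>. It is known at every time after \<open>t\<close> but possibly not at
  \<open>t\<close>, which is why the right-continuous filtration appears.\<close>

lemma stopping_time_exit_time:
  assumes "closed A" "\<And>\<omega>. \<omega> \<in> space M \<Longrightarrow> cadlag (\<lambda>s. X s \<omega>)"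
  shows "stopping_time (right_filtration M X) (exit_time X A)"
proof
  fix t
  have less: "{\<omega> \<in> space M. exit_time X A \<omega> < ennreal v} \<in> sets (natural_filtration M X u)"
    if "0 < v" "ennreal v \<le> u" for v u
  proof -
    have "{\<omega> \<in> space M. exit_time X A \<omega> < ennreal v} = (\<Union>q\<in>\<rat> \<inter> {0<..<v}. X q -` (- A) \<inter> space M)"
    proof -
      have "exit_time X A \<omega> < ennreal v \<longleftrightarrow> (\<exists>q\<in>\<rat> \<inter> {0<..<v}. X q \<omega> \<notin> A)" if "\<omega> \<in> space M" for \<omega>
        using exit_time_less_iff_rational[where X = X and \<omega> = \<omega>, OF \<open>0 < v\<close> assms(1) assms(2)[OF that]]
        by (simp add: Bex_def)
      then show ?thesis by auto
    qed
    also have "\<dots> \<in> sets (natural_filtration M X u)"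
    proof (intro sets.countable_UN'')
      show "countable (\<rat> \<inter> {0<..<v})" by (rule countable_subset[OF _ countable_rat]) auto
      fix q assume "q \<in> \<rat> \<inter> {0<..<v}"
      then have q: "0 \<le> q" "ennreal q \<le> ennreal v" by (auto intro: ennreal_leI)
      then have "X q \<in> natural_filtration M X u \<rightarrow>\<^sub>M borel"
        using that(2) by (intro measurable_natural_filtration) auto
      then have "X q -` (- A) \<inter> space (natural_filtration M X u) \<in> sets (natural_filtration M X u)"
        by (rule measurable_sets) (use assms(1) in auto)
      then show "X q -` (- A) \<inter> space M \<in> sets (natural_filtration M X u)" by simp
    qed
    finally show ?thesis .
  qed
  have le: "{\<omega> \<in> space M. exit_time X A \<omega> \<le> t} \<in> sets (natural_filtration M X u)" if "t < u" for u
  proof -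
    from that obtain r where r: "0 \<le> r" "t = ennreal r" by (cases t) auto
    obtain b where b: "r < b" "ennreal b \<le> u"
    proof (cases u)
      case (real v) then show ?thesis using that[of v] \<open>t < u\<close> r by (simp add: ennreal_less_iff)
    qed (use that[of "r + 1"] in auto)
    define v where "v k = r + (b - r) / real (Suc k)" for k
    have v: "r < v k" "v k \<le> b" for k
      using b divide_left_mono[of 1 "real (Suc k)" "b - r"] divide_pos_pos[of "b - r" "real (Suc k)"]
      by (auto simp: v_def)
    have "v \<longlonglongrightarrow> r"
    proof -
      have "(\<lambda>k. r + (b - r) * inverse (real (Suc k))) \<longlonglongrightarrow> r + (b - r) * 0"
        by (intro tendsto_intros LIMSEQ_inverse_real_of_nat)
      then show ?thesis by (simp add: v_def[abs_def] divide_inverse)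
    qed
    have "exit_time X A \<omega> \<le> t \<longleftrightarrow> (\<forall>k. exit_time X A \<omega> < ennreal (v k))" for \<omega>
    proof
      assume "exit_time X A \<omega> \<le> t" then show "\<forall>k. exit_time X A \<omega> < ennreal (v k)"
        using v r by (auto intro: le_less_trans simp: ennreal_less_iff)
    next
      assume *: "\<forall>k. exit_time X A \<omega> < ennreal (v k)"
      have "(\<lambda>k. ennreal (v k)) \<longlonglongrightarrow> ennreal r" by (intro tendsto_intros \<open>v \<longlonglongrightarrow> r\<close>)
      then show "exit_time X A \<omega> \<le> t" unfolding r(2)
        by (rule tendsto_lowerbound) (use * in \<open>auto intro!: always_eventually less_imp_le\<close>)
    qed
    then have "{\<omega> \<in> space M. exit_time X A \<omega> \<le> t} = (\<Inter>k. {\<omega> \<in> space M. exit_time X A \<omega> < ennreal (v k)})" by auto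
    also have "\<dots> \<in> sets (natural_filtration M X u)"
      using v r b by (intro sets.countable_INT' ) (auto intro!: less elim: order.strict_trans1 intro: order_trans[OF ennreal_leI])
    finally show ?thesis .
  qed
  have "{\<omega> \<in> space M. exit_time X A \<omega> \<le> t} \<in> sets (natural_filtration M X \<infinity>)"
  proof (cases "t < \<infinity>")
    case False
    then have "{\<omega> \<in> space M. exit_time X A \<omega> \<le> t} = space M" by (auto simp: not_less top_unique)
    then show ?thesis using sets.top[of "natural_filtration M X \<infinity>"] by simp
  qed (rule le)
  then show "Measurable.pred (right_filtration M X t) (\<lambda>\<omega>. exit_time X A \<omega> \<le> t)"
    using le by (auto simp: pred_def sets_right_filtration)
qed

section \<open>Measurability of paths and of the position at a stopping time\<close>

locale markov_process =
  fixes M :: "'w measure" and P :: "real^'d::finite \<Rightarrow> 'w measure" and X :: "real \<Rightarrow> 'w \<Rightarrow> real^'d"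
  assumes strong_markov: "strong_markov_process M P X"
begin

lemma prob_space_P: "prob_space (P x)" and sets_P [simp, measurable_cong]: "sets (P x) = sets M"
  and X_measurable: "0 \<le> t \<Longrightarrow> X t \<in> M \<rightarrow>\<^sub>M borel"
  and X_cadlag: "\<omega> \<in> space M \<Longrightarrow> cadlag (\<lambda>t. X t \<omega>)"
  and X_kernel: "0 \<le> t \<Longrightarrow> (\<lambda>x. distr (P x) borel (X t)) \<in> borel \<rightarrow>\<^sub>M prob_algebra borel"
  using strong_markov unfolding strong_markov_process_def by auto

lemma space_P [simp]: "space (P x) = space M"
  by (rule sets_eq_imp_space_eq) simp

abbreviation "F \<equiv> right_filtration M X"
abbreviation "G \<equiv> natural_filtration M X"

sublocale filtration "space M" F by (rule filtration_right)

lemma right_filtration_P [simp]: "right_filtration (P x) X = F"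
  by (simp add: fun_eq_iff right_filtration_def natural_filtration_def)

lemma sets_G_M: "sets (G t) \<subseteq> sets M"
  unfolding sets_natural_filtration
  using X_measurable by (intro sets.sigma_sets_subset) (auto intro: measurable_sets)

lemma sets_F_M: "sets (F t) \<subseteq> sets M"
  using right_filtration_in_natural(2) sets_G_M by blast

lemma X_right: "0 \<le> t \<Longrightarrow> \<omega> \<in> space M \<Longrightarrow> ((\<lambda>s. X s \<omega>) \<longlongrightarrow> X t \<omega>) (at_right t)"
  using X_cadlag by (simp add: cadlag_def)

lemma X_joint_G: "(\<lambda>p. X (max 0 (fst p)) (snd p)) \<in> borel \<Otimes>\<^sub>M G top \<rightarrow>\<^sub>M borel"
  by (rule measurable_right_continuous) (auto intro: measurable_natural_filtration X_right)

lemma X_joint: "(\<lambda>p. X (max 0 (fst p)) (snd p)) \<in> borel \<Otimes>\<^sub>M M \<rightarrow>\<^sub>M borel"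
  by (rule measurable_right_continuous) (auto intro: X_measurable X_right)

text \<open>Progressive measurability: the path frozen at time \<open>u\<close> is right-continuous
  and all its positions are known at time \<open>u\<close>.\<close>

lemma X_joint_stopped:
  assumes "0 \<le> u" shows "(\<lambda>p. X (min (max 0 (fst p)) u) (snd p)) \<in> borel \<Otimes>\<^sub>M G (ennreal u) \<rightarrow>\<^sub>M borel"
proof (rule measurable_right_continuous[where f = "\<lambda>t. X (min t u)"])
  fix t :: real assume t: "0 \<le> t"
  show "X (min t u) \<in> G (ennreal u) \<rightarrow>\<^sub>M borel"
    using t assms by (intro measurable_natural_filtration) (auto intro: ennreal_leI)
  fix \<omega> assume "\<omega> \<in> space (G (ennreal u))"
  then have w: "\<omega> \<in> space M" by simp
  show "((\<lambda>s. X (min s u) \<omega>) \<longlongrightarrow> X (min t u) \<omega>) (at_right t)"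
  proof (cases "t < u")
    case True
    have "\<forall>\<^sub>F s in at_right t. X s \<omega> = X (min s u) \<omega>"
      unfolding eventually_at_right_field using True by (intro exI[of _ u]) auto
    then have "((\<lambda>s. X s \<omega>) \<longlongrightarrow> X (min t u) \<omega>) (at_right t) \<longleftrightarrow> ((\<lambda>s. X (min s u) \<omega>) \<longlongrightarrow> X (min t u) \<omega>) (at_right t)"
      by (rule filterlim_cong[OF refl refl])
    then show ?thesis using X_right[OF t w] True by simp
  next
    case False
    have "\<forall>\<^sub>F s in at_right t. X (min s u) \<omega> = X (min t u) \<omega>"
      unfolding eventually_at_right_field using False by (intro exI[of _ "t + 1"]) auto
    then show ?thesis by (rule tendsto_eventually)
  qed
qed

lemma measurable_X_compose:
  assumes [measurable]: "r \<in> borel_measurable M" and "\<And>\<omega>. \<omega> \<in> space M \<Longrightarrow> 0 \<le> r \<omega>"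
  shows "(\<lambda>\<omega>. X (r \<omega>) \<omega>) \<in> M \<rightarrow>\<^sub>M borel"
proof -
  have "(\<lambda>\<omega>. (r \<omega>, \<omega>)) \<in> M \<rightarrow>\<^sub>M borel \<Otimes>\<^sub>M M" by measurable
  from measurable_compose[OF this X_joint]
  have "(\<lambda>\<omega>. X (max 0 (r \<omega>)) \<omega>) \<in> M \<rightarrow>\<^sub>M borel" by simp
  then show ?thesis by (rule measurable_cong[THEN iffD1, rotated]) (use assms(2) in \<open>simp add: max_def\<close>)
qed

lemma stopping_time_measurable: "stopping_time F T \<Longrightarrow> T \<in> borel_measurable M"
  by (rule measurable_stopping_time[where F = F]) (use sets_F_M in auto)

text \<open>For \<open>s < u\<close> the time \<open>min T s\<close> is measurable with respect to
  \<open>G u\<close>; composing it with the path frozen at \<open>u\<close> shows that the position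
  at \<open>T\<close> is known at time \<open>u\<close> on the event that \<open>T\<close> is at
  most \<open>s\<close>. Letting \<open>u\<close> decrease to \<open>s\<close> lands in
  \<open>F s\<close>.\<close>

lemma X_stopped_pre_sigma:
  assumes T: "stopping_time F T" and C [measurable]: "C \<in> sets borel"
  shows "{\<omega> \<in> space M. T \<omega> < \<infinity> \<and> X (enn2real (T \<omega>)) \<omega> \<in> C} \<in> sets (pre_sigma T)"
proof (rule sets_pre_sigmaI[OF T])
  fix t
  have key: "{\<omega> \<in> space M. T \<omega> \<le> ennreal s \<and> X (enn2real (T \<omega>)) \<omega> \<in> C} \<in> sets (G (ennreal u))"
    if s: "0 \<le> s" "s < u" for s u
  proof -
    have "{\<omega> \<in> space M. T \<omega> \<le> v} \<in> sets (G (ennreal u))" if "v < ennreal u" for v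
      using stopping_timeD[OF T, of v] right_filtration_in_natural(1)[OF that, of M X] by (auto simp: pred_def)
    note Tm = this
    have "(\<lambda>\<omega>. min (T \<omega>) (ennreal s)) \<in> borel_measurable (G (ennreal u))"
    proof (rule borel_measurableI_le)
      fix y
      show "{\<omega> \<in> space (G (ennreal u)). min (T \<omega>) (ennreal s) \<le> y} \<in> sets (G (ennreal u))"
      proof (cases "ennreal s \<le> y")
        case True
        then have "{\<omega> \<in> space (G (ennreal u)). min (T \<omega>) (ennreal s) \<le> y} = space (G (ennreal u))"
          by (auto simp: min_le_iff_disj)
        then show ?thesis by (simp only: sets.top)
      next
        case False
        then have "{\<omega> \<in> space (G (ennreal u)). min (T \<omega>) (ennreal s) \<le> y} = {\<omega> \<in> space M. T \<omega> \<le> y}"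
          by (auto simp: min_le_iff_disj)
        moreover have "y < ennreal u" using False s by (meson ennreal_leI less_imp_le not_le order_le_less_trans order.strict_trans2)
        ultimately show ?thesis using Tm by simp
      qed
    qed
    then have [measurable]: "(\<lambda>\<omega>. enn2real (min (T \<omega>) (ennreal s))) \<in> borel_measurable (G (ennreal u))" by measurable
    have "(\<lambda>\<omega>. (enn2real (min (T \<omega>) (ennreal s)), \<omega>)) \<in> G (ennreal u) \<rightarrow>\<^sub>M borel \<Otimes>\<^sub>M G (ennreal u)" by measurable
    from measurable_compose[OF this X_joint_stopped] s
    have [measurable]: "(\<lambda>\<omega>. X (min (enn2real (min (T \<omega>) (ennreal s))) u) \<omega>) \<in> G (ennreal u) \<rightarrow>\<^sub>M borel" by simp
    have [measurable]: "{\<omega> \<in> space M. T \<omega> \<le> ennreal s} \<in> sets (G (ennreal u))" using s by (intro Tm) (simp add: ennreal_less_iff)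
    have "{\<omega> \<in> space (G (ennreal u)). X (min (enn2real (min (T \<omega>) (ennreal s))) u) \<omega> \<in> C} \<inter> {\<omega> \<in> space M. T \<omega> \<le> ennreal s} \<in> sets (G (ennreal u))"
      by measurable
    also have "{\<omega> \<in> space (G (ennreal u)). X (min (enn2real (min (T \<omega>) (ennreal s))) u) \<omega> \<in> C} \<inter> {\<omega> \<in> space M. T \<omega> \<le> ennreal s}
      = {\<omega> \<in> space M. T \<omega> \<le> ennreal s \<and> X (enn2real (T \<omega>)) \<omega> \<in> C}"
    proof -
      have "min (enn2real (min (T \<omega>) (ennreal s))) u = enn2real (T \<omega>)" if "T \<omega> \<le> ennreal s" for \<omega>
        using that s enn2real_mono[OF that] by (simp add: min_def)
      then show ?thesis by auto
    qed
    finally show ?thesis .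
  qed
  have fin: "{\<omega> \<in> {\<omega> \<in> space M. T \<omega> < \<infinity> \<and> X (enn2real (T \<omega>)) \<omega> \<in> C}. T \<omega> \<le> ennreal s}
      = {\<omega> \<in> space M. T \<omega> \<le> ennreal s \<and> X (enn2real (T \<omega>)) \<omega> \<in> C}" for s
    by (auto intro: order.strict_trans1)
  have inf: "{\<omega> \<in> space M. T \<omega> < \<infinity> \<and> X (enn2real (T \<omega>)) \<omega> \<in> C}
      = (\<Union>k. {\<omega> \<in> space M. T \<omega> \<le> ennreal (real k) \<and> X (enn2real (T \<omega>)) \<omega> \<in> C})"
  proof -
    have "T \<omega> < \<infinity> \<longleftrightarrow> (\<exists>k. T \<omega> \<le> ennreal (real k))" for \<omega>
      by (cases "T \<omega>") (auto simp: real_arch_simple top_unique intro: order.strict_trans1)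
    then show ?thesis by auto
  qed
  have Gu: "{\<omega> \<in> space M. T \<omega> \<le> ennreal s \<and> X (enn2real (T \<omega>)) \<omega> \<in> C} \<in> sets (G u)" if s: "0 \<le> s" "ennreal s < u" for s u
  proof -
    obtain b where "s < b" "ennreal b \<le> u"
    proof (cases u)
      case (real v) then show ?thesis using that[of v] s by (simp add: ennreal_less_iff)
    qed (use that[of "s + 1"] in auto)
    then show ?thesis using key[OF s(1), of b] natural_filtration_mono[of "ennreal b" u M X] by auto
  qed
  show "{\<omega> \<in> {\<omega> \<in> space M. T \<omega> < \<infinity> \<and> X (enn2real (T \<omega>)) \<omega> \<in> C}. T \<omega> \<le> t} \<in> sets (F t)"
  proof (cases t)
    case (real s)
    then show ?thesis unfolding sets_right_filtration real fin using Gu[of s] by auto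
  next
    case top
    then have "{\<omega> \<in> {\<omega> \<in> space M. T \<omega> < \<infinity> \<and> X (enn2real (T \<omega>)) \<omega> \<in> C}. T \<omega> \<le> t}
      = (\<Union>k. {\<omega> \<in> space M. T \<omega> \<le> ennreal (real k) \<and> X (enn2real (T \<omega>)) \<omega> \<in> C})"
      using inf by (simp only: top_greatest simp_thms Collect_mem_eq)
    also have "\<dots> \<in> sets (F t)" unfolding sets_right_filtration using top Gu by auto
    finally show ?thesis .
  qed
qed

end

section \<open>Optional stopping\<close>

locale stable_process = stable_like n \<kappa> \<alpha> + markov_process M P X
  for n :: "real^'d::finite \<Rightarrow> real^'d \<Rightarrow> real" and \<kappa> \<alpha> :: real
    and M :: "'w measure" and P :: "real^'d \<Rightarrow> 'w measure" and X :: "real \<Rightarrow> 'w \<Rightarrow> real^'d" +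
  assumes martingale_problem: "\<And>x. solves_martingale_problem (generator n) (P x) X x"
begin

lemma AE_start: "AE \<omega> in P x. X 0 \<omega> = x"
proof -
  interpret prob_space "P x" by (rule prob_space_P)
  note [measurable] = X_measurable[of 0]
  have "prob {\<omega> \<in> space (P x). X 0 \<omega> = x} = 1"
    using martingale_problem[of x] by (simp add: solves_martingale_problem_def)
  then show ?thesis by (subst (asm) prob_Collect_eq_1) auto
qed

text \<open>The process of the martingale problem with the symmetrised operator. On the interval of
  integration \<open>max 0 s\<close> equals \<open>s\<close>; it is written so to match the joint
  measurability of paths.\<close>

definition mart :: "(real^'d \<Rightarrow> real) \<Rightarrow> real \<Rightarrow> 'w \<Rightarrow> real" where
  "mart f t \<omega> = f (X t \<omega>) - f (X 0 \<omega>) - (LINT s|lborel. indicator {0..t} s * sym_generator f (X (max 0 s) \<omega>))"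

lemma martingale_mart:
  assumes "smooth_bound C f" shows "martingale (P x) F (mart f)"
proof -
  have "(LINT s:{0..t}|lborel. generator n f (X s \<omega>)) = (LINT s|lborel. indicator {0..t} s * sym_generator f (X (max 0 s) \<omega>))" for t \<omega>
    unfolding set_lebesgue_integral_def
    by (intro Bochner_Integration.integral_cong) (auto simp: generator_eq[OF assms] indicator_def)
  note eq = this
  have "martingale (P x) F (\<lambda>t \<omega>. f (X t \<omega>) - f (X 0 \<omega>) - (LINT s:{0..t}|lborel. generator n f (X s \<omega>)))"
    using martingale_problem[of x] smooth_bound_C2_bounded[OF assms]
    unfolding solves_martingale_problem_def right_filtration_P by blast
  then show ?thesis unfolding eq mart_def[abs_def] .
qed

lemma mart_integrable: "smooth_bound C f \<Longrightarrow> 0 \<le> t \<Longrightarrow> integrable (P x) (mart f t)"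
  using martingale_mart[of C f x] by (simp add: martingale_def)

lemma mart_increment:
  assumes f: "smooth_bound C f" and st: "0 \<le> s" "s \<le> t" and A: "A \<in> sets (F (ennreal s))"
  shows "(LINT \<omega>|P x. (mart f t \<omega> - mart f s \<omega>) * indicator A \<omega>) = 0"
proof -
  interpret prob_space "P x" by (rule prob_space_P)
  interpret finite_measure_subalgebra "P x" "F (ennreal s)"
    by unfold_locales (auto simp: subalgebra_def sets_F_M[THEN subsetD])
  have A' [measurable]: "A \<in> sets M" using A sets_F_M by auto
  have int: "integrable (P x) (\<lambda>\<omega>. mart f r \<omega> * indicator A \<omega>)" if "0 \<le> r" for r
    using mart_integrable[OF f that, of x] by (intro integrable_real_mult_indicator) auto
  have "(\<integral>\<omega>\<in>A. mart f t \<omega> \<partial>P x) = (\<integral>\<omega>\<in>A. real_cond_exp (P x) (F (ennreal s)) (mart f t) \<omega> \<partial>P x)"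
    using st by (intro real_cond_exp_intA mart_integrable[OF f] A) auto
  also have "\<dots> = (\<integral>\<omega>\<in>A. mart f s \<omega> \<partial>P x)"
    unfolding set_lebesgue_integral_def
  proof (rule integral_cong_AE)
    have "AE \<omega> in P x. real_cond_exp (P x) (F (ennreal s)) (mart f t) \<omega> = mart f s \<omega>"
      using martingale_mart[OF f, of x] st by (simp add: martingale_def)
    then show "AE \<omega> in P x. indicat_real A \<omega> *\<^sub>R real_cond_exp (P x) (F (ennreal s)) (mart f t) \<omega> = indicat_real A \<omega> *\<^sub>R mart f s \<omega>"
      by eventually_elim simp
    have "mart f s \<in> borel_measurable (P x)" using mart_integrable[OF f st(1), of x] by auto
    then show "(\<lambda>\<omega>. indicat_real A \<omega> *\<^sub>R mart f s \<omega>) \<in> borel_measurable (P x)" by measurable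
    show "(\<lambda>\<omega>. indicat_real A \<omega> *\<^sub>R real_cond_exp (P x) (F (ennreal s)) (mart f t) \<omega>) \<in> borel_measurable (P x)"
      by (intro borel_measurable_scaleR borel_measurable_indicator borel_measurable_cond_exp2) auto
  qed
  finally show ?thesis
    using int[of t] int[of s] st by (simp add: set_lebesgue_integral_def algebra_simps)
qed

lemma path_measurable:
  assumes [simp]: "\<omega> \<in> space M" shows "(\<lambda>s. X (max 0 s) \<omega>) \<in> borel_measurable borel"
proof -
  have "(\<lambda>s. (s, \<omega>)) \<in> (borel :: real measure) \<rightarrow>\<^sub>M borel \<Otimes>\<^sub>M M" by measurable
  from measurable_compose[OF this X_joint] show ?thesis by simp
qed

lemma sym_generator_measurable: "smooth_bound C f \<Longrightarrow> sym_generator f \<in> borel_measurable borel"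
  by (intro borel_measurable_continuous_onI sym_generator_continuous)

lemma drift_integrable:
  assumes f: "smooth_bound C f" and w: "\<omega> \<in> space M"
  shows "integrable lborel (\<lambda>s. indicator {0..t} s * sym_generator f (X (max 0 s) \<omega>))"
proof -
  have [measurable]: "(\<lambda>s. sym_generator f (X (max 0 s) \<omega>)) \<in> borel_measurable borel"
    by (rule measurable_compose[OF path_measurable[OF w] sym_generator_measurable[OF f]])
  show ?thesis
  proof (rule Bochner_Integration.integrable_bound)
    show "integrable lborel (\<lambda>s. 2 * C * levy_mass * indicator {0..t} s)"
      by (intro integrable_mult_right integrable_real_indicator) (auto simp: emeasure_lborel_Icc_eq)
    show "AE s in lborel. norm (indicator {0..t} s * sym_generator f (X (max 0 s) \<omega>)) \<le> norm (2 * C * levy_mass * indicator {0..t} s)"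
      using sym_generator_bound[OF f] smooth_bound_nonneg[OF f] levy_mass_nonneg
      by (intro AE_I2) (auto simp: indicator_def)
  qed measurable
qed

lemma drift_lipschitz:
  assumes f: "smooth_bound C f" and w: "\<omega> \<in> space M" and st: "0 \<le> s" "s \<le> t"
  shows "\<bar>(LINT r|lborel. indicator {0..t} r * sym_generator f (X (max 0 r) \<omega>)) - (LINT r|lborel. indicator {0..s} r * sym_generator f (X (max 0 r) \<omega>))\<bar>
    \<le> 2 * C * levy_mass * (t - s)"
proof -
  note i = drift_integrable[OF f w]
  have "norm (LINT r|lborel. indicator {0..t} r * sym_generator f (X (max 0 r) \<omega>) - indicator {0..s} r * sym_generator f (X (max 0 r) \<omega>))
    \<le> (LINT r|lborel. 2 * C * levy_mass * indicator {s<..t} r)"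
  proof (rule Bochner_Integration.integral_norm_bound_integral)
    show "integrable lborel (\<lambda>r. 2 * C * levy_mass * indicator {s<..t} r)"
      using st by (intro integrable_mult_right integrable_real_indicator) auto
    fix r
    have "indicator {0..t} r * sym_generator f (X (max 0 r) \<omega>) - indicator {0..s} r * sym_generator f (X (max 0 r) \<omega>)
      = indicator {s<..t} r * sym_generator f (X (max 0 r) \<omega>)" using st by (auto simp: indicator_def)
    then show "norm (indicator {0..t} r * sym_generator f (X (max 0 r) \<omega>) - indicator {0..s} r * sym_generator f (X (max 0 r) \<omega>))
      \<le> 2 * C * levy_mass * indicator {s<..t} r"
      using sym_generator_bound[OF f, of "X (max 0 r) \<omega>"] by (auto simp: indicator_def)
  qed (use i in auto)
  also have "(LINT r|lborel. 2 * C * levy_mass * indicator {s<..t} r) = 2 * C * levy_mass * (t - s)"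
    using st by simp
  finally show ?thesis using i by simp
qed

lemma mart_0: "mart f 0 \<omega> = 0"
proof -
  have "indicator {0..0} s * sym_generator f (X (max 0 s) \<omega>) = indicator {0} s * sym_generator f (X 0 \<omega>)" for s :: real
    by (auto simp: indicator_def)
  then have "(LINT s|lborel. indicator {0..0} s * sym_generator f (X (max 0 s) \<omega>)) = (LINT (s::real)|lborel. indicator {0} s * sym_generator f (X 0 \<omega>))"
    by (simp only:)
  then show ?thesis by (simp add: mart_def)
qed

lemma mart_bound:
  assumes f: "smooth_bound C f" and w: "\<omega> \<in> space M" and st: "0 \<le> s"
  shows "\<bar>mart f s \<omega>\<bar> \<le> 2 * C + 2 * C * levy_mass * s"
  using drift_lipschitz[OF f w order_refl st] smooth_bound_abs_le[OF f, of "X s \<omega>"] smooth_bound_abs_le[OF f, of "X 0 \<omega>"] mart_0[of f \<omega>]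
  unfolding mart_def by simp

lemma mart_right:
  assumes f: "smooth_bound C f" and w: "\<omega> \<in> space M" and s: "0 \<le> s"
    and r: "\<And>k. s \<le> r k" "r \<longlonglongrightarrow> s"
  shows "(\<lambda>k. mart f (r k) \<omega>) \<longlonglongrightarrow> mart f s \<omega>"
proof -
  let ?I = "\<lambda>t. LINT u|lborel. indicator {0..t} u * sym_generator f (X (max 0 u) \<omega>)"
  have "((\<lambda>u. X u \<omega>) \<longlongrightarrow> X s \<omega>) (at s within {s..})"
    using X_right[OF s w] by (simp add: at_within_Ici_at_right)
  then have "continuous (at s within {s..}) (\<lambda>u. X u \<omega>)" by (simp add: continuous_within)
  then have Xr: "(\<lambda>k. X (r k) \<omega>) \<longlonglongrightarrow> X s \<omega>"
    using r continuous_within_sequentially[of s "{s..}" "\<lambda>u. X u \<omega>"] by (auto simp: o_def)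
  have fr: "(\<lambda>k. f (X (r k) \<omega>)) \<longlonglongrightarrow> f (X s \<omega>)"
    using continuous_on_tendsto_compose[OF smooth_bound_continuous[OF f] Xr] by simp
  have "(\<lambda>k. ?I (r k) - ?I s) \<longlonglongrightarrow> 0"
  proof (rule Lim_null_comparison)
    show "\<forall>\<^sub>F k in sequentially. norm (?I (r k) - ?I s) \<le> 2 * C * levy_mass * (r k - s)"
      using drift_lipschitz[OF f w s r(1)] by simp
    have "(\<lambda>k. 2 * C * levy_mass * (r k - s)) \<longlonglongrightarrow> 2 * C * levy_mass * (s - s)"
      by (intro tendsto_intros r)
    then show "(\<lambda>k. 2 * C * levy_mass * (r k - s)) \<longlonglongrightarrow> 0" by simp
  qed
  then have "(\<lambda>k. ?I (r k)) \<longlonglongrightarrow> ?I s" by (rule LIM_zero_cancel)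
  then show ?thesis unfolding mart_def by (intro tendsto_intros fr)
qed

text \<open>The index \<open>m\<close> marks the first grid time not below \<open>T\<close>, capped
  at \<open>t\<close>. It rounds \<open>min T t\<close> upwards by at most one mesh.\<close>

lemma stopping_grid:
  fixes T :: ennreal
  assumes t: "0 \<le> t" and N: "0 < N"
  obtains m where "m \<le> N" "\<And>j. j < N \<Longrightarrow> ennreal (t * real j / real N) < T \<longleftrightarrow> j < m"
    "enn2real (min T (ennreal t)) \<le> t * real m / real N"
    "t * real m / real N \<le> enn2real (min T (ennreal t)) + t / real N"
proof -
  define m where "m = (LEAST j. j = N \<or> \<not> ennreal (t * real j / real N) < T)"
  have m: "m = N \<or> \<not> ennreal (t * real m / real N) < T"
    unfolding m_def by (rule LeastI[where k = N]) simp
  have mN: "m \<le> N" unfolding m_def by (rule Least_le) simp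
  have less: "ennreal (t * real j / real N) < T" if "j < m" for j
    using not_less_Least[OF that[unfolded m_def]] by auto
  show ?thesis
  proof (rule that[OF mN])
    show "ennreal (t * real j / real N) < T \<longleftrightarrow> j < m" if "j < N" for j
    proof
      assume a: "ennreal (t * real j / real N) < T"
      show "j < m"
      proof (rule ccontr)
        assume "\<not> j < m"
        then have "ennreal (t * real m / real N) \<le> ennreal (t * real j / real N)" "m \<noteq> N"
          using t that by (auto intro!: ennreal_leI divide_right_mono mult_left_mono)
        then show False using a m by (auto intro: le_less_trans)
      qed
    qed (rule less)
    show "enn2real (min T (ennreal t)) \<le> t * real m / real N"
    proof (cases "m = N")
      case True
      then show ?thesis using N t by (intro enn2real_leI) auto
    next
      case False
      then show ?thesis using m t by (intro enn2real_leI) (auto simp: not_less min_le_iff_disj)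
    qed
    show "t * real m / real N \<le> enn2real (min T (ennreal t)) + t / real N"
    proof (cases m)
      case 0 then show ?thesis using t by simp
    next
      case (Suc j)
      have "t * real j / real N \<le> t * real N / real N" using Suc mN t by (intro divide_right_mono mult_left_mono) auto
      then have "ennreal (t * real j / real N) \<le> min T (ennreal t)"
        using less[of j] Suc N by (auto intro!: ennreal_leI)
      then have "enn2real (ennreal (t * real j / real N)) \<le> enn2real (min T (ennreal t))"
        by (rule enn2real_mono) (simp add: min_less_iff_disj)
      then show ?thesis using t Suc by (simp add: field_simps add_divide_distrib)
    qed
  qed
qed

text \<open>Discrete optional stopping: \<open>S N\<close> adds up the increments over grid
  intervals that start before \<open>T\<close>. Whether an interval counts is known at its left end,
  so every summand has mean 0, and the sum telescopes to the martingale at the rounded time.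
  Right-continuity and the bound on \<open>{0..t}\<close> allow the mesh to tend to 0.\<close>

lemma stopped_mart_expectation:
  assumes T: "stopping_time F T" and f: "smooth_bound C f" and t: "0 \<le> t"
  defines "\<tau> \<equiv> \<lambda>\<omega>. enn2real (min (T \<omega>) (ennreal t))"
  shows "integrable (P x) (\<lambda>\<omega>. mart f (\<tau> \<omega>) \<omega>)" "(LINT \<omega>|P x. mart f (\<tau> \<omega>) \<omega>) = 0"
proof -
  interpret prob_space "P x" by (rule prob_space_P)
  define A where "A N j = {\<omega> \<in> space M. ennreal (t * real j / real N) < T \<omega>}" for N j :: nat
  define S where "S N \<omega> = (\<Sum>j<N. (mart f (t * real (Suc j) / real N) \<omega> - mart f (t * real j / real N) \<omega>) * indicator (A N j) \<omega>)" for N \<omega>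
  have AF: "A N j \<in> sets (F (ennreal (t * real j / real N)))" for N j
    using stopping_timeD2[OF T, of "ennreal (t * real j / real N)"] by (simp add: A_def pred_def)
  then have [measurable]: "A N j \<in> sets M" for N j using sets_F_M by blast
  have mi: "integrable (P x) (mart f (t * real j / real N))" for j N using t by (intro mart_integrable[OF f]) auto
  note [measurable] = borel_measurable_integrable[OF mi]
  have Si: "integrable (P x) (S N)" for N unfolding S_def
    by (intro Bochner_Integration.integrable_sum integrable_real_mult_indicator Bochner_Integration.integrable_diff mi) auto
  have S0: "(LINT \<omega>|P x. S N \<omega>) = 0" for N
  proof -
    have "(LINT \<omega>|P x. S N \<omega>) = (\<Sum>j<N. LINT \<omega>|P x. (mart f (t * real (Suc j) / real N) \<omega> - mart f (t * real j / real N) \<omega>) * indicator (A N j) \<omega>)"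
      unfolding S_def
      by (intro Bochner_Integration.integral_sum integrable_real_mult_indicator Bochner_Integration.integrable_diff mi) auto
    also have "\<dots> = 0"
      using t by (intro sum.neutral ballI mart_increment[OF f _ _ AF]) (auto intro!: divide_right_mono mult_left_mono)
    finally show ?thesis .
  qed
  have grid: "\<exists>r. S N \<omega> = mart f r \<omega> \<and> \<tau> \<omega> \<le> r \<and> r \<le> \<tau> \<omega> + t / real N \<and> r \<le> t"
    if w: "\<omega> \<in> space M" and N: "0 < N" for N \<omega>
  proof -
    obtain m where m: "m \<le> N" "\<And>j. j < N \<Longrightarrow> ennreal (t * real j / real N) < T \<omega> \<longleftrightarrow> j < m"
        "\<tau> \<omega> \<le> t * real m / real N" "t * real m / real N \<le> \<tau> \<omega> + t / real N"
      unfolding \<tau>_def using stopping_grid[OF t N, of "T \<omega>"] by blast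
    have "S N \<omega> = (\<Sum>j<m. mart f (t * real (Suc j) / real N) \<omega> - mart f (t * real j / real N) \<omega>)"
      unfolding S_def
    proof (rule sum.mono_neutral_cong_right)
      show "\<forall>j\<in>{..<N} - {..<m}. (mart f (t * real (Suc j) / real N) \<omega> - mart f (t * real j / real N) \<omega>) * indicator (A N j) \<omega> = 0"
        using m(2) by (auto simp: A_def)
      show "(mart f (t * real (Suc j) / real N) \<omega> - mart f (t * real j / real N) \<omega>) * indicator (A N j) \<omega>
        = mart f (t * real (Suc j) / real N) \<omega> - mart f (t * real j / real N) \<omega>" if "j \<in> {..<m}" for j
        using m(1) m(2)[of j] that \<open>\<omega> \<in> space M\<close> by (auto simp: A_def)
    qed (use m(1) in auto)
    also have "\<dots> = mart f (t * real m / real N) \<omega>"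
      using sum_lessThan_telescope[of "\<lambda>j. mart f (t * real j / real N) \<omega>" m] by (simp add: mart_0)
    finally have "S N \<omega> = mart f (t * real m / real N) \<omega>" .
    moreover have "t * real m / real N \<le> t" using m(1) t N by (simp add: divide_le_eq mult_left_mono)
    ultimately show ?thesis using m by blast
  qed
  have tau0: "0 \<le> \<tau> \<omega>" for \<omega> by (simp add: \<tau>_def)
  have lim: "(\<lambda>N. S (Suc N) \<omega>) \<longlonglongrightarrow> mart f (\<tau> \<omega>) \<omega>" if w: "\<omega> \<in> space M" for \<omega>
  proof -
    obtain r where r: "\<And>N. S (Suc N) \<omega> = mart f (r N) \<omega>" "\<And>N. \<tau> \<omega> \<le> r N" "\<And>N. r N \<le> \<tau> \<omega> + t / real (Suc N)"
    proof -
      have "\<forall>N. \<exists>r. S (Suc N) \<omega> = mart f r \<omega> \<and> \<tau> \<omega> \<le> r \<and> r \<le> \<tau> \<omega> + t / real (Suc N)"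
        using grid[OF w zero_less_Suc] by blast
      from choice[OF this] show ?thesis using that by blast
    qed
    have "(\<lambda>N. \<tau> \<omega> + t * inverse (real (Suc N))) \<longlonglongrightarrow> \<tau> \<omega> + t * 0"
      by (intro tendsto_intros LIMSEQ_inverse_real_of_nat)
    then have l: "(\<lambda>N. \<tau> \<omega> + t / real (Suc N)) \<longlonglongrightarrow> \<tau> \<omega>" by (simp add: divide_inverse)
    have "r \<longlonglongrightarrow> \<tau> \<omega>"
      by (rule real_tendsto_sandwich[OF _ _ tendsto_const l]) (intro always_eventually allI r)+
    from mart_right[OF f w tau0 r(2) this] show ?thesis by (simp add: r(1))
  qed
  have meas: "(\<lambda>\<omega>. mart f (\<tau> \<omega>) \<omega>) \<in> borel_measurable (P x)"
    by (rule borel_measurable_LIMSEQ_real[where u = "\<lambda>N. S (Suc N)"]) (use lim Si in auto)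
  have bound: "\<bar>S (Suc N) \<omega>\<bar> \<le> 2 * C + 2 * C * levy_mass * t" if w: "\<omega> \<in> space M" for N \<omega>
  proof -
    obtain r where r: "S (Suc N) \<omega> = mart f r \<omega>" "\<tau> \<omega> \<le> r" "r \<le> t" using grid[OF w, of "Suc N"] by auto
    have "\<bar>mart f r \<omega>\<bar> \<le> 2 * C + 2 * C * levy_mass * r" using r tau0[of \<omega>] by (intro mart_bound[OF f w]) simp
    also have "\<dots> \<le> 2 * C + 2 * C * levy_mass * t"
      using r levy_mass_nonneg smooth_bound_nonneg[OF f] by (intro add_left_mono mult_left_mono) auto
    finally show ?thesis using r by simp
  qed
  have dct: "integrable (P x) (\<lambda>\<omega>. mart f (\<tau> \<omega>) \<omega>)" "(\<lambda>N. LINT \<omega>|P x. S (Suc N) \<omega>) \<longlonglongrightarrow> (LINT \<omega>|P x. mart f (\<tau> \<omega>) \<omega>)"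
    by (rule integrable_dominated_convergence[where s = "\<lambda>N. S (Suc N)" and w = "\<lambda>_. 2 * C + 2 * C * levy_mass * t"]
       integral_dominated_convergence[where s = "\<lambda>N. S (Suc N)" and w = "\<lambda>_. 2 * C + 2 * C * levy_mass * t"];
       use meas Si lim bound in auto)+
  then show "integrable (P x) (\<lambda>\<omega>. mart f (\<tau> \<omega>) \<omega>)" by blast
  show "(LINT \<omega>|P x. mart f (\<tau> \<omega>) \<omega>) = 0"
    using dct(2) unfolding S0 by (simp add: LIMSEQ_const_iff)
qed

section \<open>Means on the event of not being stopped yet, and Dynkin's formula\<close>

definition survival :: "real^'d \<Rightarrow> ('w \<Rightarrow> ennreal) \<Rightarrow> (real^'d \<Rightarrow> real) \<Rightarrow> real \<Rightarrow> real" where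
  "survival x T g s = (LINT \<omega>|P x. g (X (max 0 s) \<omega>) * indicator {\<omega>. ennreal s < T \<omega>} \<omega>)"

lemma survival_joint:
  assumes T: "T \<in> borel_measurable M" and g: "bounded_measurable g"
  shows "integrable (lborel \<Otimes>\<^sub>M P x) (\<lambda>(s, \<omega>). indicator {0..t} s * (g (X (max 0 s) \<omega>) * indicator {\<omega>. ennreal s < T \<omega>} \<omega>))"
proof -
  interpret prob_space "P x" by (rule prob_space_P)
  interpret pair_sigma_finite lborel "P x" ..
  obtain b where b: "\<And>x. \<bar>g x\<bar> \<le> b" and [measurable]: "g \<in> borel_measurable borel" using g by (auto simp: bounded_measurable_def)
  note [measurable] = T
  have b0: "0 \<le> b" using order_trans[OF abs_ge_zero b] .
  have [measurable]: "(\<lambda>p. X (max 0 (fst p)) (snd p)) \<in> lborel \<Otimes>\<^sub>M P x \<rightarrow>\<^sub>M borel"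
    unfolding measurable_cong_sets[OF sets_pair_measure_cong[OF sets_lborel sets_P] refl] by (rule X_joint)
  have "(\<lambda>p. indicator {0..t} (fst p) * (g (X (max 0 (fst p)) (snd p)) * (if ennreal (fst p) < T (snd p) then 1 else 0)))
      \<in> borel_measurable (lborel \<Otimes>\<^sub>M P x)" by measurable
  then have m: "(\<lambda>(s, \<omega>). indicator {0..t} s * (g (X (max 0 s) \<omega>) * indicator {\<omega>. ennreal s < T \<omega>} \<omega>)) \<in> borel_measurable (lborel \<Otimes>\<^sub>M P x)"
    by (simp add: split_beta' indicator_def of_bool_def)
  show ?thesis
  proof (rule integrableI_bounded[OF m])
    have "(\<integral>\<^sup>+p. ennreal (norm ((\<lambda>(s, \<omega>). indicator {0..t} s * (g (X (max 0 s) \<omega>) * indicator {\<omega>. ennreal s < T \<omega>} \<omega>)) p)) \<partial>(lborel \<Otimes>\<^sub>M P x))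
      \<le> (\<integral>\<^sup>+p. ennreal b * indicator ({0..t} \<times> space M) p \<partial>(lborel \<Otimes>\<^sub>M P x))"
      by (intro nn_integral_mono) (auto simp: space_pair_measure indicator_def b0 intro!: ennreal_leI b)
    also have "\<dots> = ennreal b * emeasure (lborel \<Otimes>\<^sub>M P x) ({0..t} \<times> space M)"
      by (intro nn_integral_cmult_indicator) auto
    also have "\<dots> = ennreal b * (emeasure lborel {0..t} * emeasure (P x) (space (P x)))"
      using sigma_finite_measure.emeasure_pair_measure_Times[OF prob_space_imp_sigma_finite[OF prob_space_P],
        of "{0..t}" lborel "space M" x] by simp
    also have "\<dots> < \<infinity>" using emeasure_space_1 by (simp add: ennreal_mult_less_top emeasure_lborel_Icc_eq)
    finally show "(\<integral>\<^sup>+p. ennreal (norm ((\<lambda>(s, \<omega>). indicator {0..t} s * (g (X (max 0 s) \<omega>) * indicator {\<omega>. ennreal s < T \<omega>} \<omega>)) p)) \<partial>(lborel \<Otimes>\<^sub>M P x)) < \<infinity>" .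
  qed
qed

text \<open>Dynkin's formula. The drift integral up to \<open>min T t\<close> becomes an integral
  over \<open>{0..t}\<close> restricted to \<open>s < T\<close>, at the price of a single time, and
  Fubini then moves the expectation inside.\<close>

lemma optional_stopping:
  assumes T: "stopping_time F T" and f: "smooth_bound C f" and t: "0 \<le> t"
  shows "(LINT \<omega>|P x. f (X (enn2real (min (T \<omega>) (ennreal t))) \<omega>)) = f x + (LINT s|lborel. indicator {0..t} s * survival x T (sym_generator f) s)"
proof -
  interpret prob_space "P x" by (rule prob_space_P)
  interpret pair_sigma_finite lborel "P x" ..
  note [measurable] = smooth_bound_measurable[OF f] stopping_time_measurable[OF T]
  define \<tau> where "\<tau> \<omega> = enn2real (min (T \<omega>) (ennreal t))" for \<omega>
  have tau: "0 \<le> \<tau> \<omega>" "ennreal (\<tau> \<omega>) = min (T \<omega>) (ennreal t)" for \<omega>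
    by (auto simp: \<tau>_def min_less_iff_disj)
  have [measurable]: "\<tau> \<in> borel_measurable M" unfolding \<tau>_def by measurable
  have "(\<lambda>\<omega>. X (\<tau> \<omega>) \<omega>) \<in> borel_measurable M" by (rule measurable_X_compose) (auto simp: tau)
  then have [measurable]: "(\<lambda>\<omega>. X (\<tau> \<omega>) \<omega>) \<in> borel_measurable (P x)" by simp
  have [measurable]: "X 0 \<in> borel_measurable (P x)" using X_measurable[of 0] by simp
  have i1: "integrable (P x) (\<lambda>\<omega>. f (X (\<tau> \<omega>) \<omega>))" by (rule integrable_const_bound[of _ C]) (use smooth_bound_abs_le[OF f] in auto)
  have i2: "integrable (P x) (\<lambda>\<omega>. f (X 0 \<omega>))" by (rule integrable_const_bound[of _ C]) (use smooth_bound_abs_le[OF f] in auto)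
  note mm = stopped_mart_expectation[OF T f t, of x, folded \<tau>_def]
  have i3: "(LINT \<omega>|P x. f (X 0 \<omega>)) = f x"
  proof -
    have "(LINT \<omega>|P x. f (X 0 \<omega>)) = (LINT \<omega>|P x. f x)"
      by (rule integral_cong_AE) (use AE_start[of x] in \<open>auto elim!: eventually_mono\<close>)
    then show ?thesis using prob_space by simp
  qed
  have I: "(LINT s|lborel. indicator {0..\<tau> \<omega>} s * sym_generator f (X (max 0 s) \<omega>))
      = (LINT s|lborel. indicator {0..t} s * (sym_generator f (X (max 0 s) \<omega>) * indicator {\<omega>. ennreal s < T \<omega>} \<omega>))"
    if "\<omega> \<in> space M" for \<omega>
  proof (rule integral_cong_AE)
    have [measurable]: "(\<lambda>s. sym_generator f (X (max 0 s) \<omega>)) \<in> borel_measurable borel"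
      by (rule measurable_compose[OF path_measurable[OF that] sym_generator_measurable[OF f]])
    show "(\<lambda>s. indicator {0..\<tau> \<omega>} s * sym_generator f (X (max 0 s) \<omega>)) \<in> borel_measurable lborel" by measurable
    show "(\<lambda>s. indicator {0..t} s * (sym_generator f (X (max 0 s) \<omega>) * indicator {\<omega>. ennreal s < T \<omega>} \<omega>)) \<in> borel_measurable lborel"
      unfolding indicator_def[of "{\<omega>. _ < T \<omega>}"] by simp
    show "AE s in lborel. indicator {0..\<tau> \<omega>} s * sym_generator f (X (max 0 s) \<omega>) = indicator {0..t} s * (sym_generator f (X (max 0 s) \<omega>) * indicator {\<omega>. ennreal s < T \<omega>} \<omega>)"
      using AE_lborel_singleton[of "\<tau> \<omega>"]
    proof eventually_elim
      fix s assume ne: "s \<noteq> \<tau> \<omega>"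
      have "s \<in> {0..\<tau> \<omega>} \<longleftrightarrow> s \<in> {0..t} \<and> ennreal s < T \<omega>"
      proof (cases "0 \<le> s")
        case True
        have "s < \<tau> \<omega> \<longleftrightarrow> ennreal s < min (T \<omega>) (ennreal t)"
          unfolding tau(2)[symmetric] using True by (simp add: ennreal_less_iff)
        also have "\<dots> \<longleftrightarrow> ennreal s < T \<omega> \<and> s < t" using True by (auto simp: ennreal_less_iff)
        finally have 1: "s < \<tau> \<omega> \<longleftrightarrow> ennreal s < T \<omega> \<and> s < t" .
        have 2: "t = \<tau> \<omega>" if "ennreal t < T \<omega>" using that t by (simp add: \<tau>_def min_absorb2 less_imp_le)
        show ?thesis using 1 2 ne True by (auto simp: less_le)
      qed auto
      then show "indicator {0..\<tau> \<omega>} s * sym_generator f (X (max 0 s) \<omega>) = indicator {0..t} s * (sym_generator f (X (max 0 s) \<omega>) * indicator {\<omega>. ennreal s < T \<omega>} \<omega>)"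
        by (auto simp: indicator_def)
    qed
  qed
  have "(LINT \<omega>|P x. f (X (\<tau> \<omega>) \<omega>)) - f x = (LINT \<omega>|P x. f (X (\<tau> \<omega>) \<omega>) - f (X 0 \<omega>) - mart f (\<tau> \<omega>) \<omega>)"
    using i1 i2 i3 mm by simp
  also have "\<dots> = (LINT \<omega>|P x. LINT s|lborel. indicator {0..t} s * (sym_generator f (X (max 0 s) \<omega>) * indicator {\<omega>. ennreal s < T \<omega>} \<omega>))"
    by (intro Bochner_Integration.integral_cong refl) (simp add: mart_def I)
  also have "\<dots> = (LINT s|lborel. LINT \<omega>|P x. indicator {0..t} s * (sym_generator f (X (max 0 s) \<omega>) * indicator {\<omega>. ennreal s < T \<omega>} \<omega>))"
    by (rule Fubini_integral[OF survival_joint])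
       (use sym_generator_bound[OF f] sym_generator_measurable[OF f] stopping_time_measurable[OF T] in \<open>auto intro: bounded_measurableI\<close>)
  also have "\<dots> = (LINT s|lborel. indicator {0..t} s * survival x T (sym_generator f) s)"
    by (simp add: survival_def)
  finally show ?thesis by (simp add: \<tau>_def)
qed

lemma survival_abs_le:
  assumes T: "T \<in> borel_measurable M" and g: "g \<in> borel_measurable borel" "\<And>x. \<bar>g x\<bar> \<le> b"
  shows "integrable (P x) (\<lambda>\<omega>. g (X (max 0 s) \<omega>) * indicator {\<omega>. ennreal s < T \<omega>} \<omega>)" (is "integrable _ ?h")
    and "\<bar>survival x T g s\<bar> \<le> b"
proof -
  interpret prob_space "P x" by (rule prob_space_P)
  note [measurable] = T g(1)
  have [measurable]: "X (max 0 s) \<in> borel_measurable (P x)" using X_measurable[of "max 0 s"] by simp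
  have b0: "0 \<le> b" using order_trans[OF abs_ge_zero g(2)] .
  have bd: "norm (?h \<omega>) \<le> b" for \<omega> using g(2)[of "X (max 0 s) \<omega>"] b0 by (auto simp: indicator_def)
  have [measurable]: "?h \<in> borel_measurable (P x)"
    by (simp add: indicator_def[of "{\<omega>. ennreal s < T \<omega>}"])
  show i: "integrable (P x) ?h" by (rule integrable_const_bound[of _ b]) (use bd in auto)
  have "norm (LINT \<omega>|P x. ?h \<omega>) \<le> (LINT \<omega>|P x. norm (?h \<omega>))" by (rule integral_norm_bound)
  also have "\<dots> \<le> (LINT \<omega>|P x. b)" by (rule integral_mono) (use i bd in auto)
  finally have "norm (LINT \<omega>|P x. ?h \<omega>) \<le> (LINT \<omega>|P x. b)" .
  then show "\<bar>survival x T g s\<bar> \<le> b" using prob_space by (simp add: survival_def)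
qed

lemma survival_integrable:
  assumes "T \<in> borel_measurable M" and "bounded_measurable g"
  shows "integrable lborel (\<lambda>s. indicator {0..t} s * survival x T g s)"
proof -
  interpret prob_space "P x" by (rule prob_space_P)
  interpret pair_sigma_finite lborel "P x" ..
  from integrable_fst'[OF survival_joint[OF assms, where t = t and x = x]] show ?thesis by (simp add: survival_def)
qed

lemma survival_mono:
  assumes T: "T \<in> borel_measurable M" and "bounded_measurable f" "bounded_measurable g"
    and "\<And>\<omega>. \<omega> \<in> space M \<Longrightarrow> ennreal s < T \<omega> \<Longrightarrow> f (X (max 0 s) \<omega>) \<le> g (X (max 0 s) \<omega>)"
  shows "survival x T f s \<le> survival x T g s"
proof -
  obtain b c where "f \<in> borel_measurable borel" "\<And>x. \<bar>f x\<bar> \<le> b" "g \<in> borel_measurable borel" "\<And>x. \<bar>g x\<bar> \<le> c"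
    using assms(2,3) by (auto simp: bounded_measurable_def)
  then show ?thesis unfolding survival_def
    by (intro integral_mono survival_abs_le(1)[OF T]) (auto simp: indicator_def assms(4))
qed

lemma exit_time_measurable: "closed A \<Longrightarrow> exit_time X A \<in> borel_measurable M"
  by (intro stopping_time_measurable stopping_time_exit_time X_cadlag)

lemma stopped_at_exit:
  assumes w: "\<omega> \<in> space M" and e: "exit_time X A \<omega> \<le> ennreal t" "0 \<le> t"
  shows "X (enn2real (min (exit_time X A \<omega>) (ennreal t))) \<omega> \<notin> interior A"
proof -
  have "exit_time X A \<omega> = ennreal (enn2real (exit_time X A \<omega>))"
    using e by (metis ennreal_enn2real_if ennreal_less_top leD)
  then show ?thesis using at_exit_time[of X \<omega>, OF X_cadlag[OF w]] e by (simp add: min_absorb1)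
qed

text \<open>Dynkin's formula for 1 minus a bump centred at \<open>x\<close>: this function vanishes
  at the start and equals 1 wherever the ball can be left, so its mean at the stopped time dominates
  the exit probability. Translates of one bump share one constant, hence \<open>K\<close> is the
  same for all \<open>x\<close>.\<close>

lemma exit_ball_prob:
  assumes r: "0 < r" "r \<le> 1"
  obtains K where "0 \<le> K" "\<And>x t. 0 \<le> t \<Longrightarrow> measure (P x) {\<omega> \<in> space M. exit_time X (cball x r) \<omega> \<le> ennreal t} \<le> K * t"
proof -
  obtain C0 where "smooth_bound C0 (bump :: real^'d \<Rightarrow> real)" using smooth_bound_bump by blast
  from smooth_bound_scale[OF this, of "1 / r"] r obtain C1 where C1: "smooth_bound C1 (\<lambda>x::real^'d. bump ((1 / r) *\<^sub>R x))" by auto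
  define C where "C = \<bar>1\<bar> + \<bar>- 1\<bar> * C1"
  define f where "f x y = 1 + - 1 * bump ((1 / r) *\<^sub>R (y - x))" for x y :: "real^'d"
  have f: "smooth_bound C (f x)" for x
    unfolding f_def C_def
    by (intro smooth_bound_add smooth_bound_const smooth_bound_cmult smooth_bound_translate[OF C1])
  have f0: "0 \<le> f x y" "f x x = 0" for x y using bump_le_1 by (simp_all add: f_def)
  have f1: "f x y = 1" if "y \<notin> ball x r" for x y
  proof -
    have "1 \<le> norm ((1 / r) *\<^sub>R (y - x))" using that r by (simp add: dist_norm norm_minus_commute divide_simps)
    then show ?thesis by (simp add: f_def bump_eq_0)
  qed
  have "measure (P x) {\<omega> \<in> space M. exit_time X (cball x r) \<omega> \<le> ennreal t} \<le> 2 * C * levy_mass * t" if t: "0 \<le> t" for x t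
  proof -
    interpret prob_space "P x" by (rule prob_space_P)
    let ?T = "exit_time X (cball x r)"
    have T: "stopping_time F ?T" by (intro stopping_time_exit_time X_cadlag) auto
    note [measurable] = stopping_time_measurable[OF T] smooth_bound_measurable[OF f]
    have [measurable]: "(\<lambda>\<omega>. X (enn2real (min (?T \<omega>) (ennreal t))) \<omega>) \<in> borel_measurable (P x)"
      using measurable_X_compose[of "\<lambda>\<omega>. enn2real (min (?T \<omega>) (ennreal t))"] by simp
    have "prob {\<omega> \<in> space M. ?T \<omega> \<le> ennreal t} = (LINT \<omega>|P x. indicator {\<omega> \<in> space M. ?T \<omega> \<le> ennreal t} \<omega>)"
      by (simp add: Int_absorb1 Int_commute subset_eq)
    also have "\<dots> \<le> (LINT \<omega>|P x. f x (X (enn2real (min (?T \<omega>) (ennreal t))) \<omega>))"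
    proof (rule integral_mono)
      show "integrable (P x) (\<lambda>\<omega>. f x (X (enn2real (min (?T \<omega>) (ennreal t))) \<omega>))"
        by (rule integrable_const_bound[of _ C]) (use smooth_bound_abs_le[OF f] in auto)
      fix \<omega> assume "\<omega> \<in> space (P x)"
      then show "indicator {\<omega> \<in> space M. ?T \<omega> \<le> ennreal t} \<omega> \<le> f x (X (enn2real (min (?T \<omega>) (ennreal t))) \<omega>)"
        using f1[OF stopped_at_exit[of \<omega> "cball x r" t, unfolded interior_cball]] f0 t by (auto simp: indicator_def)
    qed (auto intro!: integrable_real_indicator simp: emeasure_eq_measure)
    also have "\<dots> = (LINT s|lborel. indicator {0..t} s * survival x ?T (sym_generator (f x)) s)"
      using optional_stopping[OF T f t, of x] f0 by simp
    also have "\<dots> \<le> (LINT s|lborel. indicator {0..t} s * (2 * C * levy_mass))"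
    proof (rule integral_mono)
      show "integrable lborel (\<lambda>s. indicator {0..t} s * survival x ?T (sym_generator (f x)) s)"
        using sym_generator_bound[OF f] sym_generator_measurable[OF f]
        by (intro survival_integrable stopping_time_measurable[OF T]) (auto intro: bounded_measurableI)
      show "integrable lborel (\<lambda>s. indicator {0..t} s * (2 * C * levy_mass))"
        using t by (intro integrable_mult_left integrable_real_indicator) auto
      show "indicator {0..t} s * survival x ?T (sym_generator (f x)) s \<le> indicator {0..t} s * (2 * C * levy_mass)" for s
        using survival_abs_le(2)[OF stopping_time_measurable[OF T] sym_generator_measurable[OF f] sym_generator_bound[OF f], where x = x and s = s, THEN abs_le_D1]
        by (auto simp: indicator_def)
    qed
    also have "\<dots> = 2 * C * levy_mass * t" using t by (simp add: mult.commute)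
    finally show ?thesis .
  qed
  then show ?thesis
    using that[of "2 * C * levy_mass"] smooth_bound_nonneg[OF f] levy_mass_nonneg by simp
qed

end

section \<open>The strong Markov property for path functionals\<close>

context markov_process
begin

lemma kernel_subprob: "0 \<le> t \<Longrightarrow> (\<lambda>x. distr (P x) borel (X t)) \<in> borel \<rightarrow>\<^sub>M subprob_algebra borel"
  using X_kernel by (rule measurable_prob_algebraD)

lemma finite_stopping_sets:
  assumes T: "stopping_time F T" and A: "A \<in> sets (pre_sigma T)"
  shows "A \<in> sets M" "{\<omega> \<in> A. T \<omega> < \<infinity>} \<in> sets M"
proof -
  note [measurable] = stopping_time_measurable[OF T]
  have "{\<omega> \<in> A. T \<omega> \<le> \<infinity>} \<in> sets (F \<infinity>)" by (rule sets_pre_sigmaD[OF T A])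
  then show A' [measurable]: "A \<in> sets M" using sets_F_M by auto
  have "{\<omega> \<in> A. T \<omega> < \<infinity>} = A \<inter> {\<omega> \<in> space M. T \<omega> < \<infinity>}" using sets.sets_into_space[OF A'] by auto
  then show "{\<omega> \<in> A. T \<omega> < \<infinity>} \<in> sets M" by simp
qed

lemma strong_markov_emeasure:
  assumes T: "stopping_time F T" and t: "0 \<le> t" and A: "A \<in> sets (pre_sigma T)" and B [measurable]: "B \<in> sets borel"
  shows "emeasure (P x) {\<omega> \<in> A. T \<omega> < \<infinity> \<and> X (enn2real (T \<omega>) + t) \<omega> \<in> B} =
    (\<integral>\<^sup>+\<omega>. indicator {\<omega> \<in> A. T \<omega> < \<infinity>} \<omega> * emeasure (distr (P (X (enn2real (T \<omega>)) \<omega>)) borel (X t)) B \<partial>P x)"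
proof -
  interpret prob_space "P x" by (rule prob_space_P)
  note [measurable] = stopping_time_measurable[OF T] finite_stopping_sets[OF T A] kernel_subprob[OF t] X_measurable[OF t]
  have [measurable]: "(\<lambda>\<omega>. X (enn2real (T \<omega>)) \<omega>) \<in> borel_measurable M" by (rule measurable_X_compose) auto
  let ?p = "\<lambda>\<omega>. measure (P (X (enn2real (T \<omega>)) \<omega>)) {\<omega>' \<in> space M. X t \<omega>' \<in> B}"
  have pe: "emeasure (distr (P y) borel (X t)) B = ennreal (measure (P y) {\<omega>' \<in> space M. X t \<omega>' \<in> B})" for y
  proof -
    interpret y: prob_space "P y" by (rule prob_space_P)
    have "X t -` B \<inter> space (P y) = {\<omega>' \<in> space M. X t \<omega>' \<in> B}" by auto
    then show ?thesis by (simp add: emeasure_distr y.emeasure_eq_measure)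
  qed
  have "(\<lambda>y. emeasure (distr (P y) borel (X t)) B) \<in> borel_measurable borel"
    by (rule measurable_emeasure_kernel[OF kernel_subprob[OF t] B])
  then have "(\<lambda>y. enn2real (emeasure (distr (P y) borel (X t)) B)) \<in> borel_measurable borel" by measurable
  then have [measurable]: "(\<lambda>y. measure (P y) {\<omega>' \<in> space M. X t \<omega>' \<in> B}) \<in> borel_measurable borel" by (simp add: pe)
  have [measurable]: "?p \<in> borel_measurable M" by measurable
  have p1: "?p \<omega> \<le> 1" for \<omega> using prob_space.prob_le_1[OF prob_space_P] .
  have sm: "measure (P x) {\<omega> \<in> A. T \<omega> < \<infinity> \<and> X (enn2real (T \<omega>) + t) \<omega> \<in> B} = (LINT \<omega>:{\<omega> \<in> A. T \<omega> < \<infinity>}|P x. ?p \<omega>)"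
    using strong_markov T t A B unfolding strong_markov_process_def by blast
  have int: "integrable (P x) (\<lambda>\<omega>. indicator {\<omega> \<in> A. T \<omega> < \<infinity>} \<omega> *\<^sub>R ?p \<omega>)"
    by (rule integrable_const_bound[of _ 1]) (auto simp: indicator_def p1)
  have "emeasure (P x) {\<omega> \<in> A. T \<omega> < \<infinity> \<and> X (enn2real (T \<omega>) + t) \<omega> \<in> B} = ennreal (LINT \<omega>:{\<omega> \<in> A. T \<omega> < \<infinity>}|P x. ?p \<omega>)"
    unfolding emeasure_eq_measure sm ..
  also have "\<dots> = (\<integral>\<^sup>+\<omega>. ennreal (indicator {\<omega> \<in> A. T \<omega> < \<infinity>} \<omega> *\<^sub>R ?p \<omega>) \<partial>P x)"
    unfolding set_lebesgue_integral_def using int by (intro nn_integral_eq_integral[symmetric]) (auto simp: indicator_def)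
  also have "\<dots> = (\<integral>\<^sup>+\<omega>. indicator {\<omega> \<in> A. T \<omega> < \<infinity>} \<omega> * emeasure (distr (P (X (enn2real (T \<omega>)) \<omega>)) borel (X t)) B \<partial>P x)"
    by (intro nn_integral_cong) (auto simp: pe indicator_def)
  finally show ?thesis .
qed

lemma strong_markov_nn_integral:
  assumes T: "stopping_time F T" and t: "0 \<le> t" and A: "A \<in> sets (pre_sigma T)" and g: "g \<in> borel_measurable borel"
  shows "(\<integral>\<^sup>+\<omega>. indicator {\<omega> \<in> A. T \<omega> < \<infinity>} \<omega> * g (X (enn2real (T \<omega>) + t) \<omega>) \<partial>P x) =
    (\<integral>\<^sup>+\<omega>. indicator {\<omega> \<in> A. T \<omega> < \<infinity>} \<omega> * (\<integral>\<^sup>+z. g z \<partial>distr (P (X (enn2real (T \<omega>)) \<omega>)) borel (X t)) \<partial>P x)"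
proof -
  have [measurable]: "(\<lambda>\<omega>. X (enn2real (T \<omega>) + s) \<omega>) \<in> borel_measurable M" if "0 \<le> s" for s
    using stopping_time_measurable[OF T] that by (intro measurable_X_compose) auto
  have XT [measurable]: "(\<lambda>\<omega>. X (enn2real (T \<omega>)) \<omega>) \<in> borel_measurable M"
    using stopping_time_measurable[OF T] by (intro measurable_X_compose) auto
  have XTt [measurable]: "(\<lambda>\<omega>. X (enn2real (T \<omega>) + t) \<omega>) \<in> borel_measurable M"
    using stopping_time_measurable[OF T] t by (intro measurable_X_compose) auto
  define I where "I = {\<omega> \<in> A. T \<omega> < \<infinity>}"
  have [measurable]: "I \<in> sets M" unfolding I_def by (rule finite_stopping_sets(2)[OF T A])
  have K [measurable]: "(\<lambda>\<omega>. \<integral>\<^sup>+z. g z \<partial>distr (P (X (enn2real (T \<omega>)) \<omega>)) borel (X t)) \<in> borel_measurable M"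
    if "g \<in> borel_measurable borel" for g
    using measurable_compose[OF measurable_compose[OF XT kernel_subprob[OF t]] nn_integral_measurable_subprob_algebra[OF that]] .
  have "(\<integral>\<^sup>+\<omega>. indicator I \<omega> * g (X (enn2real (T \<omega>) + t) \<omega>) \<partial>P x) =
    (\<integral>\<^sup>+\<omega>. indicator I \<omega> * (\<integral>\<^sup>+z. g z \<partial>distr (P (X (enn2real (T \<omega>)) \<omega>)) borel (X t)) \<partial>P x)"
    using g
  proof (induction rule: borel_measurable_induct)
    case (cong f g)
    then show ?case by (simp add: fun_eq_iff)
  next
    case (set B)
    have s: "{\<omega> \<in> A. T \<omega> < \<infinity> \<and> X (enn2real (T \<omega>) + t) \<omega> \<in> B} \<in> sets (P x)"
    proof -
      have "{\<omega> \<in> A. T \<omega> < \<infinity> \<and> X (enn2real (T \<omega>) + t) \<omega> \<in> B} =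
        I \<inter> {\<omega> \<in> space M. X (enn2real (T \<omega>) + t) \<omega> \<in> B}"
        using sets.sets_into_space[OF finite_stopping_sets(1)[OF T A]] by (auto simp: I_def)
      also have "\<dots> \<in> sets M" using set by measurable
      finally show ?thesis by simp
    qed
    have "(\<integral>\<^sup>+\<omega>. indicator I \<omega> * indicator B (X (enn2real (T \<omega>) + t) \<omega>) \<partial>P x)
       = (\<integral>\<^sup>+\<omega>. indicator {\<omega> \<in> A. T \<omega> < \<infinity> \<and> X (enn2real (T \<omega>) + t) \<omega> \<in> B} \<omega> \<partial>P x)"
      by (intro nn_integral_cong) (auto simp: indicator_def I_def)
    also have "\<dots> = emeasure (P x) {\<omega> \<in> A. T \<omega> < \<infinity> \<and> X (enn2real (T \<omega>) + t) \<omega> \<in> B}"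
      by (rule nn_integral_indicator[OF s])
    also have "\<dots> = (\<integral>\<^sup>+\<omega>. indicator I \<omega> * emeasure (distr (P (X (enn2real (T \<omega>)) \<omega>)) borel (X t)) B \<partial>P x)"
      unfolding I_def by (rule strong_markov_emeasure[OF T t A set])
    finally show ?case using set by simp
  next
    case (mult u c)
    then show ?case by (simp add: nn_integral_cmult mult.left_commute[of _ c])
  next
    case (add u v)
    then show ?case by (simp add: nn_integral_add distrib_left)
  next
    case (seq U)
    have m: "incseq (\<lambda>i \<omega>. indicator I \<omega> * U i (X (enn2real (T \<omega>) + t) \<omega>))"
      using \<open>incseq U\<close> by (auto simp: incseq_def le_fun_def intro!: mult_left_mono)
    have m2: "incseq (\<lambda>i \<omega>. indicator I \<omega> * (\<integral>\<^sup>+z. U i z \<partial>distr (P (X (enn2real (T \<omega>)) \<omega>)) borel (X t)))"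
      using \<open>incseq U\<close> by (auto simp: incseq_def le_fun_def intro!: mult_left_mono nn_integral_mono)
    have "(\<integral>\<^sup>+\<omega>. indicator I \<omega> * (SUP i. U i) (X (enn2real (T \<omega>) + t) \<omega>) \<partial>P x)
      = (SUP i. \<integral>\<^sup>+\<omega>. indicator I \<omega> * U i (X (enn2real (T \<omega>) + t) \<omega>) \<partial>P x)"
      unfolding SUP_apply SUP_mult_left_ennreal using seq(1) by (intro nn_integral_monotone_convergence_SUP m) auto
    also have "\<dots> = (SUP i. \<integral>\<^sup>+\<omega>. indicator I \<omega> * (\<integral>\<^sup>+z. U i z \<partial>distr (P (X (enn2real (T \<omega>)) \<omega>)) borel (X t)) \<partial>P x)"
      by (simp only: seq.IH)
    also have "\<dots> = (\<integral>\<^sup>+\<omega>. (SUP i. indicator I \<omega> * (\<integral>\<^sup>+z. U i z \<partial>distr (P (X (enn2real (T \<omega>)) \<omega>)) borel (X t))) \<partial>P x)"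
      using seq(1) by (intro nn_integral_monotone_convergence_SUP[symmetric] m2) auto
    also have "\<dots> = (\<integral>\<^sup>+\<omega>. indicator I \<omega> * (\<integral>\<^sup>+z. (SUP i. U i) z \<partial>distr (P (X (enn2real (T \<omega>)) \<omega>)) borel (X t)) \<partial>P x)"
      unfolding SUP_apply SUP_mult_left_ennreal[symmetric] using seq(1) \<open>incseq U\<close>
      by (intro nn_integral_cong arg_cong2[where f = "(*)"] refl nn_integral_monotone_convergence_SUP[symmetric]) auto
    finally show ?case .
  qed
  then show ?thesis unfolding I_def .
qed

text \<open>Conditions on finitely many positions, coded by successive time increments so that the
  strong Markov property can be applied one coordinate after the other.\<close>

fun cyl :: "(real \<times> (real^'d) set) list \<Rightarrow> real \<Rightarrow> 'w \<Rightarrow> bool" where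
  "cyl [] T \<omega> = True"
| "cyl (p # l) T \<omega> = (X (T + fst p) \<omega> \<in> snd p \<and> cyl l (T + fst p) \<omega>)"

text \<open>Iterated transition kernels, the Chapman-Kolmogorov form of a finite-dimensional
  distribution.\<close>

fun cyl_prob :: "(real \<times> (real^'d) set) list \<Rightarrow> real^'d \<Rightarrow> ennreal" where
  "cyl_prob [] y = 1"
| "cyl_prob (p # l) y = (\<integral>\<^sup>+z. indicator (snd p) z * cyl_prob l z \<partial>distr (P y) borel (X (fst p)))"

definition valid_cyl :: "(real \<times> (real^'d) set) list \<Rightarrow> bool" where
  "valid_cyl l \<longleftrightarrow> (\<forall>p\<in>set l. 0 \<le> fst p \<and> snd p \<in> sets borel)"

lemma cyl_prob_measurable: "valid_cyl l \<Longrightarrow> cyl_prob l \<in> borel_measurable borel"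
proof (induction l)
  case (Cons p l)
  then have "(\<lambda>z. indicator (snd p) z * cyl_prob l z) \<in> borel_measurable borel"
    by (intro borel_measurable_times_ennreal borel_measurable_indicator) (auto simp: valid_cyl_def)
  from measurable_compose[OF kernel_subprob nn_integral_measurable_subprob_algebra[OF this], of "fst p"] Cons(2)
  show ?case by (simp add: valid_cyl_def)
next
  case Nil
  have "cyl_prob [] = (\<lambda>_. 1)" by auto
  then show ?case by simp
qed

lemma stopping_time_add:
  assumes T: "stopping_time F T" and d: "0 \<le> d" shows "stopping_time F (\<lambda>\<omega>. T \<omega> + ennreal d)"
proof
  fix t
  show "Measurable.pred (F t) (\<lambda>\<omega>. T \<omega> + ennreal d \<le> t)"
  proof (cases "ennreal d \<le> t")
    case True
    have "T \<omega> + ennreal d \<le> t \<longleftrightarrow> T \<omega> \<le> t - ennreal d" for \<omega>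
      using True by (auto simp: ennreal_le_minus_iff add.commute)
    moreover have "Measurable.pred (F t) (\<lambda>\<omega>. T \<omega> \<le> t - ennreal d)"
      by (rule stopping_time_le_const[OF T]) (simp add: diff_le_self_ennreal)
    ultimately show ?thesis by simp
  next
    case False
    then have "\<not> T \<omega> + ennreal d \<le> t" for \<omega> by (metis add.commute add_increasing2 dual_order.trans le_add_same_cancel1 zero_le order_trans le_iff_add)
    then show ?thesis by simp
  qed
qed

text \<open>Induction on the coordinates, with both the stopping time and the event varying. After
  the first coordinate the process is restarted at \<open>T + d\<close>; the remaining coordinates
  contribute a function of the position there, to which the property for a single time
  applies.\<close>

lemma strong_markov_cyl:
  assumes "valid_cyl l" "stopping_time F T" "A \<in> sets (pre_sigma T)"
  shows "emeasure (P x) {\<omega> \<in> A. T \<omega> < \<infinity> \<and> cyl l (enn2real (T \<omega>)) \<omega>} =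
    (\<integral>\<^sup>+\<omega>. indicator {\<omega> \<in> A. T \<omega> < \<infinity>} \<omega> * cyl_prob l (X (enn2real (T \<omega>)) \<omega>) \<partial>P x)"
  using assms
proof (induction l arbitrary: T A)
  case Nil
  then show ?case using finite_stopping_sets(2)[OF Nil(2,3)] by simp
next
  case (Cons p l)
  define d C where "d = fst p" and "C = snd p"
  have d: "0 \<le> d" and C: "C \<in> sets borel" and l: "valid_cyl l" using Cons(2) by (auto simp: valid_cyl_def d_def C_def)
  let ?T = "\<lambda>\<omega>. T \<omega> + ennreal d"
  have T': "stopping_time F ?T" by (rule stopping_time_add[OF Cons(3) d])
  have fin: "?T \<omega> < \<infinity> \<longleftrightarrow> T \<omega> < \<infinity>" for \<omega> by (simp add: less_top[symmetric])
  have e2r: "enn2real (?T \<omega>) = enn2real (T \<omega>) + d" if "T \<omega> < \<infinity>" for \<omega>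
    using that d by (subst enn2real_plus) auto
  \<comment> \<open>The condition on the first coordinate is an event known at \<open>T + d\<close>,
    so it can be absorbed into the event of the induction hypothesis.\<close>
  define A' where "A' = A \<inter> {\<omega> \<in> space M. ?T \<omega> < \<infinity> \<and> X (enn2real (?T \<omega>)) \<omega> \<in> C}"
  have "A \<in> sets (pre_sigma ?T)"
    using mono_pre_sigma[OF Cons(3) T'] Cons(4) by auto
  then have A': "A' \<in> sets (pre_sigma ?T)"
    unfolding A'_def using X_stopped_pre_sigma[OF T' C] by blast
  have As: "A \<subseteq> space M" using sets.sets_into_space[OF finite_stopping_sets(1)[OF Cons(3,4)]] .
  have "{\<omega> \<in> A. T \<omega> < \<infinity> \<and> cyl (p # l) (enn2real (T \<omega>)) \<omega>} = {\<omega> \<in> A'. ?T \<omega> < \<infinity> \<and> cyl l (enn2real (?T \<omega>)) \<omega>}"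
    using As by (auto simp: A'_def fin e2r d_def[symmetric] C_def[symmetric])
  also have "emeasure (P x) \<dots> = (\<integral>\<^sup>+\<omega>. indicator {\<omega> \<in> A'. ?T \<omega> < \<infinity>} \<omega> * cyl_prob l (X (enn2real (?T \<omega>)) \<omega>) \<partial>P x)"
    by (rule Cons(1)[OF l T' A'])
  also have "\<dots> = (\<integral>\<^sup>+\<omega>. indicator {\<omega> \<in> A. T \<omega> < \<infinity>} \<omega> * (indicator C (X (enn2real (T \<omega>) + d) \<omega>) * cyl_prob l (X (enn2real (T \<omega>) + d) \<omega>)) \<partial>P x)"
    using As by (intro nn_integral_cong) (auto simp: A'_def fin e2r indicator_def)
  also have "\<dots> = (\<integral>\<^sup>+\<omega>. indicator {\<omega> \<in> A. T \<omega> < \<infinity>} \<omega> * (\<integral>\<^sup>+z. indicator C z * cyl_prob l z \<partial>distr (P (X (enn2real (T \<omega>)) \<omega>)) borel (X d)) \<partial>P x)"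
    using C cyl_prob_measurable[OF l]
    by (intro strong_markov_nn_integral[OF Cons(3) d Cons(4), where g = "\<lambda>z. indicator C z * cyl_prob l z"]
       borel_measurable_times_ennreal borel_measurable_indicator) auto
  finally show ?case by (simp add: d_def C_def)
qed

text \<open>The smallest time is peeled off and becomes the origin for the remaining ones; hence the
  arbitrary origin \<open>a\<close> in the induction.\<close>

lemma finite_times_cyl:
  assumes "finite I" "\<And>t. C t \<in> sets borel"
  shows "(\<forall>t\<in>I. a \<le> t) \<Longrightarrow> \<exists>l. valid_cyl l \<and> (\<forall>T \<omega>. cyl l (T + a) \<omega> \<longleftrightarrow> (\<forall>t\<in>I. X (T + t) \<omega> \<in> C t))"
  using assms(1)
proof (induction I arbitrary: a rule: finite_linorder_min_induct)
  case empty
  show ?case by (rule exI[of _ "[]"]) (simp add: valid_cyl_def)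
next
  case (insert b I)
  have "\<forall>t\<in>I. b \<le> t" using insert(2) by (simp add: less_imp_le)
  from insert(3)[OF this] obtain l where l: "valid_cyl l" "\<And>T \<omega>. cyl l (T + b) \<omega> \<longleftrightarrow> (\<forall>t\<in>I. X (T + t) \<omega> \<in> C t)" by blast
  show ?case
    by (rule exI[of _ "(b - a, C b) # l"]) (use l insert(4) assms(2) in \<open>auto simp: valid_cyl_def\<close>)
qed

end

section \<open>The laws on path space as a kernel in the starting point\<close>

context stable_process
begin

text \<open>The strong Markov property at the constant time 0, together with the almost sure
  starting point, identifies iterated kernels with finite-dimensional distributions.\<close>

lemma emeasure_cyl:
  assumes l: "valid_cyl l" shows "emeasure (P y) {\<omega> \<in> space M. cyl l 0 \<omega>} = cyl_prob l y"
proof -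
  interpret prob_space "P y" by (rule prob_space_P)
  have T: "stopping_time F (\<lambda>_. 0)" by (rule stopping_time_const)
  have "space M \<in> sets (pre_sigma (\<lambda>_. 0))" using sets.top[of "pre_sigma (\<lambda>_. 0)"] by (simp add: space_pre_sigma)
  from strong_markov_cyl[OF l T this, of y]
  have "emeasure (P y) {\<omega> \<in> space M. cyl l 0 \<omega>} = (\<integral>\<^sup>+\<omega>. indicator (space M) \<omega> * cyl_prob l (X 0 \<omega>) \<partial>P y)" by simp
  also have "\<dots> = (\<integral>\<^sup>+\<omega>. cyl_prob l y \<partial>P y)"
    by (rule nn_integral_cong_AE) (use AE_start[of y] AE_space[of "P y"] in \<open>eventually_elim, simp\<close>)
  finally show ?thesis using emeasure_space_1 by simp
qed

lemma cyl_sets_G: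
  assumes "finite I" "\<And>t. C t \<in> sets borel" "I \<subseteq> {0..}"
  shows "{\<omega> \<in> space M. \<forall>t\<in>I. X t \<omega> \<in> C t} \<in> sets (G top)"
proof -
  have "{\<omega> \<in> space (G top). X t \<omega> \<in> C t} \<in> sets (G top)" if "t \<in> I" for t
  proof -
    have "X t \<in> G top \<rightarrow>\<^sub>M borel" using that assms(3) by (intro measurable_natural_filtration) auto
    from measurable_sets[OF this assms(2)[of t]] show ?thesis by (simp add: vimage_def Int_def conj_commute)
  qed
  then have "{\<omega> \<in> space (G top). \<forall>t\<in>I. X t \<omega> \<in> C t} \<in> sets (G top)"
    by (intro sets.sets_Collect_finite_All assms(1))
  then show ?thesis by simp
qed

text \<open>Restriction to the events generated by the path, on which dependence on \<open>y\<close>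
  is determined by the transition kernels; \<open>M\<close> may contain further events.\<close>

definition path_law :: "real^'d \<Rightarrow> 'w measure" where
  "path_law y = restr_to_subalg (P y) (G top)"

lemma subalgebra_G: "subalgebra (P y) (G top)"
  using sets_G_M by (simp add: subalgebra_def)

lemma path_law_simps [simp]:
  "sets (path_law y) = sets (G top)" "space (path_law y) = space M"
  "A \<in> sets (G top) \<Longrightarrow> emeasure (path_law y) A = emeasure (P y) A"
  unfolding path_law_def
  by (rule sets_restr_to_subalg[OF subalgebra_G], simp add: space_restr_to_subalg,
      rule emeasure_restr_to_subalg[OF subalgebra_G])

text \<open>The finite cylinder events generate and are stable under intersection, and on them
  measurability in \<open>y\<close> is that of \<open>cyl_prob\<close>.\<close>

lemma path_law_kernel: "path_law \<in> borel \<rightarrow>\<^sub>M subprob_algebra (G top)"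
proof (rule measurable_subprob_algebra_generated)
  let ?S = "{{\<omega> \<in> space M. \<forall>t\<in>I. X t \<omega> \<in> C t} | I C. finite I \<and> I \<subseteq> {0..} \<and> (\<forall>t. C t \<in> sets borel)}"
  show "sets (G top) = sigma_sets (space M) ?S"
  proof
    show "sets (G top) \<subseteq> sigma_sets (space M) ?S"
      unfolding sets_natural_filtration
    proof (rule sigma_sets_mono', safe)
      fix s :: real and A :: "(real^'d) set" assume "0 \<le> s" "A \<in> sets borel"
      then show "\<exists>I C. X s -` A \<inter> space M = {\<omega> \<in> space M. \<forall>t\<in>I. X t \<omega> \<in> C t} \<and> finite I \<and> I \<subseteq> {0..} \<and> (\<forall>t. C t \<in> sets borel)"
        by (intro exI[of _ "{s}"] exI[of _ "\<lambda>_. A"]) auto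
    qed
    have "?S \<subseteq> sets (G top)" using cyl_sets_G by auto
    then show "sigma_sets (space M) ?S \<subseteq> sets (G top)"
      using sets.sigma_sets_subset[of ?S "G top"] by simp
  qed
  show "Int_stable ?S"
  proof (rule Int_stableI, safe)
    fix I J :: "real set" and C D :: "real \<Rightarrow> (real^'d) set"
    assume "finite I" "I \<subseteq> {0..}" "\<forall>t. C t \<in> sets borel" "finite J" "J \<subseteq> {0..}" "\<forall>t. D t \<in> sets borel"
    then show "\<exists>K E. {\<omega> \<in> space M. \<forall>t\<in>I. X t \<omega> \<in> C t} \<inter> {\<omega> \<in> space M. \<forall>t\<in>J. X t \<omega> \<in> D t}
      = {\<omega> \<in> space M. \<forall>t\<in>K. X t \<omega> \<in> E t} \<and> finite K \<and> K \<subseteq> {0..} \<and> (\<forall>t. E t \<in> sets borel)"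
      by (intro exI[of _ "I \<union> J"] exI[of _ "\<lambda>t. (if t \<in> I then C t else UNIV) \<inter> (if t \<in> J then D t else UNIV)"]) auto
  qed
  show "?S \<subseteq> Pow (space M)" by auto
  show "subprob_space (path_law y)" for y
    using prob_space_P[of y] sets.top[of "G top"]
    by (intro prob_space_imp_subprob_space prob_spaceI) (simp add: prob_space.emeasure_space_1[unfolded space_P] flip: space_P[of y] del: space_P)
  show "sets (path_law y) = sets (G top)" for y by simp
  have eq: "(\<lambda>y. emeasure (path_law y) {\<omega> \<in> space M. \<forall>t\<in>I. X t \<omega> \<in> C t}) \<in> borel_measurable borel"
    if IC: "finite I" "I \<subseteq> {0..}" "\<forall>t. C t \<in> sets borel" for I C
  proof -
    obtain l where l: "valid_cyl l" "\<And>T \<omega>. cyl l (T + 0) \<omega> \<longleftrightarrow> (\<forall>t\<in>I. X (T + t) \<omega> \<in> C t)"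
      using finite_times_cyl[OF IC(1), of C 0] IC(2,3) by auto
    have "emeasure (path_law y) {\<omega> \<in> space M. \<forall>t\<in>I. X t \<omega> \<in> C t} = cyl_prob l y" for y
      using emeasure_cyl[OF l(1), of y] l(2)[of 0] cyl_sets_G[of I C] IC by simp
    then show ?thesis using cyl_prob_measurable[OF l(1)] by simp
  qed
  show "(\<lambda>y. emeasure (path_law y) A) \<in> borel_measurable borel" if "A \<in> ?S" for A
    using that eq by auto
  show "(\<lambda>y. emeasure (path_law y) (space M)) \<in> borel_measurable borel"
    using eq[of "{}" "\<lambda>_. UNIV"] by simp
qed

end

section \<open>Occupation times\<close>

locale killed_process = stable_process n \<kappa> \<alpha> M P X
  for n :: "real^'d::finite \<Rightarrow> real^'d \<Rightarrow> real" and \<kappa> \<alpha> :: real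
    and M :: "'w measure" and P :: "real^'d \<Rightarrow> 'w measure" and X :: "real \<Rightarrow> 'w \<Rightarrow> real^'d" +
  fixes Q :: "(real^'d) set"
  assumes closed_Q: "closed Q"
begin

text \<open>Membership in \<open>Q\<close> is only tested at rational times, which suffices because \<open>Q\<close> is closed and
  paths are right-continuous.\<close>

definition stays :: "(real^'d) set \<Rightarrow> real \<Rightarrow> real \<Rightarrow> 'w \<Rightarrow> bool" where
  "stays B s T \<omega> \<longleftrightarrow> X (T + s) \<omega> \<in> B \<and> (\<forall>q\<in>\<rat> \<inter> {0..}. q < s \<longrightarrow> X (T + q) \<omega> \<in> Q)"

text \<open>Transition function of the process killed on leaving \<open>Q\<close>. Time 0 is tested
  here as well, whereas \<open>exit_time\<close> looks at positive times only; for a start in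
  \<open>Q\<close> the two agree almost surely in this respect.\<close>

definition killed :: "(real^'d) set \<Rightarrow> real \<Rightarrow> real^'d \<Rightarrow> ennreal" where
  "killed B s y = emeasure (P y) {\<omega> \<in> space M. stays B s 0 \<omega>}"

definition occupation :: "(real^'d) set \<Rightarrow> real^'d \<Rightarrow> ennreal" where
  "occupation B y = (\<integral>\<^sup>+s. indicator {0..} s * killed B s y \<partial>lborel)"

lemma stays_before:
  assumes w: "\<omega> \<in> space M" and T: "0 \<le> T" and st: "stays B s T \<omega>" and u: "0 \<le> u" "u < s"
  shows "X (T + u) \<omega> \<in> Q"
proof (rule ccontr)
  assume "X (T + u) \<omega> \<notin> Q"
  moreover have "((\<lambda>v. X v \<omega>) \<longlongrightarrow> X (T + u) \<omega>) (at_right (T + u))" using w T u by (intro X_right) auto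
  ultimately have "\<forall>\<^sub>F v in at_right (T + u). X v \<omega> \<in> - Q"
    using closed_Q by (intro topological_tendstoD) (auto simp: open_Compl)
  then obtain b where b: "T + u < b" "\<And>v. T + u < v \<Longrightarrow> v < b \<Longrightarrow> X v \<omega> \<in> - Q"
    unfolding eventually_at_right_field by blast
  obtain q where q: "q \<in> \<rat>" "u < q" "q < min (b - T) s" using Rats_dense_in_real[of u "min (b - T) s"] b u by auto
  then have "X (T + q) \<omega> \<in> Q" using st u by (auto simp: stays_def)
  then show False using b(2)[of "T + q"] q by auto
qed

text \<open>The space \<open>N\<close> and the random origin \<open>T\<close> stay general because
  the event is needed twice: from time 0 on the path sigma-algebra, and from a stopping time under
  \<open>P x\<close>.\<close>

lemma stays_measurable:
  assumes B [measurable]: "B \<in> sets borel" and T: "T \<in> borel_measurable N" "\<And>\<omega>. 0 \<le> T \<omega>"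
    and Xm: "(\<lambda>p. X (max 0 (fst p)) (snd p)) \<in> borel \<Otimes>\<^sub>M N \<rightarrow>\<^sub>M borel"
  shows "Measurable.pred (borel \<Otimes>\<^sub>M N) (\<lambda>p. stays B (max 0 (fst p)) (T (snd p)) (snd p))"
proof -
  have X': "(\<lambda>p. X (T (snd p) + r p) (snd p)) \<in> borel \<Otimes>\<^sub>M N \<rightarrow>\<^sub>M borel"
    if [measurable]: "r \<in> borel_measurable (borel \<Otimes>\<^sub>M N)" and r: "\<And>p. 0 \<le> r p" for r :: "real \<times> 'w \<Rightarrow> real"
  proof -
    note [measurable] = T(1)
    have "(\<lambda>p. (T (snd p) + r p, snd p)) \<in> borel \<Otimes>\<^sub>M N \<rightarrow>\<^sub>M borel \<Otimes>\<^sub>M N" by measurable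
    from measurable_compose[OF this Xm] show ?thesis using T(2) r by (simp add: max_def)
  qed
  have [measurable]: "Q \<in> sets borel" using closed_Q by simp
  have [measurable]: "(\<lambda>p. X (T (snd p) + max 0 (fst p)) (snd p)) \<in> borel \<Otimes>\<^sub>M N \<rightarrow>\<^sub>M borel" by (rule X') auto
  have "Measurable.pred (borel \<Otimes>\<^sub>M N) (\<lambda>p. \<forall>q\<in>\<rat> \<inter> {0..}. q < max 0 (fst p) \<longrightarrow> X (T (snd p) + q) (snd p) \<in> Q)"
  proof -
    have R: "{p \<in> space (borel \<Otimes>\<^sub>M N). \<not> (q < max 0 (fst p) \<longrightarrow> X (T (snd p) + q) (snd p) \<in> Q)} \<in> sets (borel \<Otimes>\<^sub>M N)"
      if q: "q \<in> \<rat> \<inter> {0..}" for q :: real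
    proof -
      from q have [measurable]: "(\<lambda>p. X (T (snd p) + q) (snd p)) \<in> (borel :: real measure) \<Otimes>\<^sub>M N \<rightarrow>\<^sub>M borel"
        using X'[of "\<lambda>_. q"] by simp
      show ?thesis by measurable
    qed
    have "(\<Union>q\<in>\<rat> \<inter> {0..}. {p \<in> space (borel \<Otimes>\<^sub>M N). \<not> (q < max 0 (fst p) \<longrightarrow> X (T (snd p) + q) (snd p) \<in> Q)}) \<in> sets (borel \<Otimes>\<^sub>M N)"
      using countable_rat by (intro sets.countable_UN'' R) auto
    from sets.compl_sets[OF this] show ?thesis unfolding pred_def
      by (rule back_subst[of "\<lambda>S. S \<in> sets (borel \<Otimes>\<^sub>M N)"]) auto
  qed
  then show ?thesis unfolding stays_def by measurable
qed

lemma stays_event_G: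
  assumes "B \<in> sets borel" "0 \<le> s" shows "{\<omega> \<in> space M. stays B s 0 \<omega>} \<in> sets (G top)"
proof -
  have "Measurable.pred (borel \<Otimes>\<^sub>M G top) (\<lambda>p. stays B (max 0 (fst p)) 0 (snd p))"
    by (rule stays_measurable[OF assms(1) _ _ X_joint_G]) auto
  then have "Measurable.pred (G top) (\<lambda>\<omega>. stays B (max 0 (fst (s, \<omega>))) 0 (snd (s, \<omega>)))"
    by (rule measurable_compose[rotated]) measurable
  then show ?thesis using assms(2) by (simp add: pred_def)
qed

lemma killed_joint:
  assumes B: "B \<in> sets borel"
  shows "(\<lambda>p. killed B (max 0 (fst p)) (snd p)) \<in> borel_measurable (borel \<Otimes>\<^sub>M borel)"
proof -
  have *: "Measurable.pred (borel \<Otimes>\<^sub>M G top) (\<lambda>p. stays B (max 0 (fst p)) 0 (snd p))"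
    by (rule stays_measurable[OF B _ _ X_joint_G]) auto
  have [measurable]: "Measurable.pred (((borel :: real measure) \<Otimes>\<^sub>M (borel :: (real^'d) measure)) \<Otimes>\<^sub>M G top) (\<lambda>p. stays B (max 0 (fst (fst p))) 0 (snd p))"
  proof -
    have "(\<lambda>p. (fst (fst p), snd p)) \<in> ((borel :: real measure) \<Otimes>\<^sub>M (borel :: (real^'d) measure)) \<Otimes>\<^sub>M G top \<rightarrow>\<^sub>M borel \<Otimes>\<^sub>M G top" by measurable
    from measurable_compose[OF this *] show ?thesis by simp
  qed
  have "(\<lambda>(p, \<omega>). if stays B (max 0 (fst p)) 0 \<omega> then 1 else 0 :: ennreal) \<in> borel_measurable (((borel :: real measure) \<Otimes>\<^sub>M (borel :: (real^'d) measure)) \<Otimes>\<^sub>M G top)"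
    unfolding split_beta' by measurable
  moreover have "(\<lambda>p. path_law (snd p)) \<in> ((borel :: real measure) \<Otimes>\<^sub>M (borel :: (real^'d) measure)) \<rightarrow>\<^sub>M subprob_algebra (G top)"
    by (rule measurable_compose[OF measurable_snd path_law_kernel])
  ultimately have "(\<lambda>p. \<integral>\<^sup>+\<omega>. (if stays B (max 0 (fst p)) 0 \<omega> then 1 else 0) \<partial>path_law (snd p)) \<in> borel_measurable ((borel :: real measure) \<Otimes>\<^sub>M (borel :: (real^'d) measure))"
    by (rule nn_integral_measurable_subprob_algebra2)
  moreover have "(\<integral>\<^sup>+\<omega>. (if stays B (max 0 s) 0 \<omega> then 1 else 0) \<partial>path_law y) = killed B (max 0 s) y" for s y
  proof -
    have G: "{\<omega> \<in> space M. stays B (max 0 s) 0 \<omega>} \<in> sets (G top)" by (rule stays_event_G[OF B]) simp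
    have "(\<integral>\<^sup>+\<omega>. (if stays B (max 0 s) 0 \<omega> then 1 else 0) \<partial>path_law y) = (\<integral>\<^sup>+\<omega>. indicator {\<omega> \<in> space M. stays B (max 0 s) 0 \<omega>} \<omega> \<partial>path_law y)"
      by (intro nn_integral_cong) (auto simp: indicator_def)
    also have "\<dots> = killed B (max 0 s) y" using G by (simp add: killed_def)
    finally show ?thesis .
  qed
  ultimately show ?thesis by simp
qed

lemma occupation_measurable:
  assumes B: "B \<in> sets borel" shows "occupation B \<in> borel_measurable borel"
proof -
  have "(\<lambda>p. indicator {0..} (snd p) * killed B (max 0 (snd p)) (fst p)) \<in> borel_measurable ((borel :: (real^'d) measure) \<Otimes>\<^sub>M lborel)"
    using measurable_compose[OF _ killed_joint[OF B], of "\<lambda>p. (snd p, fst p)" "(borel :: (real^'d) measure) \<Otimes>\<^sub>M lborel"] by simp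
  then have "(\<lambda>y. \<integral>\<^sup>+s. indicator {0..} s * killed B (max 0 s) y \<partial>lborel) \<in> borel_measurable borel"
    by (intro lborel.borel_measurable_nn_integral) (simp add: split_beta')
  moreover have "(\<integral>\<^sup>+s. indicator {0..} s * killed B (max 0 s) y \<partial>lborel) = occupation B y" for y
    unfolding occupation_def by (intro nn_integral_cong) (auto simp: indicator_def max_def)
  ultimately show ?thesis by simp
qed

text \<open>The rational times before \<open>s\<close>, with \<open>s\<close> itself added, are
  exhausted by finite sets \<open>I k\<close>. The event is thus a decreasing limit of cylinder
  events, and both sides converge, the right one by dominated convergence.\<close>

lemma strong_markov_stays:
  assumes T: "stopping_time F T" and A: "A \<in> sets (pre_sigma T)" and B: "B \<in> sets borel" and s: "0 \<le> s"
  shows "emeasure (P x) {\<omega> \<in> A. T \<omega> < \<infinity> \<and> stays B s (enn2real (T \<omega>)) \<omega>} =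
    (\<integral>\<^sup>+\<omega>. indicator {\<omega> \<in> A. T \<omega> < \<infinity>} \<omega> * killed B s (X (enn2real (T \<omega>)) \<omega>) \<partial>P x)"
proof -
  interpret prob_space "P x" by (rule prob_space_P)
  define D where "D = {q \<in> \<rat>. 0 \<le> q \<and> q < s}"
  have cD: "countable D" unfolding D_def by (rule countable_subset[OF _ countable_rat]) auto
  define I where "I k = insert s {q \<in> D. to_nat_on D q \<le> k}" for k :: nat
  have "finite {q \<in> D. to_nat_on D q \<le> k}" for k
    by (rule finite_imageD[of "to_nat_on D"]) (auto intro: finite_subset[of _ "{..k}"] inj_on_subset[OF inj_on_to_nat_on[OF cD]])
  then have I: "finite (I k)" "I k \<subseteq> {0..}" for k using s by (auto simp: I_def D_def)
  have Ii: "I k \<subseteq> I l" if "k \<le> l" for k l using that by (auto simp: I_def)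
  have IU: "(\<Union>k. I k) = insert s D" by (auto simp: I_def)
  define C where "C t = (if t = s then B else Q)" for t
  have C: "C t \<in> sets borel" for t using B closed_Q by (simp add: C_def)
  have stays_iff: "stays B s r \<omega> \<longleftrightarrow> (\<forall>k. \<forall>t\<in>I k. X (r + t) \<omega> \<in> C t)" for r \<omega>
  proof -
    have "(\<forall>k. \<forall>t\<in>I k. X (r + t) \<omega> \<in> C t) \<longleftrightarrow> (\<forall>t\<in>insert s D. X (r + t) \<omega> \<in> C t)" unfolding IU[symmetric] by blast
    also have "\<dots> \<longleftrightarrow> stays B s r \<omega>" by (auto simp: stays_def C_def D_def)
    finally show ?thesis by simp
  qed
  have "\<exists>l. valid_cyl l \<and> (\<forall>r \<omega>. cyl l (r + 0) \<omega> \<longleftrightarrow> (\<forall>t\<in>I k. X (r + t) \<omega> \<in> C t))" for k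
    using I(2)[of k] by (intro finite_times_cyl I(1) C) auto
  then obtain l where l: "\<And>k. valid_cyl (l k)" "\<And>k r \<omega>. cyl (l k) r \<omega> \<longleftrightarrow> (\<forall>t\<in>I k. X (r + t) \<omega> \<in> C t)"
    by (metis add_0_right)
  note [measurable] = stopping_time_measurable[OF T] finite_stopping_sets[OF T A]
  have [measurable]: "(\<lambda>\<omega>. X (enn2real (T \<omega>)) \<omega>) \<in> borel_measurable M" by (rule measurable_X_compose) auto
  define E where "E k = {\<omega> \<in> A. T \<omega> < \<infinity> \<and> cyl (l k) (enn2real (T \<omega>)) \<omega>}" for k
  have Em: "E k \<in> sets M" for k
  proof -
    have [measurable]: "(\<lambda>\<omega>. X (enn2real (T \<omega>) + t) \<omega>) \<in> borel_measurable M" if "t \<in> I k" for t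
      using I(2)[of k] that by (intro measurable_X_compose) (auto simp: subset_iff)
    have "{\<omega> \<in> space M. \<forall>t\<in>I k. X (enn2real (T \<omega>) + t) \<omega> \<in> C t} \<in> sets M"
      by (intro sets.sets_Collect_finite_All I(1)) (use C in measurable)
    then have "{\<omega> \<in> A. T \<omega> < \<infinity>} \<inter> {\<omega> \<in> space M. \<forall>t\<in>I k. X (enn2real (T \<omega>) + t) \<omega> \<in> C t} \<in> sets M"
      by (intro sets.Int finite_stopping_sets(2)[OF T A])
    also have "{\<omega> \<in> A. T \<omega> < \<infinity>} \<inter> {\<omega> \<in> space M. \<forall>t\<in>I k. X (enn2real (T \<omega>) + t) \<omega> \<in> C t} = E k"
      using sets.sets_into_space[OF finite_stopping_sets(1)[OF T A]] by (auto simp: E_def l)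
    finally show ?thesis .
  qed
  have "(\<lambda>k. emeasure (P x) (E k)) \<longlonglongrightarrow> emeasure (P x) (\<Inter>k. E k)"
    using Em by (intro Lim_emeasure_decseq) (auto simp: decseq_def E_def l emeasure_eq_measure dest: Ii)
  also have "(\<Inter>k. E k) = {\<omega> \<in> A. T \<omega> < \<infinity> \<and> stays B s (enn2real (T \<omega>)) \<omega>}"
    by (auto simp: E_def l stays_iff)
  finally have lim1: "(\<lambda>k. emeasure (P x) (E k)) \<longlonglongrightarrow> emeasure (P x) {\<omega> \<in> A. T \<omega> < \<infinity> \<and> stays B s (enn2real (T \<omega>)) \<omega>}" .
  have cl: "(\<lambda>k. cyl_prob (l k) y) \<longlonglongrightarrow> killed B s y" for y
  proof -
    interpret y: prob_space "P y" by (rule prob_space_P)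
    have m: "{\<omega> \<in> space M. cyl (l k) 0 \<omega>} \<in> sets (P y)" for k
      using subsetD[OF sets_G_M cyl_sets_G[OF I(1)[of k] C I(2)]] by (simp add: l)
    have "(\<lambda>k. emeasure (P y) {\<omega> \<in> space M. cyl (l k) 0 \<omega>}) \<longlonglongrightarrow> emeasure (P y) (\<Inter>k. {\<omega> \<in> space M. cyl (l k) 0 \<omega>})"
      using m by (intro Lim_emeasure_decseq) (auto simp: decseq_def l y.emeasure_eq_measure dest: Ii)
    also have "(\<Inter>k. {\<omega> \<in> space M. cyl (l k) 0 \<omega>}) = {\<omega> \<in> space M. stays B s 0 \<omega>}" by (auto simp: l stays_iff)
    finally show ?thesis by (simp only: emeasure_cyl[OF l(1)] killed_def)
  qed
  have c1: "cyl_prob (l k) y \<le> 1" for k y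
    using emeasure_cyl[OF l(1)[of k], of y] prob_space.emeasure_le_1[OF prob_space_P, of y] by metis
  have [measurable]: "cyl_prob (l k) \<in> borel_measurable borel" for k by (rule cyl_prob_measurable[OF l(1)])
  have [measurable]: "killed B s \<in> borel_measurable borel"
    by (rule borel_measurable_LIMSEQ_order[OF cl]) simp
  have "(\<lambda>k. \<integral>\<^sup>+\<omega>. indicator {\<omega> \<in> A. T \<omega> < \<infinity>} \<omega> * cyl_prob (l k) (X (enn2real (T \<omega>)) \<omega>) \<partial>P x)
     \<longlonglongrightarrow> (\<integral>\<^sup>+\<omega>. indicator {\<omega> \<in> A. T \<omega> < \<infinity>} \<omega> * killed B s (X (enn2real (T \<omega>)) \<omega>) \<partial>P x)"
  proof (rule nn_integral_dominated_convergence[where w = "\<lambda>_. 1"])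
    show "AE \<omega> in P x. (\<lambda>k. indicator {\<omega> \<in> A. T \<omega> < \<infinity>} \<omega> * cyl_prob (l k) (X (enn2real (T \<omega>)) \<omega>)) \<longlonglongrightarrow> indicator {\<omega> \<in> A. T \<omega> < \<infinity>} \<omega> * killed B s (X (enn2real (T \<omega>)) \<omega>)"
      using cl by (intro AE_I2) (auto simp: indicator_def)
    show "AE \<omega> in P x. indicator {\<omega> \<in> A. T \<omega> < \<infinity>} \<omega> * cyl_prob (l k) (X (enn2real (T \<omega>)) \<omega>) \<le> 1" for k
      using c1 by (intro AE_I2) (auto simp: indicator_def)
  qed (use emeasure_space_1 in \<open>auto intro!: borel_measurable_times_ennreal borel_measurable_indicator simp: finite_stopping_sets[OF T A, simplified]\<close>)
  then have "(\<lambda>k. emeasure (P x) (E k)) \<longlonglongrightarrow> (\<integral>\<^sup>+\<omega>. indicator {\<omega> \<in> A. T \<omega> < \<infinity>} \<omega> * killed B s (X (enn2real (T \<omega>)) \<omega>) \<partial>P x)"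
    unfolding E_def by (simp only: strong_markov_cyl[OF l(1) T A])
  from LIMSEQ_unique[OF lim1 this] show ?thesis .
qed

end

text \<open>Inner regularity of a finite measure, applied to Lebesgue measure restricted to a ball
  around the bounded set.\<close>

lemma emeasure_lborel_inner_compact:
  fixes A :: "'a::euclidean_space set"
  assumes A [measurable]: "A \<in> sets borel" and AR: "A \<subseteq> ball 0 R"
  shows "emeasure lborel A = (SUP L\<in>{L. L \<subseteq> A \<and> compact L}. emeasure lborel L)"
proof -
  let ?N = "density lborel (indicator (ball (0::'a) R))"
  have bm [measurable]: "ball (0::'a) R \<in> sets borel" by simp
  have im: "indicator (ball (0::'a) R) \<in> borel_measurable lborel" by (rule borel_measurable_indicator) simp
  have N: "emeasure ?N B = emeasure lborel B" if [measurable]: "B \<in> sets borel" and "B \<subseteq> ball 0 R" for B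
  proof -
    have "emeasure ?N B = (\<integral>\<^sup>+x. indicator (ball 0 R) x * indicator B x \<partial>lborel)"
      by (rule emeasure_density[OF im]) simp
    also have "\<dots> = (\<integral>\<^sup>+x. indicator B x \<partial>lborel)"
      using that by (intro nn_integral_cong) (auto simp: indicator_def)
    finally show ?thesis by simp
  qed
  have "emeasure ?N A = (SUP L\<in>{L. L \<subseteq> A \<and> compact L}. emeasure ?N L)"
  proof (rule inner_regular)
    show "emeasure ?N (space ?N) \<noteq> \<infinity>"
      using emeasure_bounded_finite[OF bounded_ball, of "0::'a" R]
        emeasure_density[OF im, of UNIV] by simp
  qed auto
  also have "\<dots> = (SUP L\<in>{L. L \<subseteq> A \<and> compact L}. emeasure lborel L)"
    using AR by (intro SUP_cong refl N) (auto intro: borel_compact)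
  also have "emeasure ?N A = emeasure lborel A" using AR by (intro N) auto
  finally show ?thesis .
qed

section \<open>The law of the position after leaving a small ball\<close>

context stable_process
begin

text \<open>At a zero of a nonnegative \<open>f\<close> the second difference is half the sum of
  \<open>f (y + h)\<close> and \<open>f (y - h)\<close>. Only \<open>h\<close> of norm below
  \<open>2 * R\<close> contribute, where the kernel is at least the stated constant, and each of the
  two values integrates to the integral of \<open>f\<close>.\<close>

lemma sym_generator_lower:
  assumes f: "smooth_bound C f" and f0: "\<And>x. 0 \<le> f x" and R: "0 < R"
    and supp: "\<And>x. x \<notin> ball 0 R \<Longrightarrow> f x = 0" and y: "y \<in> ball 0 R" "f y = 0"
  shows "\<kappa> * (2 * R) powr (- real CARD('d) - \<alpha>) * (LINT z|lborel. f z) \<le> sym_generator f y"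
proof -
  note [measurable] = smooth_bound_measurable[OF f]
  let ?c = "\<kappa> * (2 * R) powr (- real CARD('d) - \<alpha>)"
  have fi: "integrable lborel f"
  proof (rule Bochner_Integration.integrable_bound)
    show "integrable lborel (\<lambda>x. C * indicator (ball 0 R) x)"
      by (intro integrable_mult_right integrable_real_indicator emeasure_bounded_finite) auto
    show "AE x in lborel. norm (f x) \<le> norm (C * indicator (ball 0 R) x)"
      using smooth_bound_abs_le[OF f] smooth_bound_nonneg[OF f] supp by (intro AE_I2) (auto simp: indicator_def)
  qed measurable
  have fy: "integrable lborel (\<lambda>h. f (y + h))"
  proof -
    have "integrable (distr lborel borel ((+) y)) f" using fi by (simp add: lborel_distr_plus)
    then show ?thesis by (simp add: integrable_distr_eq)
  qed
  have fy': "integrable lborel (\<lambda>h. f (y - h))" using lborel_integrable_reflection[OF fy] by simp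
  have i1: "(LINT h|lborel. f (y + h)) = (LINT z|lborel. f z)" by (rule lborel_integral_translation) measurable
  have i2: "(LINT h|lborel. f (y - h)) = (LINT z|lborel. f z)"
    using lborel_integral_reflection[of "\<lambda>h. f (y + h)"] i1 by simp
  have "?c * (LINT z|lborel. f z) = (LINT h|lborel. ?c / 2 * (f (y + h) + f (y - h)))"
    using fy fy' i1 i2 by simp
  also have "\<dots> \<le> sym_generator f y" unfolding sym_generator_def
  proof (rule integral_mono)
    show "integrable lborel (\<lambda>h. ?c / 2 * (f (y + h) + f (y - h)))" using fy fy' by simp
    show "integrable lborel (\<lambda>h. second_diff f y h * n y h)" by (rule second_diff_n_integrable[OF f])
    fix h
    show "?c / 2 * (f (y + h) + f (y - h)) \<le> second_diff f y h * n y h"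
    proof (cases "h = 0 \<or> f (y + h) + f (y - h) = 0")
      case True
      then show ?thesis using y(2) by (auto simp: second_diff_def)
    next
      case False
      then have "y + h \<in> ball 0 R \<or> y - h \<in> ball 0 R" using supp by fastforce
      then have "norm h < 2 * R"
        using y(1) norm_triangle_ineq4[of "y + h" y] norm_triangle_ineq4[of y "y - h"] by auto
      then have "(2 * R) powr (- real CARD('d) - \<alpha>) \<le> norm h powr (- real CARD('d) - \<alpha>)"
        using False alpha by (intro powr_mono2') auto
      then have "?c \<le> \<kappa> * norm h powr (- real CARD('d) - \<alpha>)" using kappa by (intro mult_left_mono) auto
      also have "\<dots> \<le> n y h" using False by (intro n_lower) auto
      finally have "(f (y + h) + f (y - h)) / 2 * ?c \<le> (f (y + h) + f (y - h)) / 2 * n y h"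
        using f0 by (intro mult_left_mono) auto
      then show ?thesis using y(2) by (simp add: second_diff_def mult_ac)
    qed
  qed
  finally show ?thesis .
qed

text \<open>While the process stays in the small ball, a nonnegative test function supported in
  \<open>ball 0 R\<close> away from that ball has drift at least \<open>c1\<close> times its
  integral. Dynkin's formula accumulates this drift into the mean of the test function at the
  stopped position. Smooth functions then yield compact sets by approximation and Borel sets by
  inner regularity. The constant \<open>c\<close> is the same for all \<open>x\<close>, which
  matters once starting points vary.\<close>

lemma jump_density:
  assumes r: "0 < r" "r \<le> 1" and R: "0 < R"
  obtains c where "0 < c"
    "\<And>x A. \<lbrakk>cball x r \<subseteq> ball 0 R; A \<in> sets borel; A \<subseteq> ball 0 R - cball x r\<rbrakk> \<Longrightarrow>
      ennreal c * emeasure lborel A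
        \<le> emeasure (P x) {\<omega> \<in> space M. X (enn2real (min (exit_time X (cball x r) \<omega>) 1)) \<omega> \<in> A}"
proof -
  obtain K where K: "0 \<le> K" "\<And>x t. 0 \<le> t \<Longrightarrow> measure (P x) {\<omega> \<in> space M. exit_time X (cball x r) \<omega> \<le> ennreal t} \<le> K * t"
    using exit_ball_prob[OF r] by blast
  \<comment> \<open>Up to time \<open>t0\<close> the small ball has been left with probability at
    most 1/2, so drift accumulates at half rate for that long; this is where
    \<open>c1 * t0 / 2\<close> comes from.\<close>
  define t0 where "t0 = 1 / (2 * K + 1)"
  have t0: "0 < t0" "t0 \<le> 1" "K * t0 \<le> 1 / 2" using K(1) by (auto simp: t0_def divide_simps)
  define c1 where "c1 = \<kappa> * (2 * R) powr (- real CARD('d) - \<alpha>)"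
  have c1: "0 < c1" using kappa R by (simp add: c1_def)
  define c where "c = c1 * t0 / 2"
  have c: "0 < c" using c1 t0 by (simp add: c_def)
  show ?thesis
  proof (rule that[OF c])
    fix x and A :: "(real^'d) set"
    assume xr: "cball x r \<subseteq> ball 0 R" and A [measurable]: "A \<in> sets borel" and AU: "A \<subseteq> ball 0 R - cball x r"
    interpret prob_space "P x" by (rule prob_space_P)
    let ?T = "exit_time X (cball x r)"
    have T: "stopping_time F ?T" by (intro stopping_time_exit_time X_cadlag) auto
    note [measurable] = stopping_time_measurable[OF T]
    define Z where "Z \<omega> = X (enn2real (min (?T \<omega>) 1)) \<omega>" for \<omega>
    have Zm: "Z \<in> borel_measurable M" unfolding Z_def by (intro measurable_X_compose) auto
    then have Zm' [measurable]: "Z \<in> borel_measurable (P x)" by simp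
    have p: "1 / 2 \<le> survival x ?T (\<lambda>_. 1) s" if s: "0 \<le> s" "s \<le> t0" for s
    proof -
      have "prob {\<omega> \<in> space M. ?T \<omega> \<le> ennreal s} \<le> K * s" by (rule K(2)[OF s(1)])
      also have "\<dots> \<le> K * t0" using K(1) s by (intro mult_left_mono)
      finally have "prob {\<omega> \<in> space M. ?T \<omega> \<le> ennreal s} \<le> 1 / 2" using t0 by simp
      moreover have "prob (space (P x) - {\<omega> \<in> space M. ?T \<omega> \<le> ennreal s}) = 1 - prob {\<omega> \<in> space M. ?T \<omega> \<le> ennreal s}"
        by (rule prob_compl) simp
      moreover have "survival x ?T (\<lambda>_. 1) s = prob (space (P x) - {\<omega> \<in> space M. ?T \<omega> \<le> ennreal s})"
      proof -
        have "survival x ?T (\<lambda>_. 1) s = (LINT \<omega>|P x. indicator (space (P x) - {\<omega> \<in> space M. ?T \<omega> \<le> ennreal s}) \<omega>)"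
          unfolding survival_def by (intro Bochner_Integration.integral_cong refl) (auto simp: indicator_def)
        then show ?thesis by simp
      qed
      ultimately show ?thesis by simp
    qed
    have smooth: "c * (LINT z|lborel. f z) \<le> (LINT \<omega>|P x. f (Z \<omega>))"
      if f: "smooth_bound C f" and f0: "\<And>x. 0 \<le> f x" and fU: "\<And>y. y \<notin> ball 0 R - cball x r \<Longrightarrow> f y = 0" for f C
    proof -
      define a where "a = c1 * (LINT z|lborel. f z)"
      have a: "0 \<le> a" unfolding a_def using c1 f0 by (intro mult_nonneg_nonneg Bochner_Integration.integral_nonneg) auto
      have La: "a \<le> sym_generator f y" if "y \<in> cball x r" for y
        unfolding a_def c1_def using xr that fU by (intro sym_generator_lower[OF f f0 R]) auto
      have bL: "bounded_measurable (sym_generator f)" using sym_generator_bound[OF f] sym_generator_measurable[OF f] by (intro bounded_measurableI)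
      have ba: "bounded_measurable (\<lambda>_::real^'d. a)" by (rule bounded_measurableI[of _ "\<bar>a\<bar>"]) auto
      have sa: "survival x ?T (\<lambda>_. a) s = a * survival x ?T (\<lambda>_. 1) s" for s
        by (simp add: survival_def)
      have Xin: "X (max 0 s) \<omega> \<in> cball x r" if "0 < s" "ennreal s < ?T \<omega>" for s \<omega>
        using before_exit_time[OF that(2), of s] that(1) by simp
      have sL: "a * survival x ?T (\<lambda>_. 1) s \<le> survival x ?T (sym_generator f) s" if "0 < s" for s
        unfolding sa[symmetric] using that La Xin by (intro survival_mono stopping_time_measurable[OF T] ba bL) auto
      have s1: "0 \<le> survival x ?T (\<lambda>_. 1) s" for s
        unfolding survival_def by (intro Bochner_Integration.integral_nonneg) auto
      have "c * (LINT z|lborel. f z) = (LINT s|lborel. indicator {0..t0} s * (a / 2))"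
        using t0 by (simp add: c_def a_def)
      also have "\<dots> \<le> (LINT s|lborel. indicator {0..1} s * survival x ?T (sym_generator f) s)"
      proof (rule integral_mono_AE)
        show "integrable lborel (\<lambda>s. indicator {0..t0} s * (a / 2))"
          using t0 by (intro integrable_mult_left integrable_real_indicator) auto
        show "integrable lborel (\<lambda>s. indicator {0..1} s * survival x ?T (sym_generator f) s)"
          by (intro survival_integrable stopping_time_measurable[OF T] bL)
        show "AE s in lborel. indicator {0..t0} s * (a / 2) \<le> indicator {0..1} s * survival x ?T (sym_generator f) s"
          using AE_lborel_singleton[of "0::real"]
        proof eventually_elim
          fix s :: real assume "s \<noteq> 0"
          have "0 \<le> survival x ?T (sym_generator f) s" if "0 < s" using sL[OF that] a s1[of s] mult_nonneg_nonneg order_trans by blast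
          moreover have "a / 2 \<le> survival x ?T (sym_generator f) s" if "0 < s" "s \<le> t0"
            using sL[OF that(1)] p[of s] that a mult_left_mono[of "1 / 2" "survival x ?T (\<lambda>_. 1) s" a] by simp
          ultimately show "indicator {0..t0} s * (a / 2) \<le> indicator {0..1} s * survival x ?T (sym_generator f) s"
            using t0 \<open>s \<noteq> 0\<close> by (auto simp: indicator_def)
        qed
      qed
      also have "\<dots> = (LINT \<omega>|P x. f (Z \<omega>))"
        using optional_stopping[OF T f, of 1 x] fU[of x] r by (simp add: Z_def)
      finally show ?thesis .
    qed
    have compact: "ennreal c * emeasure lborel L \<le> emeasure (P x) {\<omega> \<in> space M. Z \<omega> \<in> L}"
      if L: "compact L" "L \<subseteq> ball 0 R - cball x r" for L
    proof -
      have [measurable]: "L \<in> sets borel" using L(1) by (intro borel_closed compact_imp_closed)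
      have o: "open (ball 0 R - cball x r)" by (intro open_Diff) auto
      obtain g where g: "\<And>k. \<exists>C. smooth_bound C (g k)" "\<And>k y. 0 \<le> g k y" "\<And>k y. g k y \<le> 1"
         "\<And>k y. y \<in> L \<Longrightarrow> g k y = 1" "\<And>k y. y \<notin> ball 0 R - cball x r \<Longrightarrow> g k y = 0"
         "\<And>y. (\<lambda>k. g k y) \<longlonglongrightarrow> indicator L y"
        using smooth_cutoff_sequence[OF L(1) o L(2)] by blast
      have gm [measurable]: "g k \<in> borel_measurable borel" for k using g(1)[of k] smooth_bound_measurable by blast
      have "c * measure lborel L \<le> (LINT \<omega>|P x. g k (Z \<omega>))" for k
      proof -
        obtain C where C: "smooth_bound C (g k)" using g(1) by blast
        have "measure lborel L = (LINT z|lborel. indicator L z)" by simp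
        also have "\<dots> \<le> (LINT z|lborel. g k z)"
        proof (rule integral_mono)
          show "integrable lborel (indicator L :: _ \<Rightarrow> real)"
            using L(1) by (intro integrable_real_indicator emeasure_bounded_finite compact_imp_bounded) auto
          show "integrable lborel (g k)"
          proof (rule Bochner_Integration.integrable_bound)
            show "integrable lborel (indicator (ball 0 R) :: real^'d \<Rightarrow> real)"
              by (intro integrable_real_indicator emeasure_bounded_finite) auto
            show "AE y in lborel. norm (g k y) \<le> norm (indicator (ball 0 R) y :: real)"
              using g(2,3,5) by (intro AE_I2) (auto simp: indicator_def)
          qed measurable
          show "indicator L z \<le> g k z" for z using g(2,4) by (auto simp: indicator_def)
        qed
        finally have "c * measure lborel L \<le> c * (LINT z|lborel. g k z)" using c by (intro mult_left_mono) auto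
        also have "\<dots> \<le> (LINT \<omega>|P x. g k (Z \<omega>))" by (rule smooth[OF C g(2) g(5)])
        finally show ?thesis .
      qed
      moreover have "(\<lambda>k. LINT \<omega>|P x. g k (Z \<omega>)) \<longlonglongrightarrow> (LINT \<omega>|P x. indicator L (Z \<omega>))"
        by (rule integral_dominated_convergence[where w = "\<lambda>_. 1"]) (use g in auto)
      ultimately have "c * measure lborel L \<le> (LINT \<omega>|P x. indicator L (Z \<omega>))"
        by (intro LIMSEQ_le_const) auto
      also have "\<dots> = (LINT \<omega>|P x. indicator {\<omega> \<in> space M. Z \<omega> \<in> L} \<omega>)"
        by (intro Bochner_Integration.integral_cong refl) (auto simp: indicator_def)
      also have "\<dots> = prob {\<omega> \<in> space M. Z \<omega> \<in> L}" by simp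
      finally have "c * measure lborel L \<le> prob {\<omega> \<in> space M. Z \<omega> \<in> L}" .
      moreover have "emeasure lborel L = ennreal (measure lborel L)"
        using emeasure_bounded_finite[OF compact_imp_bounded[OF L(1)]] by (simp add: emeasure_eq_ennreal_measure)
      ultimately show ?thesis using c by (simp add: emeasure_eq_measure ennreal_mult'[symmetric] ennreal_leI)
    qed
    have "emeasure lborel A = (SUP L\<in>{L. L \<subseteq> A \<and> compact L}. emeasure lborel L)"
      using AU by (intro emeasure_lborel_inner_compact[of A R]) auto
    then have "ennreal c * emeasure lborel A = (SUP L\<in>{L. L \<subseteq> A \<and> compact L}. ennreal c * emeasure lborel L)"
      by (simp add: SUP_mult_left_ennreal)
    also have "\<dots> \<le> emeasure (P x) {\<omega> \<in> space M. Z \<omega> \<in> A}"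
    proof (rule SUP_least)
      fix L assume "L \<in> {L. L \<subseteq> A \<and> compact L}"
      then have "ennreal c * emeasure lborel L \<le> emeasure (P x) {\<omega> \<in> space M. Z \<omega> \<in> L}" "L \<subseteq> A" using AU by (auto intro!: compact)
      note this(1)
      also have "emeasure (P x) {\<omega> \<in> space M. Z \<omega> \<in> L} \<le> emeasure (P x) {\<omega> \<in> space M. Z \<omega> \<in> A}"
        using \<open>L \<subseteq> A\<close> Zm by (intro emeasure_mono) auto
      finally show "ennreal c * emeasure lborel L \<le> emeasure (P x) {\<omega> \<in> space M. Z \<omega> \<in> A}" .
    qed
    finally show "ennreal c * emeasure lborel A \<le> emeasure (P x) {\<omega> \<in> space M. X (enn2real (min (?T \<omega>) 1)) \<omega> \<in> A}"
      unfolding Z_def .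
  qed
qed

end

section \<open>Restarting occupation at a stopping time\<close>

context killed_process
begin

lemma occupation_before_exit:
  assumes B: "B \<in> sets borel" and D: "closed D" "D \<subseteq> Q" and y: "y \<in> Q"
  shows "(\<integral>\<^sup>+s. indicator {0..} s * emeasure (P y) {\<omega> \<in> space M. X s \<omega> \<in> B \<and> ennreal s < exit_time X D \<omega>} \<partial>lborel)
    \<le> occupation B y"
  unfolding occupation_def
proof (rule nn_integral_mono)
  fix s :: real
  show "indicator {0..} s * emeasure (P y) {\<omega> \<in> space M. X s \<omega> \<in> B \<and> ennreal s < exit_time X D \<omega>} \<le> indicator {0..} s * killed B s y"
  proof (cases "0 \<le> s")
    case True
    have "{\<omega> \<in> space M. stays B s 0 \<omega>} \<in> sets (P y)"
      using stays_event_G[OF B True] sets_G_M by auto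
    moreover have "AE \<omega> in P y. \<omega> \<in> {\<omega> \<in> space M. X s \<omega> \<in> B \<and> ennreal s < exit_time X D \<omega>} \<longrightarrow> \<omega> \<in> {\<omega> \<in> space M. stays B s 0 \<omega>}"
      using AE_start[of y]
    proof eventually_elim
      fix \<omega> assume X0: "X 0 \<omega> = y"
      show "\<omega> \<in> {\<omega> \<in> space M. X s \<omega> \<in> B \<and> ennreal s < exit_time X D \<omega>} \<longrightarrow> \<omega> \<in> {\<omega> \<in> space M. stays B s 0 \<omega>}"
      proof
        assume w: "\<omega> \<in> {\<omega> \<in> space M. X s \<omega> \<in> B \<and> ennreal s < exit_time X D \<omega>}"
        \<comment> \<open>The exit time says nothing about time 0; there the position is the
          starting point, which lies in \<open>Q\<close>.\<close>
        have "X q \<omega> \<in> Q" if "0 \<le> q" "q < s" for q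
          using before_exit_time[of s X D \<omega> q] w that D X0 y by (cases "q = 0") auto
        then show "\<omega> \<in> {\<omega> \<in> space M. stays B s 0 \<omega>}" using w by (auto simp: stays_def)
      qed
    qed
    ultimately show ?thesis unfolding killed_def by (intro mult_left_mono emeasure_mono_AE) auto
  qed simp
qed

text \<open>A path that has not left \<open>Q\<close> before \<open>T\<close> and then occupies
  \<open>B\<close> without leaving \<open>Q\<close> does so before its overall exit. The time spent
  after \<open>T\<close> is therefore part of the total, and shifting time by \<open>T\<close>
  preserves Lebesgue measure.\<close>

lemma occupation_strong_markov:
  assumes T: "stopping_time F T" and Tfin: "\<And>\<omega>. T \<omega> < \<infinity>" and A: "A \<in> sets (pre_sigma T)"
    and before: "\<And>\<omega> u. \<omega> \<in> A \<Longrightarrow> 0 < u \<Longrightarrow> u < enn2real (T \<omega>) \<Longrightarrow> X u \<omega> \<in> Q"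
    and B: "B \<in> sets borel" "B \<subseteq> Q"
  shows "(\<integral>\<^sup>+\<omega>. indicator A \<omega> * occupation B (X (enn2real (T \<omega>)) \<omega>) \<partial>P x)
    \<le> (\<integral>\<^sup>+\<omega>. (\<integral>\<^sup>+s\<in>{s. 0 \<le> s \<and> ennreal s < exit_time X Q \<omega>}. indicator B (X s \<omega>) \<partial>lborel) \<partial>P x)"
proof -
  interpret prob_space "P x" by (rule prob_space_P)
  interpret pair_sigma_finite lborel "P x" ..
  note [measurable] = stopping_time_measurable[OF T] finite_stopping_sets(1)[OF T A] B(1)
  define r where "r \<omega> = enn2real (T \<omega>)" for \<omega>
  have r0: "0 \<le> r \<omega>" for \<omega> by (simp add: r_def)
  have rm [measurable]: "r \<in> borel_measurable M" unfolding r_def by measurable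
  have rP: "r \<in> borel_measurable (P x)" by simp
  have XP: "(\<lambda>p. X (max 0 (fst p)) (snd p)) \<in> borel \<Otimes>\<^sub>M P x \<rightarrow>\<^sub>M borel"
    unfolding measurable_cong_sets[OF sets_pair_measure_cong[OF refl sets_P] refl] by (rule X_joint)
  have Xr [measurable]: "(\<lambda>\<omega>. X (r \<omega>) \<omega>) \<in> borel_measurable M" using r0 by (intro measurable_X_compose) auto
  have As: "A \<subseteq> space M" using sets.sets_into_space[OF finite_stopping_sets(1)[OF T A]] .
  have AT: "{\<omega> \<in> A. T \<omega> < \<infinity>} = A" using Tfin by auto
  have st [measurable]: "Measurable.pred (lborel \<Otimes>\<^sub>M P x) (\<lambda>p. stays B (max 0 (fst p)) (r (snd p)) (snd p))"
    using stays_measurable[OF B(1) rP r0 XP]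
    unfolding measurable_cong_sets[OF sets_pair_measure_cong[OF sets_lborel[symmetric] refl] refl] .
  have k: "(\<lambda>(s, \<omega>). indicator A \<omega> * (indicator {0..} s * killed B (max 0 s) (X (r \<omega>) \<omega>))) \<in> borel_measurable (lborel \<Otimes>\<^sub>M P x)"
  proof -
    have "(\<lambda>p. (fst p, X (r (snd p)) (snd p))) \<in> lborel \<Otimes>\<^sub>M P x \<rightarrow>\<^sub>M borel \<Otimes>\<^sub>M borel" by measurable
    from measurable_compose[OF this killed_joint[OF B(1)]]
    have [measurable]: "(\<lambda>p. killed B (max 0 (fst p)) (X (r (snd p)) (snd p))) \<in> borel_measurable (lborel \<Otimes>\<^sub>M P x)" by simp
    show ?thesis unfolding split_beta' by measurable
  qed
  have "(\<integral>\<^sup>+\<omega>. indicator A \<omega> * occupation B (X (enn2real (T \<omega>)) \<omega>) \<partial>P x)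
    = (\<integral>\<^sup>+\<omega>. (\<integral>\<^sup>+s. indicator A \<omega> * (indicator {0..} s * killed B (max 0 s) (X (r \<omega>) \<omega>)) \<partial>lborel) \<partial>P x)"
  proof (rule nn_integral_cong)
    fix \<omega>
    have "occupation B (X (r \<omega>) \<omega>) = (\<integral>\<^sup>+s. indicator {0..} s * killed B (max 0 s) (X (r \<omega>) \<omega>) \<partial>lborel)"
      unfolding occupation_def by (intro nn_integral_cong) (auto simp: indicator_def max_def)
    then show "indicator A \<omega> * occupation B (X (enn2real (T \<omega>)) \<omega>)
        = (\<integral>\<^sup>+s. indicator A \<omega> * (indicator {0..} s * killed B (max 0 s) (X (r \<omega>) \<omega>)) \<partial>lborel)"
      by (cases "\<omega> \<in> A") (simp_all add: r_def)
  qed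
  also have "\<dots> = (\<integral>\<^sup>+s. (\<integral>\<^sup>+\<omega>. indicator A \<omega> * (indicator {0..} s * killed B (max 0 s) (X (r \<omega>) \<omega>)) \<partial>P x) \<partial>lborel)"
    by (rule Fubini'[OF k])
  also have "\<dots> = (\<integral>\<^sup>+s. (\<integral>\<^sup>+\<omega>. indicator A \<omega> * (indicator {0..} s * (if stays B (max 0 s) (r \<omega>) \<omega> then 1 else 0)) \<partial>P x) \<partial>lborel)"
  proof (rule nn_integral_cong)
    fix s :: real
    have "(\<integral>\<^sup>+\<omega>. indicator A \<omega> * killed B (max 0 s) (X (r \<omega>) \<omega>) \<partial>P x) = emeasure (P x) {\<omega> \<in> A. stays B (max 0 s) (r \<omega>) \<omega>}"
      using strong_markov_stays[OF T A B(1), of "max 0 s" x] Tfin unfolding AT r_def by simp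
    also have "\<dots> = (\<integral>\<^sup>+\<omega>. indicator {\<omega> \<in> A. stays B (max 0 s) (r \<omega>) \<omega>} \<omega> \<partial>P x)"
    proof (rule nn_integral_indicator[symmetric])
      have "Measurable.pred (P x) (\<lambda>\<omega>. stays B (max 0 (fst (s, \<omega>))) (r (snd (s, \<omega>))) (snd (s, \<omega>)))"
        by (rule measurable_compose[OF _ st]) measurable
      then have "A \<inter> {\<omega> \<in> space (P x). stays B (max 0 s) (r \<omega>) \<omega>} \<in> sets (P x)" by (auto simp: pred_def)
      also have "A \<inter> {\<omega> \<in> space (P x). stays B (max 0 s) (r \<omega>) \<omega>} = {\<omega> \<in> A. stays B (max 0 s) (r \<omega>) \<omega>}" using As by auto
      finally show "{\<omega> \<in> A. stays B (max 0 s) (r \<omega>) \<omega>} \<in> sets (P x)" .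
    qed
    also have "\<dots> = (\<integral>\<^sup>+\<omega>. indicator A \<omega> * (if stays B (max 0 s) (r \<omega>) \<omega> then 1 else 0) \<partial>P x)"
      by (intro nn_integral_cong) (auto simp: indicator_def)
    finally show "(\<integral>\<^sup>+\<omega>. indicator A \<omega> * (indicator {0..} s * killed B (max 0 s) (X (r \<omega>) \<omega>)) \<partial>P x)
      = (\<integral>\<^sup>+\<omega>. indicator A \<omega> * (indicator {0..} s * (if stays B (max 0 s) (r \<omega>) \<omega> then 1 else 0)) \<partial>P x)"
      by (cases "0 \<le> s") simp_all
  qed
  also have "\<dots> = (\<integral>\<^sup>+\<omega>. (\<integral>\<^sup>+s. indicator A \<omega> * (indicator {0..} s * (if stays B (max 0 s) (r \<omega>) \<omega> then 1 else 0)) \<partial>lborel) \<partial>P x)"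
    by (rule Fubini'[symmetric]) (unfold split_beta', measurable)
  also have "\<dots> \<le> (\<integral>\<^sup>+\<omega>. (\<integral>\<^sup>+s\<in>{s. 0 \<le> s \<and> ennreal s < exit_time X Q \<omega>}. indicator B (X s \<omega>) \<partial>lborel) \<partial>P x)"
  proof (rule nn_integral_mono)
    fix \<omega> assume "\<omega> \<in> space (P x)"
    then have w: "\<omega> \<in> space M" by simp
    define e where "e = exit_time X Q \<omega>"
    define h :: "real \<Rightarrow> ennreal" where "h s = indicator B (X (max 0 s) \<omega>) * indicator {s. 0 \<le> s \<and> ennreal s < e} s" for s :: real
    have [measurable]: "(\<lambda>s. X (max 0 s) \<omega>) \<in> borel_measurable borel" by (rule path_measurable[OF w])
    have [measurable]: "h \<in> borel_measurable borel" unfolding h_def by measurable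
    have "(\<integral>\<^sup>+s. indicator A \<omega> * (indicator {0..} s * (if stays B (max 0 s) (r \<omega>) \<omega> then 1 else 0)) \<partial>lborel) \<le> (\<integral>\<^sup>+s. h (r \<omega> + s) \<partial>lborel)"
    proof (rule nn_integral_mono_AE)
      \<comment> \<open>The path staying in \<open>Q\<close> up to \<open>r \<omega> + s\<close>
        gives only a weak inequality with the exit time, while the target demands a strict one; a
        single value of \<open>s\<close> is lost.\<close>
      show "AE s in lborel. indicator A \<omega> * (indicator {0..} s * (if stays B (max 0 s) (r \<omega>) \<omega> then 1 else 0)) \<le> h (r \<omega> + s)"
        using AE_lborel_singleton[of "enn2real e - r \<omega>"]
      proof eventually_elim
        fix s assume ne: "s \<noteq> enn2real e - r \<omega>"
        have "h (r \<omega> + s) = 1" if s: "\<omega> \<in> A" "0 \<le> s" "stays B s (r \<omega>) \<omega>"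
        proof -
          have XB: "X (r \<omega> + s) \<omega> \<in> B" using s(3) by (simp add: stays_def)
          have "X u \<omega> \<in> Q" if u: "0 < u" "u \<le> r \<omega> + s" for u
          proof -
            consider "u < r \<omega>" | "r \<omega> \<le> u" "u < r \<omega> + s" | "u = r \<omega> + s" using u by linarith
            then show ?thesis
            proof cases
              case 1 then show ?thesis using before[OF s(1) u(1)] by (simp add: r_def)
            next
              case 2 then show ?thesis using stays_before[OF w r0 s(3), of "u - r \<omega>"] by simp
            next
              case 3 then show ?thesis using XB B(2) by auto
            qed
          qed
          then have "ennreal (r \<omega> + s) \<le> e" unfolding e_def by (rule exit_time_ge)
          moreover have "ennreal (r \<omega> + s) \<noteq> e"
            using ne enn2real_ennreal[of "r \<omega> + s"] r0[of \<omega>] s(2) by auto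
          ultimately have "ennreal (r \<omega> + s) < e" by (simp add: less_le)
          then show ?thesis using XB r0[of \<omega>] s(2) by (simp add: h_def)
        qed
        then show "indicator A \<omega> * (indicator {0..} s * (if stays B (max 0 s) (r \<omega>) \<omega> then 1 else 0)) \<le> h (r \<omega> + s)"
          by (auto simp: indicator_def)
      qed
    qed
    also have "\<dots> = (\<integral>\<^sup>+s. h s \<partial>lborel)"
      by (subst (2) lborel_distr_plus[of "r \<omega>", symmetric]) (simp add: nn_integral_distr)
    also have "\<dots> = (\<integral>\<^sup>+s\<in>{s. 0 \<le> s \<and> ennreal s < exit_time X Q \<omega>}. indicator B (X s \<omega>) \<partial>lborel)"
      unfolding h_def e_def by (intro nn_integral_cong) (auto simp: indicator_def max_def)
    finally show "(\<integral>\<^sup>+s. indicator A \<omega> * (indicator {0..} s * (if stays B (max 0 s) (r \<omega>) \<omega> then 1 else 0)) \<partial>lborel)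
      \<le> (\<integral>\<^sup>+s\<in>{s. 0 \<le> s \<and> ennreal s < exit_time X Q \<omega>}. indicator B (X s \<omega>) \<partial>lborel)" .
  qed
  finally show ?thesis .
qed

end

lemma exit_time_mono: "A \<subseteq> B \<Longrightarrow> exit_time X A \<omega> \<le> exit_time X B \<omega>"
  unfolding exit_time_def by (intro INF_superset_mono) auto

section \<open>From approximate resolvents to a lower bound on occupation\<close>

context stable_process
begin

lemma survival_tendsto:
  assumes T [measurable]: "T \<in> borel_measurable M"
    and g [measurable]: "\<And>k. g k \<in> borel_measurable borel" and h [measurable]: "h \<in> borel_measurable borel"
    and bd: "\<And>k x. \<bar>g k x\<bar> \<le> b" and lim: "\<And>x. (\<lambda>k. g k x) \<longlonglongrightarrow> h x"
  shows "(\<lambda>k. LINT s|lborel. indicator {0..t} s * survival x T (g k) s)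
    \<longlonglongrightarrow> (LINT s|lborel. indicator {0..t} s * survival x T h s)"
proof -
  interpret prob_space "P x" by (rule prob_space_P)
  have b0: "0 \<le> b" using order_trans[OF abs_ge_zero bd] .
  have hb: "\<bar>h x\<bar> \<le> b" for x
    by (rule LIMSEQ_le_const2[OF tendsto_rabs[OF lim]]) (use bd in auto)
  have s: "(\<lambda>k. survival x T (g k) s) \<longlonglongrightarrow> survival x T h s" for s
    unfolding survival_def
  proof (rule integral_dominated_convergence[where w = "\<lambda>_. b"])
    show "AE \<omega> in P x. (\<lambda>k. g k (X (max 0 s) \<omega>) * indicator {\<omega>. ennreal s < T \<omega>} \<omega>) \<longlonglongrightarrow> h (X (max 0 s) \<omega>) * indicator {\<omega>. ennreal s < T \<omega>} \<omega>"
      by (intro AE_I2 tendsto_intros lim)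
    show "AE \<omega> in P x. norm (g k (X (max 0 s) \<omega>) * indicator {\<omega>. ennreal s < T \<omega>} \<omega>) \<le> b" for k
      using bd b0 by (intro AE_I2) (auto simp: indicator_def)
    show "(\<lambda>\<omega>. h (X (max 0 s) \<omega>) * indicator {\<omega>. ennreal s < T \<omega>} \<omega>) \<in> borel_measurable (P x)"
      by (rule borel_measurable_integrable[OF survival_abs_le(1)[OF T h hb]])
    show "(\<lambda>\<omega>. g k (X (max 0 s) \<omega>) * indicator {\<omega>. ennreal s < T \<omega>} \<omega>) \<in> borel_measurable (P x)" for k
      by (rule borel_measurable_integrable[OF survival_abs_le(1)[OF T g bd]])
  qed auto
  show ?thesis
  proof (rule integral_dominated_convergence[where w = "\<lambda>s. b * indicator {0..t} s"])
    show "integrable lborel (\<lambda>s. b * indicator {0..t} s)"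
      by (intro integrable_mult_right integrable_real_indicator) (auto simp: emeasure_lborel_Icc_eq)
    show "AE s in lborel. (\<lambda>k. indicator {0..t} s * survival x T (g k) s) \<longlonglongrightarrow> indicator {0..t} s * survival x T h s"
      by (intro AE_I2 tendsto_intros s)
    show "AE s in lborel. norm (indicator {0..t} s * survival x T (g k) s) \<le> b * indicator {0..t} s" for k
      using survival_abs_le(2)[OF T g bd] by (intro AE_I2) (auto simp: indicator_def)
    show "(\<lambda>s. indicator {0..t} s * survival x T h s) \<in> borel_measurable lborel"
      by (intro borel_measurable_integrable survival_integrable T bounded_measurableI[OF h hb])
    show "(\<lambda>s. indicator {0..t} s * survival x T (g k) s) \<in> borel_measurable lborel" for k
      by (intro borel_measurable_integrable survival_integrable T bounded_measurableI[OF g bd])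
  qed
qed

text \<open>If the process hardly visited \<open>{g > 0}\<close> before time \<open>t\<close>, then \<open>u (X s)\<close> would stay close to
  \<open>u x \<approx> 1 / l\<close> in mean, so that its drift \<open>l * u\<close> would make the mean of \<open>u (X t)\<close> exceed the
  bound \<open>1 / l\<close> once \<open>l * t\<close> is large.\<close>

lemma occupation_drift_bound:
  assumes u: "smooth_bound Cu u" "\<And>x. 0 \<le> u x" "\<And>x. u x \<le> 1 / l"
    and l: "0 < l" and t: "0 \<le> t" "10 \<le> l * t"
    and g: "bounded_measurable g" "\<And>x. 0 \<le> g x"
    and D: "closed D" and K: "0 \<le> K" "K * t \<le> 1 / 4"
    and drift: "\<And>y. y \<in> D \<Longrightarrow> \<bar>sym_generator u y - l * u y + g y\<bar> \<le> K / l"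
    and ux: "3 / 4 \<le> l * u x"
    and exit: "measure (P x) {\<omega> \<in> space M. exit_time X D \<omega> \<le> ennreal t} \<le> 1 / 4"
  shows "1 / (8 * l) \<le> (LINT s|lborel. indicator {0..t} s * survival x (exit_time X D) g s)"
proof (rule ccontr)
  interpret prob_space "P x" by (rule prob_space_P)
  let ?T = "exit_time X D"
  define I where "I = (LINT s|lborel. indicator {0..t} s * survival x ?T g s)"
  assume "\<not> 1 / (8 * l) \<le> (LINT s|lborel. indicator {0..t} s * survival x ?T g s)"
  then have I: "I < 1 / (8 * l)" by (simp add: I_def)
  have T: "stopping_time F ?T" by (intro stopping_time_exit_time X_cadlag D)
  have Tm [measurable]: "?T \<in> borel_measurable M" by (rule stopping_time_measurable[OF T])
  note [measurable] = smooth_bound_measurable[OF u(1)]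
  have bu: "bounded_measurable u" by (rule smooth_bound_bounded_measurable[OF u(1)])
  have bL: "bounded_measurable (sym_generator u)" using sym_generator_bound[OF u(1)] sym_generator_measurable[OF u(1)] by (intro bounded_measurableI)
  obtain bg where bg: "\<And>x. \<bar>g x\<bar> \<le> bg" and gm [measurable]: "g \<in> borel_measurable borel" using g(1) by (auto simp: bounded_measurable_def)
  \<comment> \<open>Two lower bounds for the drift of \<open>u\<close> in \<open>D\<close>:
    \<open>q\<close> drops the nonnegative term \<open>l * u\<close> and shows that means of
    \<open>u\<close> hardly decrease, while \<open>q'\<close> keeps that term for the final
    contradiction.\<close>
  define q where "q y = - g y - K / l" for y
  define q' where "q' y = l * u y - g y - K / l" for y
  have bq: "bounded_measurable q" unfolding q_def
  proof (rule bounded_measurableI)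
    show "\<bar>- g y - K / l\<bar> \<le> bg + \<bar>K / l\<bar>" for y using bg[of y] by linarith
  qed measurable
  have bq': "bounded_measurable q'" unfolding q'_def
  proof (rule bounded_measurableI)
    show "\<bar>l * u y - g y - K / l\<bar> \<le> 1 + bg + \<bar>K / l\<bar>" for y
    proof -
      have "0 \<le> l * u y" "l * u y \<le> 1" using u(2,3)[of y] l by (auto simp: field_simps)
      then show ?thesis using bg[of y] by linarith
    qed
  qed measurable
  have XD: "X (max 0 s) \<omega> \<in> D" if "0 < s" "ennreal s < ?T \<omega>" for s \<omega>
    using before_exit_time[OF that(2), of s] that(1) by simp
  have one: "\<bar>(\<lambda>_::real^'d. 1) x\<bar> \<le> (1::real)" for x by simp
  have int_on: "integrable (P x) (\<lambda>\<omega>. f (X (max 0 s) \<omega>) * indicator {\<omega>. ennreal s < ?T \<omega>} \<omega>)"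
    if "bounded_measurable f" for f s
    using that survival_abs_le(1)[OF Tm] by (auto simp: bounded_measurable_def)
  have b1: "bounded_measurable (\<lambda>_::real^'d. 1 :: real)" by (rule bounded_measurableI[of _ 1]) auto
  define p where "p s = survival x ?T (\<lambda>_. 1) s" for s
  have p01: "0 \<le> p s" "p s \<le> 1" for s
    using survival_abs_le(2)[OF Tm _ one, of x s] unfolding p_def survival_def
    by (auto intro!: Bochner_Integration.integral_nonneg simp: abs_le_iff)
  have sq: "survival x ?T q s = - survival x ?T g s - K / l * p s" for s
  proof -
    have "survival x ?T q s = (LINT \<omega>|P x. - (g (X (max 0 s) \<omega>) * indicator {\<omega>. ennreal s < ?T \<omega>} \<omega>)
        - K / l * (1 * indicator {\<omega>. ennreal s < ?T \<omega>} \<omega>))"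
      unfolding survival_def q_def by (intro Bochner_Integration.integral_cong refl) (simp add: algebra_simps)
    then show ?thesis using int_on[OF g(1), of s] int_on[OF b1, of s] by (simp add: survival_def p_def)
  qed
  have sq': "survival x ?T q' s = l * survival x ?T u s - survival x ?T g s - K / l * p s" for s
  proof -
    have "survival x ?T q' s = (LINT \<omega>|P x. l * (u (X (max 0 s) \<omega>) * indicator {\<omega>. ennreal s < ?T \<omega>} \<omega>)
        - (g (X (max 0 s) \<omega>) * indicator {\<omega>. ennreal s < ?T \<omega>} \<omega>)
        - K / l * (1 * indicator {\<omega>. ennreal s < ?T \<omega>} \<omega>))"
      unfolding survival_def q'_def by (intro Bochner_Integration.integral_cong refl) (simp add: algebra_simps)
    then show ?thesis using int_on[OF g(1), of s] int_on[OF b1, of s] int_on[OF bu, of s] by (simp add: survival_def p_def)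
  qed
  have Lq: "survival x ?T q s \<le> survival x ?T (sym_generator u) s" if "0 < s" for s
  proof (rule survival_mono[OF Tm bq bL])
    fix \<omega> assume "ennreal s < ?T \<omega>"
    then have "X (max 0 s) \<omega> \<in> D" using XD that by blast
    from drift[OF this] show "q (X (max 0 s) \<omega>) \<le> sym_generator u (X (max 0 s) \<omega>)"
      using u(2)[of "X (max 0 s) \<omega>"] l mult_nonneg_nonneg[of l "u (X (max 0 s) \<omega>)"] unfolding q_def abs_le_iff by linarith
  qed
  have Lq': "survival x ?T q' s \<le> survival x ?T (sym_generator u) s" if "0 < s" for s
  proof (rule survival_mono[OF Tm bq' bL])
    fix \<omega> assume "ennreal s < ?T \<omega>"
    then have "X (max 0 s) \<omega> \<in> D" using XD that by blast
    from drift[OF this] show "q' (X (max 0 s) \<omega>) \<le> sym_generator u (X (max 0 s) \<omega>)"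
      unfolding q'_def abs_le_iff by linarith
  qed
  have si: "integrable lborel (\<lambda>s. indicator {0..r} s * survival x ?T f s)" if "bounded_measurable f" for f r
    by (rule survival_integrable[OF Tm that])
  have ci: "integrable lborel (\<lambda>s. indicator {0..r} s * c)" for r c :: real
    by (intro integrable_mult_left integrable_real_indicator) (auto simp: emeasure_lborel_Icc_eq)
  have g0: "0 \<le> survival x ?T g s" for s
    unfolding survival_def using g(2) by (intro Bochner_Integration.integral_nonneg) auto
  have Kl: "0 \<le> K / l" using K l by simp
  \<comment> \<open>The drift is compared with its lower bound on the whole of \<open>{0..t}\<close>
    instead of \<open>{0..s}\<close>, which is allowed because that lower bound is
    nonpositive.\<close>
  have a: "u x - I - K / l * t \<le> (LINT \<omega>|P x. u (X (enn2real (min (?T \<omega>) (ennreal s))) \<omega>))" if s: "0 \<le> s" "s \<le> t" for s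
  proof -
    have "- I - K / l * t = (LINT r|lborel. - (indicator {0..t} r * survival x ?T g r) - indicator {0..t} r * (K / l))"
      using si[OF g(1), of t] ci[of t "K / l"] t by (simp add: I_def)
    also have "\<dots> \<le> (LINT r|lborel. indicator {0..s} r * survival x ?T (sym_generator u) r)"
    proof (rule integral_mono_AE)
      show "AE r in lborel. - (indicator {0..t} r * survival x ?T g r) - indicator {0..t} r * (K / l) \<le> indicator {0..s} r * survival x ?T (sym_generator u) r"
        using AE_lborel_singleton[of "0::real"]
      proof eventually_elim
        fix r :: real assume "r \<noteq> 0"
        have "- survival x ?T g r - K / l \<le> survival x ?T (sym_generator u) r" if "0 < r"
          using Lq[OF that] sq[of r] mult_left_mono[OF p01(2)[of r] Kl] by simp
        then show "- (indicator {0..t} r * survival x ?T g r) - indicator {0..t} r * (K / l) \<le> indicator {0..s} r * survival x ?T (sym_generator u) r"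
          using s \<open>r \<noteq> 0\<close> g0[of r] Kl by (auto simp: indicator_def)
      qed
    qed (use si[OF g(1)] si[OF bL] ci in auto)
    finally show ?thesis using optional_stopping[OF T u(1) s(1), of x] by simp
  qed
  have stop_int: "integrable (P x) (\<lambda>\<omega>. u (X (enn2real (min (?T \<omega>) (ennreal s))) \<omega>))" for s
  proof (rule integrable_const_bound[of _ "1 / l"])
    have "(\<lambda>\<omega>. X (enn2real (min (?T \<omega>) (ennreal s))) \<omega>) \<in> borel_measurable M" by (intro measurable_X_compose) auto
    then have [measurable]: "(\<lambda>\<omega>. X (enn2real (min (?T \<omega>) (ennreal s))) \<omega>) \<in> borel_measurable (P x)" by simp
    show "(\<lambda>\<omega>. u (X (enn2real (min (?T \<omega>) (ennreal s))) \<omega>)) \<in> borel_measurable (P x)" by measurable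
  qed (use u in auto)
  \<comment> \<open>Stopped and surviving means differ only on paths that have left \<open>D\<close>
    by time \<open>t\<close>; these have probability at most 1/4, and \<open>u\<close> is at most
    \<open>1 / l\<close> there.\<close>
  have su: "u x - I - K / l * t - 1 / l * (1 / 4) \<le> survival x ?T u s" if s: "0 \<le> s" "s \<le> t" for s
  proof -
    have E [measurable]: "{\<omega> \<in> space M. ?T \<omega> \<le> ennreal t} \<in> sets M" by measurable
    have "(LINT \<omega>|P x. u (X (enn2real (min (?T \<omega>) (ennreal s))) \<omega>))
      \<le> (LINT \<omega>|P x. u (X (max 0 s) \<omega>) * indicator {\<omega>. ennreal s < ?T \<omega>} \<omega> + 1 / l * indicator {\<omega> \<in> space M. ?T \<omega> \<le> ennreal t} \<omega>)"
    proof (rule integral_mono[OF stop_int])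
      show "integrable (P x) (\<lambda>\<omega>. u (X (max 0 s) \<omega>) * indicator {\<omega>. ennreal s < ?T \<omega>} \<omega> + 1 / l * indicator {\<omega> \<in> space M. ?T \<omega> \<le> ennreal t} \<omega>)"
        using int_on[OF bu] by (intro Bochner_Integration.integrable_add integrable_mult_right integrable_real_indicator) (auto simp: emeasure_eq_measure)
      fix \<omega> assume w: "\<omega> \<in> space (P x)"
      show "u (X (enn2real (min (?T \<omega>) (ennreal s))) \<omega>)
        \<le> u (X (max 0 s) \<omega>) * indicator {\<omega>. ennreal s < ?T \<omega>} \<omega> + 1 / l * indicator {\<omega> \<in> space M. ?T \<omega> \<le> ennreal t} \<omega>"
      proof (cases "ennreal s < ?T \<omega>")
        case True
        then have "min (?T \<omega>) (ennreal s) = ennreal s" by (simp add: min_absorb2 less_imp_le)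
        then show ?thesis using True s(1) l by (simp add: max_def indicator_def)
      next
        case False
        then have "?T \<omega> \<le> ennreal t" using s by (meson ennreal_leI not_less order_trans)
        then show ?thesis using False w u(3) by (simp add: indicator_def)
      qed
    qed
    also have "\<dots> = survival x ?T u s + 1 / l * prob {\<omega> \<in> space M. ?T \<omega> \<le> ennreal t}"
      using int_on[OF bu, of s] by (simp add: survival_def emeasure_eq_measure)
    also have "\<dots> \<le> survival x ?T u s + 1 / l * (1 / 4)"
      using exit l by (intro add_left_mono mult_left_mono) auto
    finally show ?thesis using a[OF s] by linarith
  qed
  define v where "v = u x - I - K / l * t - 1 / l * (1 / 4)"
  have J: "t * v \<le> (LINT s|lborel. indicator {0..t} s * survival x ?T u s)"
  proof -
    have "t * v = (LINT s|lborel. indicator {0..t} s * v)" using t by simp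
    also have "\<dots> \<le> (LINT s|lborel. indicator {0..t} s * survival x ?T u s)"
      using su by (intro integral_mono si[OF bu] ci) (auto simp: indicator_def v_def)
    finally show ?thesis .
  qed
  have "l * (LINT s|lborel. indicator {0..t} s * survival x ?T u s) - I - K / l * t
    = (LINT s|lborel. l * (indicator {0..t} s * survival x ?T u s) - indicator {0..t} s * survival x ?T g s - indicator {0..t} s * (K / l))"
    using si[OF g(1), of t] si[OF bu, of t] ci[of t "K / l"] t by (simp add: I_def)
  also have "\<dots> \<le> (LINT s|lborel. indicator {0..t} s * survival x ?T (sym_generator u) s)"
  proof (rule integral_mono_AE)
    show "AE s in lborel. l * (indicator {0..t} s * survival x ?T u s) - indicator {0..t} s * survival x ?T g s - indicator {0..t} s * (K / l)
      \<le> indicator {0..t} s * survival x ?T (sym_generator u) s"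
      using AE_lborel_singleton[of "0::real"]
    proof eventually_elim
      fix s :: real assume "s \<noteq> 0"
      have "l * survival x ?T u s - survival x ?T g s - K / l \<le> survival x ?T (sym_generator u) s" if "0 < s"
        using Lq'[OF that] sq'[of s] mult_left_mono[OF p01(2)[of s] Kl] by simp
      then show "l * (indicator {0..t} s * survival x ?T u s) - indicator {0..t} s * survival x ?T g s - indicator {0..t} s * (K / l)
        \<le> indicator {0..t} s * survival x ?T (sym_generator u) s"
        using \<open>s \<noteq> 0\<close> by (auto simp: indicator_def)
    qed
  qed (use si[OF g(1)] si[OF bL] si[OF bu] ci in auto)
  also have "u x + \<dots> = (LINT \<omega>|P x. u (X (enn2real (min (?T \<omega>) (ennreal t))) \<omega>))"
    using optional_stopping[OF T u(1) t(1), of x] by simp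
  also have "\<dots> \<le> (LINT \<omega>|P x. 1 / l)" using u(3) by (intro integral_mono stop_int) auto
  finally have "u x + (l * (LINT s|lborel. indicator {0..t} s * survival x ?T u s) - I - K / l * t) \<le> 1 / l"
    using prob_space by simp
  then have main: "u x + l * (t * v) - I - K / l * t \<le> 1 / l"
    using mult_left_mono[OF J, of l] l by linarith
  \<comment> \<open>In multiples of \<open>1 / l\<close>: surviving means exceed 3/4 - 1/8 - 1/4 -
    1/4 = 1/8, so the drift over a time with \<open>l * t\<close> at least 10 adds more than 10/8.
    The final mean then exceeds 3/4 + 10/8 - 1/8 - 1/4, which is more than 1.\<close>
  have lI: "l * I < 1 / 8" using mult_strict_left_mono[OF I l] l by simp
  have lv: "l * v = l * u x - l * I - K * t - 1 / 4" using l by (simp add: v_def algebra_simps)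
  then have "1 / 8 < l * v" using lI ux K by linarith
  then have "10 * (1 / 8) < (l * t) * (l * v)" using t(2) by (intro mult_le_less_imp_less) auto
  moreover have "l * (u x + l * (t * v) - I - K / l * t) \<le> l * (1 / l)" using main l by (intro mult_left_mono) auto
  then have "l * u x + (l * t) * (l * v) - l * I - K * t \<le> 1" using l by (simp add: algebra_simps)
  ultimately show False using ux lI K by linarith
qed

end

section \<open>Positive occupation of compact sets, and the transfer to other starting
  points\<close>

context killed_process
begin

text \<open>For each smooth approximation \<open>g k\<close> of the indicator of \<open>B\<close>,
  the lower bound on occupation holds for starting points in \<open>B\<close> off an exceptional set
  of at most half the measure of \<open>B\<close>. Some point of \<open>B\<close> avoids infinitely
  many of these sets, and there the uniform bound survives the limit in \<open>k\<close>.\<close>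

lemma occupation_positive:
  assumes r0: "0 < r0" "r0 \<le> 1" "cball y0 r0 \<subseteq> Q"
    and close: "\<And>x h. x \<in> cball y0 r0 \<Longrightarrow> h \<noteq> 0 \<Longrightarrow> norm h \<le> 1 \<Longrightarrow> \<bar>n x h - n y0 h\<bar> \<le> 1"
    and B: "compact B" "B \<subseteq> cball y0 (r0 / 2)" "emeasure lborel B \<noteq> 0"
  shows "\<exists>x\<in>B. occupation B x \<noteq> 0"
proof -
  let ?D = "cball y0 r0"
  let ?T = "exit_time X ?D"
  have Bm [measurable]: "B \<in> sets borel" using B(1) by (rule borel_compact)
  have Bo: "B \<subseteq> ball y0 r0" using B(2) r0(1) by (auto simp: subset_iff mem_cball)
  obtain K where K: "0 \<le> K"
    and res: "\<And>l (g :: real^'d \<Rightarrow> real) Cg. \<lbrakk>0 < l; smooth_bound Cg g; \<And>x. 0 \<le> g x; \<And>x. g x \<le> 1\<rbrakk> \<Longrightarrow>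
      \<exists>u Cu. smooth_bound Cu u \<and> (\<forall>x. 0 \<le> u x \<and> u x \<le> 1 / l) \<and>
        (\<forall>x\<in>?D. \<bar>sym_generator u x - l * u x + g x\<bar> \<le> K / l) \<and>
        (\<forall>\<phi> C B \<epsilon>. smooth_bound C \<phi> \<and> (\<forall>x. 0 \<le> \<phi> x \<and> \<phi> x \<le> 1) \<and> (\<forall>x\<in>B. \<phi> x = 1) \<and>
           B \<in> sets borel \<and> (\<forall>x. indicator B x \<le> g x) \<and> 0 < \<epsilon> \<longrightarrow>
           (\<exists>E\<in>sets borel. ennreal \<epsilon> * emeasure lborel E \<le> (\<integral>\<^sup>+x. ennreal \<bar>\<phi> x - indicator B x\<bar> \<partial>lborel) \<and>
              (\<forall>x\<in>B - E. 1 - \<epsilon> - (1 + 2 * C * levy_mass) / l \<le> l * u x)))"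
    using approximate_resolvent[OF close] by blast
  obtain K' where K': "0 \<le> K'" "\<And>x t. 0 \<le> t \<Longrightarrow> measure (P x) {\<omega> \<in> space M. exit_time X (cball x (r0 / 2)) \<omega> \<le> ennreal t} \<le> K' * t"
    using exit_ball_prob[of "r0 / 2"] r0 by auto
  \<comment> \<open>A short horizon makes both the resolvent error \<open>K * t\<close> and the exit
    probability at most 1/4.\<close>
  define t where "t = 1 / (4 * (K + K' + 1))"
  have t: "0 < t" "K * t \<le> 1 / 4" "K' * t \<le> 1 / 4" using K K'(1) by (auto simp: t_def divide_simps)
  obtain g where g: "\<And>k. \<exists>C. smooth_bound C (g k)" "\<And>k x. 0 \<le> g k x" "\<And>k x. g k x \<le> 1"
    "\<And>k x. x \<in> B \<Longrightarrow> g k x = 1" "\<And>k x. x \<notin> ball y0 r0 \<Longrightarrow> g k x = 0" "\<And>x. (\<lambda>k. g k x) \<longlonglongrightarrow> indicator B x"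
    using smooth_cutoff_sequence[OF B(1) open_ball Bo] by blast
  have gm [measurable]: "g k \<in> borel_measurable borel" for k using g(1)[of k] smooth_bound_measurable by blast
  have gb: "\<bar>g k x\<bar> \<le> 1" for k x using g(2,3)[of k x] by simp
  have Bfin: "emeasure lborel B < \<infinity>" by (rule emeasure_bounded_finite[OF compact_imp_bounded[OF B(1)]])
  define b where "b = measure lborel B"
  have Bb: "emeasure lborel B = ennreal b" unfolding b_def using Bfin by (intro emeasure_eq_ennreal_measure) auto
  have b: "0 < b" using B(3) Bb by (cases "0 < b") (auto simp: ennreal_neg)
  have "(\<lambda>k. \<integral>\<^sup>+x. ennreal \<bar>g k x - indicator B x\<bar> \<partial>lborel) \<longlonglongrightarrow> (\<integral>\<^sup>+(x::real^'d). 0 \<partial>lborel)"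
  proof (rule nn_integral_dominated_convergence[where w = "indicator (ball y0 r0)"])
    show "AE x in lborel. ennreal \<bar>g k x - indicator B x\<bar> \<le> indicator (ball y0 r0) x" for k
    proof (rule AE_I2)
      fix x show "ennreal \<bar>g k x - indicator B x\<bar> \<le> indicator (ball y0 r0) x"
      proof (cases "x \<in> ball y0 r0")
        case True
        have "\<bar>g k x - indicator B x\<bar> \<le> 1" using g(2)[of k x] g(3)[of k x] by (cases "x \<in> B") (simp_all add: abs_le_iff)
        then show ?thesis using True ennreal_leI by fastforce
      next
        case False
        then have "x \<notin> B" using Bo by auto
        then show ?thesis using g(5)[OF False] by simp
      qed
    qed
    show "AE x in lborel. (\<lambda>k. ennreal \<bar>g k x - indicator B x\<bar>) \<longlonglongrightarrow> 0"
    proof (rule AE_I2)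
      fix x
      have "(\<lambda>k. ennreal \<bar>g k x - indicator B x\<bar>) \<longlonglongrightarrow> ennreal \<bar>indicator B x - indicator B x\<bar>"
        by (intro tendsto_intros g(6))
      then show "(\<lambda>k. ennreal \<bar>g k x - indicator B x\<bar>) \<longlonglongrightarrow> 0" by simp
    qed
    show "(\<integral>\<^sup>+x. indicator (ball y0 r0) x \<partial>lborel) < \<infinity>"
      using emeasure_bounded_finite[OF bounded_ball, of y0 r0] by simp
    show "indicator (ball y0 r0) \<in> borel_measurable lborel" by (rule borel_measurable_indicator) simp
  qed auto
  \<comment> \<open>With the threshold 1/8 in Chebyshev's inequality, \<open>b / 16\<close> becomes
    the bound \<open>b / 2\<close> on the exceptional sets.\<close>
  then have "\<forall>\<^sub>F k in sequentially. (\<integral>\<^sup>+x. ennreal \<bar>g k x - indicator B x\<bar> \<partial>lborel) < ennreal (b / 16)"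
    using b by (intro order_tendstoD(2)) auto
  then obtain j where j: "(\<integral>\<^sup>+x. ennreal \<bar>g j x - indicator B x\<bar> \<partial>lborel) < ennreal (b / 16)"
    using eventually_happens' sequentially_bot by blast
  obtain C where C: "smooth_bound C (g j)" using g(1) by blast
  \<comment> \<open>The first entry makes \<open>L * t\<close> at least 10; the second leaves 1 -
    1/8 - 1/8 = 3/4 as lower bound for \<open>L * u\<close>. Its constant \<open>C\<close> belongs
    to the one function \<open>g j\<close> that serves as \<open>\<phi>\<close> for every
    \<open>k\<close>, so \<open>L\<close> is fixed before \<open>k\<close> varies.\<close>
  define L where "L = max (10 / t) (8 * (1 + 2 * C * levy_mass))"
  have L: "0 < L" "10 \<le> L * t" "(1 + 2 * C * levy_mass) / L \<le> 1 / 8"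
  proof -
    have "0 < 10 / t" "10 / t \<le> L" using t by (auto simp: L_def)
    then show sym_generator: "0 < L" by linarith
    show "10 \<le> L * t" using \<open>10 / t \<le> L\<close> t(1) by (simp add: pos_divide_le_eq)
    have "8 * (1 + 2 * C * levy_mass) \<le> L" by (simp add: L_def)
    then show "(1 + 2 * C * levy_mass) / L \<le> 1 / 8" using sym_generator by (simp add: divide_simps)
  qed
  have "\<exists>u Cu E. smooth_bound Cu u \<and> (\<forall>x. 0 \<le> u x \<and> u x \<le> 1 / L) \<and> (\<forall>x\<in>?D. \<bar>sym_generator u x - L * u x + g k x\<bar> \<le> K / L) \<and>
      E \<in> sets borel \<and> emeasure lborel E \<le> ennreal (b / 2) \<and> (\<forall>x\<in>B - E. 3 / 4 \<le> L * u x)" for k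
  proof -
    obtain Ck where Ck: "smooth_bound Ck (g k)" using g(1) by blast
    obtain u Cu where u: "smooth_bound Cu u" "\<forall>x. 0 \<le> u x \<and> u x \<le> 1 / L" "\<forall>x\<in>?D. \<bar>sym_generator u x - L * u x + g k x\<bar> \<le> K / L"
      and E: "\<forall>\<phi> C B \<epsilon>. smooth_bound C \<phi> \<and> (\<forall>x. 0 \<le> \<phi> x \<and> \<phi> x \<le> 1) \<and> (\<forall>x\<in>B. \<phi> x = 1) \<and>
           B \<in> sets borel \<and> (\<forall>x. indicator B x \<le> g k x) \<and> 0 < \<epsilon> \<longrightarrow>
           (\<exists>E\<in>sets borel. ennreal \<epsilon> * emeasure lborel E \<le> (\<integral>\<^sup>+x. ennreal \<bar>\<phi> x - indicator B x\<bar> \<partial>lborel) \<and>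
              (\<forall>x\<in>B - E. 1 - \<epsilon> - (1 + 2 * C * levy_mass) / L \<le> L * u x))"
      using res[OF L(1) Ck g(2) g(3)] by blast
    have "indicator B x \<le> g k x" for x using g(2,4) by (simp add: indicator_def)
    then obtain E where E: "E \<in> sets borel" "ennreal (1 / 8) * emeasure lborel E \<le> (\<integral>\<^sup>+x. ennreal \<bar>g j x - indicator B x\<bar> \<partial>lborel)"
        "\<forall>x\<in>B - E. 1 - 1 / 8 - (1 + 2 * C * levy_mass) / L \<le> L * u x"
      using E[rule_format, of C "g j" B "1 / 8"] C g(2,3,4) Bm by auto
    have "ennreal (1 / 8) * emeasure lborel E \<le> ennreal (b / 16)" using E(2) j by simp
    then have "emeasure lborel E \<le> ennreal (b / 2)"
      using b by (cases "emeasure lborel E") (auto simp: ennreal_mult'[symmetric] ennreal_mult_top ennreal_le_iff top_unique intro!: ennreal_leI)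
    moreover have "3 / 4 \<le> L * u x" if "x \<in> B - E" for x using bspec[OF E(3) that] L(3) by linarith
    ultimately show ?thesis using u E(1) by blast
  qed
  then obtain u Cu E where u: "\<And>k. smooth_bound (Cu k) (u k)" "\<And>k x. 0 \<le> u k x" "\<And>k x. u k x \<le> 1 / L"
      "\<And>k x. x \<in> ?D \<Longrightarrow> \<bar>sym_generator (u k) x - L * u k x + g k x\<bar> \<le> K / L"
    and E: "\<And>k. E k \<in> sets borel" "\<And>k. emeasure lborel (E k) \<le> ennreal (b / 2)"
      "\<And>k x. x \<in> B \<Longrightarrow> x \<notin> E k \<Longrightarrow> 3 / 4 \<le> L * u k x"
    by (metis DiffI)
  \<comment> \<open>Otherwise every point of \<open>B\<close> lies in \<open>E k\<close> for all
    large \<open>k\<close>, and \<open>B\<close> is the increasing union of sets \<open>V m\<close>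
    of measure at most \<open>b / 2\<close>.\<close>
  have "\<exists>x\<in>B. \<forall>m. \<exists>k\<ge>m. x \<notin> E k"
  proof (rule ccontr)
    assume "\<not> (\<exists>x\<in>B. \<forall>m. \<exists>k\<ge>m. x \<notin> E k)"
    then have ev: "\<And>x. x \<in> B \<Longrightarrow> \<exists>m. \<forall>k\<ge>m. x \<in> E k" by blast
    define V where "V m = B \<inter> (\<Inter>k\<in>{m..}. E k)" for m
    have Vm: "V m \<in> sets lborel" for m unfolding V_def using E(1) Bm by (intro sets.Int sets.countable_INT'') auto
    have "incseq V" by (auto simp: incseq_def V_def)
    then have "(SUP m. emeasure lborel (V m)) = emeasure lborel (\<Union>m. V m)" using Vm by (intro SUP_emeasure_incseq) auto
    also have "(\<Union>m. V m) = B" using ev by (fastforce simp: V_def)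
    finally have "ennreal b = (SUP m. emeasure lborel (V m))" using Bb by simp
    also have "\<dots> \<le> ennreal (b / 2)"
    proof (rule SUP_least)
      fix m
      have "emeasure lborel (V m) \<le> emeasure lborel (E m)" using E(1) by (intro emeasure_mono) (auto simp: V_def)
      then show "emeasure lborel (V m) \<le> ennreal (b / 2)" using E(2)[of m] by (rule order_trans)
    qed
    finally show False using b by (simp add: ennreal_le_iff)
  qed
  then obtain x where x: "x \<in> B" "\<And>m. \<exists>k\<ge>m. x \<notin> E k" by blast
  have T: "?T \<in> borel_measurable M" by (rule exit_time_measurable) simp
  \<comment> \<open>\<open>B\<close> keeps distance \<open>r0 / 2\<close> from the boundary of the
    ball, so leaving it from \<open>x\<close> takes at least as long as leaving the ball of that
    radius around \<open>x\<close>.\<close>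
  have exit: "measure (P x) {\<omega> \<in> space M. ?T \<omega> \<le> ennreal t} \<le> 1 / 4"
  proof -
    interpret prob_space "P x" by (rule prob_space_P)
    have "exit_time X (cball x (r0 / 2)) \<in> borel_measurable M" by (rule exit_time_measurable) simp
    then have m: "{\<omega> \<in> space M. exit_time X (cball x (r0 / 2)) \<omega> \<le> ennreal t} \<in> sets M" by measurable
    have sub: "cball x (r0 / 2) \<subseteq> ?D"
    proof
      fix z assume "z \<in> cball x (r0 / 2)"
      then show "z \<in> ?D" using x(1) B(2) dist_triangle[of y0 z x] by (fastforce simp: subset_iff)
    qed
    have "measure (P x) {\<omega> \<in> space M. ?T \<omega> \<le> ennreal t} \<le> measure (P x) {\<omega> \<in> space M. exit_time X (cball x (r0 / 2)) \<omega> \<le> ennreal t}"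
      using m exit_time_mono[OF sub, of X] by (intro finite_measure_mono) (auto intro: order_trans)
    also have "\<dots> \<le> K' * t" using t by (intro K') auto
    finally show ?thesis using t by simp
  qed
  let ?I = "\<lambda>g. LINT s|lborel. indicator {0..t} s * survival x ?T g s"
  have big: "1 / (8 * L) \<le> ?I (g k)" if "x \<notin> E k" for k
  proof (rule occupation_drift_bound[OF u(1) u(2) u(3) L(1) _ L(2) _ g(2) _ K t(2) u(4)])
    show "bounded_measurable (g k)" using gb by (intro bounded_measurableI[of _ 1]) auto
  qed (use t E(3)[OF x(1) that] exit in auto)
  have "(\<lambda>k. ?I (g k)) \<longlonglongrightarrow> ?I (indicator B)"
    by (rule survival_tendsto[OF T gm _ gb g(6)]) measurable
  have IB: "0 < ?I (indicator B)"
  proof (rule ccontr)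
    assume "\<not> 0 < ?I (indicator B)"
    then have "?I (indicator B) < 1 / (8 * L)" using L(1) by (meson divide_pos_pos le_less_trans mult_pos_pos not_less zero_less_numeral zero_less_one)
    with \<open>(\<lambda>k. ?I (g k)) \<longlonglongrightarrow> ?I (indicator B)\<close> have "\<forall>\<^sub>F k in sequentially. ?I (g k) < 1 / (8 * L)"
      by (rule order_tendstoD(2))
    then obtain m where "\<And>k. m \<le> k \<Longrightarrow> ?I (g k) < 1 / (8 * L)" by (auto simp: eventually_sequentially)
    then show False using x(2)[of m] big by (meson not_less)
  qed
  have "occupation B x \<noteq> 0"
  proof
    assume occ: "occupation B x = 0"
    interpret prob_space "P x" by (rule prob_space_P)
    have xQ: "x \<in> Q" using x(1) Bo r0(3) ball_subset_cball[of y0 r0] by blast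
    have bB: "bounded_measurable (indicator B :: real^'d \<Rightarrow> real)" by (rule bounded_measurableI[of _ 1]) auto
    have sB: "survival x ?T (indicator B) s = prob {\<omega> \<in> space M. X s \<omega> \<in> B \<and> ennreal s < ?T \<omega>}" if "0 \<le> s" for s
    proof -
      have "survival x ?T (indicator B) s = (LINT \<omega>|P x. indicator {\<omega> \<in> space M. X s \<omega> \<in> B \<and> ennreal s < ?T \<omega>} \<omega>)"
        unfolding survival_def using that by (intro Bochner_Integration.integral_cong refl) (auto simp: indicator_def max_def)
      moreover have "{\<omega> \<in> space M. X s \<omega> \<in> B \<and> ennreal s < ?T \<omega>} \<subseteq> space (P x)" by auto
      ultimately show ?thesis by (simp add: Int_absorb1 Int_absorb2 del: space_P)
    qed
    have "ennreal (?I (indicator B)) = (\<integral>\<^sup>+s. ennreal (indicator {0..t} s * survival x ?T (indicator B) s) \<partial>lborel)"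
    proof (rule nn_integral_eq_integral[symmetric])
      show "integrable lborel (\<lambda>s. indicator {0..t} s * survival x ?T (indicator B) s)" by (rule survival_integrable[OF T bB])
      show "AE s in lborel. 0 \<le> indicator {0..t} s * survival x ?T (indicator B) s" using sB by (intro AE_I2) (auto simp: indicator_def)
    qed
    also have "\<dots> \<le> (\<integral>\<^sup>+s. indicator {0..} s * emeasure (P x) {\<omega> \<in> space M. X s \<omega> \<in> B \<and> ennreal s < ?T \<omega>} \<partial>lborel)"
      using sB by (intro nn_integral_mono) (auto simp: indicator_def emeasure_eq_measure)
    also have "\<dots> \<le> occupation B x" using r0(3) xQ by (intro occupation_before_exit) auto
    finally show False using occ IB by simp
  qed
  then show ?thesis using x(1) by blast
qed

lemma occupation_mono:
  assumes "B \<subseteq> B'" "B' \<in> sets borel" shows "occupation B y \<le> occupation B' y"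
  unfolding occupation_def
proof (rule nn_integral_mono)
  fix s :: real
  show "indicator {0..} s * killed B s y \<le> indicator {0..} s * killed B' s y"
  proof (cases "0 \<le> s")
    case True
    have "{\<omega> \<in> space M. stays B' s 0 \<omega>} \<in> sets (P y)" using stays_event_G[OF assms(2) True] sets_G_M by auto
    then have "killed B s y \<le> killed B' s y" unfolding killed_def using assms(1) by (intro emeasure_mono) (auto simp: stays_def)
    then show ?thesis by (rule mult_left_mono) simp
  qed simp
qed

lemma occupation_UN:
  assumes B: "\<And>k. B k \<in> sets borel" shows "occupation (\<Union>k. B k) y \<le> (\<Sum>k. occupation (B k) y)"
proof -
  have km: "(\<lambda>s. indicator {0..} s * killed (B k) s y) \<in> borel_measurable lborel" for k
  proof -
    have "(\<lambda>s. indicator {0..} s * killed (B k) (max 0 s) y) \<in> borel_measurable lborel"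
      using measurable_compose[OF _ killed_joint[OF B[of k]], of "\<lambda>s. (s, y)" lborel] by simp
    moreover have "(\<lambda>s. indicator {0..} s * killed (B k) (max 0 s) y) = (\<lambda>s. indicator {0..} s * killed (B k) s y)"
      by (auto simp: fun_eq_iff indicator_def max_def)
    ultimately show ?thesis by simp
  qed
  have "occupation (\<Union>k. B k) y \<le> (\<integral>\<^sup>+s. (\<Sum>k. indicator {0..} s * killed (B k) s y) \<partial>lborel)"
    unfolding occupation_def
  proof (rule nn_integral_mono)
    fix s :: real
    show "indicator {0..} s * killed (\<Union>k. B k) s y \<le> (\<Sum>k. indicator {0..} s * killed (B k) s y)"
    proof (cases "0 \<le> s")
      case True
      have m: "{\<omega> \<in> space M. stays (B k) s 0 \<omega>} \<in> sets (P y)" for k using stays_event_G[OF B True] sets_G_M by auto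
      have "{\<omega> \<in> space M. stays (\<Union>k. B k) s 0 \<omega>} = (\<Union>k. {\<omega> \<in> space M. stays (B k) s 0 \<omega>})" by (auto simp: stays_def)
      then have "killed (\<Union>k. B k) s y \<le> (\<Sum>k. killed (B k) s y)"
        unfolding killed_def using m by (simp add: emeasure_subadditive_countably image_subset_iff)
      then show ?thesis using True by simp
    qed simp
  qed
  also have "\<dots> = (\<Sum>k. occupation (B k) y)" unfolding occupation_def by (rule nn_integral_suminf[OF km])
  finally show ?thesis .
qed

text \<open>The law of the position at the stopping time dominates \<open>c\<close> times Lebesgue
  measure on \<open>W\<close>. Restarting there replaces the given starting point by an integral
  over \<open>W\<close>, so null sets of starting points no longer matter. The cap 1 keeps the
  stopping time finite, and up to it the path remains in \<open>Q\<close>.\<close>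

lemma target_lower_bound:
  assumes x: "cball x r \<subseteq> Q"
    and c: "\<And>A. A \<in> sets borel \<Longrightarrow> A \<subseteq> W \<Longrightarrow> ennreal c * emeasure lborel A
        \<le> emeasure (P x) {\<omega> \<in> space M. X (enn2real (min (exit_time X (cball x r) \<omega>) 1)) \<omega> \<in> A}"
    and W [measurable]: "W \<in> sets borel" and B: "B \<in> sets borel" "B \<subseteq> Q"
  shows "ennreal c * (\<integral>\<^sup>+y. indicator W y * occupation B y \<partial>lborel)
    \<le> (\<integral>\<^sup>+\<omega>. (\<integral>\<^sup>+s\<in>{s. 0 \<le> s \<and> ennreal s < exit_time X Q \<omega>}. indicator B (X s \<omega>) \<partial>lborel) \<partial>P x)"
proof -
  let ?T = "\<lambda>\<omega>. min (exit_time X (cball x r) \<omega>) 1"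
  have T: "stopping_time F ?T"
    by (intro stopping_time_min stopping_time_exit_time stopping_time_const X_cadlag) auto
  define Z where "Z \<omega> = X (enn2real (?T \<omega>)) \<omega>" for \<omega>
  have "Z \<in> borel_measurable M"
    unfolding Z_def using stopping_time_measurable[OF T] by (intro measurable_X_compose) auto
  then have Z [measurable]: "Z \<in> borel_measurable (P x)" by simp
  define A where "A = {\<omega> \<in> space M. ?T \<omega> < \<infinity> \<and> X (enn2real (?T \<omega>)) \<omega> \<in> W}"
  have fin: "?T \<omega> < \<infinity>" for \<omega> by (simp add: min_less_iff_disj)
  have AZ: "A = {\<omega> \<in> space M. Z \<omega> \<in> W}" using fin by (auto simp: A_def Z_def)
  have om [measurable]: "occupation B \<in> borel_measurable borel" by (rule occupation_measurable[OF B(1)])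
  have "ennreal c * (\<integral>\<^sup>+y. indicator W y * occupation B y \<partial>lborel)
     = (\<integral>\<^sup>+y. occupation B y \<partial>density lborel (\<lambda>y. ennreal c * indicator W y))"
    by (subst nn_integral_density) (auto simp: mult.assoc nn_integral_cmult)
  also have "\<dots> \<le> (\<integral>\<^sup>+y. occupation B y \<partial>density (distr (P x) borel Z) (indicator W))"
  proof (rule nn_integral_mono_measure)
    show "density lborel (\<lambda>y. ennreal c * indicator W y) \<le> density (distr (P x) borel Z) (indicator W)"
    proof (subst le_measure)
      show "\<forall>S\<in>sets (density lborel (\<lambda>y. ennreal c * indicator W y)).
        emeasure (density lborel (\<lambda>y. ennreal c * indicator W y)) S \<le> emeasure (density (distr (P x) borel Z) (indicator W)) S"
      proof
        fix S assume "S \<in> sets (density lborel (\<lambda>y. ennreal c * indicator W y))"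
        then have S [measurable]: "S \<in> sets borel" by simp
        have "emeasure (density lborel (\<lambda>y. ennreal c * indicator W y)) S = (\<integral>\<^sup>+y. ennreal c * indicator (S \<inter> W) y \<partial>lborel)"
          by (subst emeasure_density) (auto intro!: nn_integral_cong simp: indicator_def)
        also have "\<dots> = ennreal c * emeasure lborel (S \<inter> W)" by (rule nn_integral_cmult_indicator) simp
        also have "\<dots> \<le> emeasure (P x) {\<omega> \<in> space M. Z \<omega> \<in> S \<inter> W}" unfolding Z_def by (rule c) auto
        also have "\<dots> = emeasure (distr (P x) borel Z) (S \<inter> W)"
          by (subst emeasure_distr) (auto simp: vimage_def Int_def conj_commute)
        also have "\<dots> = (\<integral>\<^sup>+y. indicator (S \<inter> W) y \<partial>distr (P x) borel Z)" by (rule nn_integral_indicator[symmetric]) simp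
        also have "\<dots> = (\<integral>\<^sup>+y. indicator W y * indicator S y \<partial>distr (P x) borel Z)"
          by (intro nn_integral_cong) (auto simp: indicator_def)
        also have "\<dots> = emeasure (density (distr (P x) borel Z) (indicator W)) S"
          by (rule emeasure_density[symmetric]) auto
        finally show "emeasure (density lborel (\<lambda>y. ennreal c * indicator W y)) S \<le> emeasure (density (distr (P x) borel Z) (indicator W)) S" .
      qed
    qed simp
  qed simp
  also have "\<dots> = (\<integral>\<^sup>+\<omega>. indicator W (Z \<omega>) * occupation B (Z \<omega>) \<partial>P x)"
    by (subst nn_integral_density) (auto simp: nn_integral_distr)
  also have "\<dots> = (\<integral>\<^sup>+\<omega>. indicator A \<omega> * occupation B (X (enn2real (?T \<omega>)) \<omega>) \<partial>P x)"
    by (intro nn_integral_cong) (auto simp: AZ Z_def indicator_def)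
  also have "\<dots> \<le> (\<integral>\<^sup>+\<omega>. (\<integral>\<^sup>+s\<in>{s. 0 \<le> s \<and> ennreal s < exit_time X Q \<omega>}. indicator B (X s \<omega>) \<partial>lborel) \<partial>P x)"
  proof (rule occupation_strong_markov[OF T fin _ _ B])
    show "A \<in> sets (pre_sigma ?T)" unfolding A_def by (rule X_stopped_pre_sigma[OF T W])
    fix \<omega> u assume u: "0 < u" "u < enn2real (?T \<omega>)"
    have "ennreal u < ?T \<omega>"
      using u fin[of \<omega>] by (metis ennreal_enn2real ennreal_less_iff infinity_ennreal_def less_imp_le)
    then have "ennreal u < exit_time X (cball x r) \<omega>" by simp
    from before_exit_time[OF this u(1)] show "X u \<omega> \<in> Q" using x by auto
  qed
  finally show ?thesis .
qed

end

section \<open>Cubes\<close>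

lemma cube_eq_cbox: "cube x r = cbox (\<chi> i. x $ i - r / 2) (\<chi> i. x $ i + r / 2)"
proof -
  have "\<bar>a - b\<bar> \<le> r / 2 \<longleftrightarrow> b - r / 2 \<le> a \<and> a \<le> b + r / 2" for a b :: real
    unfolding abs_le_iff by (rule iffI; (intro conjI)?; linarith)
  then show ?thesis by (simp only: set_eq_iff cube_def mem_Collect_eq mem_box_cart vec_lambda_beta) simp
qed

lemma compact_cube: "compact (cube x r)"
  and convex_cube: "convex (cube x r)"
  by (simp_all only: cube_eq_cbox compact_cbox convex_box)

lemma cball_subset_cube:
  assumes "x \<in> cube 0 (1 / 2)" "r \<le> 1 / 4" shows "cball x r \<subseteq> cube 0 1"
proof
  fix y assume y: "y \<in> cball x r"
  have "\<bar>y $ i\<bar> \<le> 1 / 2" for i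
  proof -
    have "\<bar>y $ i - x $ i\<bar> \<le> norm (y - x)" using component_le_norm_cart[of "y - x" i] by simp
    also have "\<dots> \<le> 1 / 4" using y assms(2) by (simp add: dist_norm norm_minus_commute)
    finally have "\<bar>y $ i - x $ i\<bar> \<le> 1 / 4" .
    moreover have "\<bar>x $ i\<bar> \<le> 1 / 4" using assms(1) by (simp add: cube_def)
    ultimately show ?thesis by linarith
  qed
  then show "y \<in> cube 0 1" by (simp add: cube_def)
qed

lemma emeasure_lborel_frontier_convex:
  fixes S :: "'a::euclidean_space set"
  assumes "convex S" shows "emeasure lborel (frontier S) = 0"
proof -
  have "frontier S \<in> sets lborel" by simp
  then have "frontier S \<in> null_sets lborel"
    using negligible_convex_frontier[OF assms]
    by (simp add: negligible_iff_null_sets null_sets_completion_iff)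
  then show ?thesis by auto
qed

section \<open>Uniformity over all sets of a given measure\<close>

context stable_process
begin

abbreviation "expected_occupation x B \<equiv>
  (\<integral>\<^sup>+\<omega>. (\<integral>\<^sup>+s\<in>{s. 0 \<le> s \<and> ennreal s < exit_time X (cube 0 1) \<omega>}. indicator B (X s \<omega>) \<partial>lborel) \<partial>P x)"

text \<open>Sets \<open>B' k\<close> with expected occupation below \<open>c / 2 ^ k\<close>, seen from starting points converging
  to \<open>l\<close>, would have an upper limit \<open>S\<close> of positive measure which the process, started from almost
  every point away from \<open>l\<close>, never visits.\<close>

lemma expected_occupation_uniform:
  assumes eps: "0 < \<epsilon>"
  shows "\<exists>\<delta>>0. \<forall>x B. x \<in> cube 0 (1 / 2) \<and> B \<subseteq> cube 0 1 \<and> B \<in> sets borel \<and> \<epsilon> \<le> measure lborel B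
    \<longrightarrow> ennreal \<delta> \<le> expected_occupation x B"
proof (rule ccontr)
  let ?Q = "cube 0 1 :: (real^'d) set"
  interpret killed_process n \<kappa> \<alpha> M P X ?Q
    by unfold_locales (rule compact_imp_closed[OF compact_cube])
  have Qm [measurable]: "?Q \<in> sets borel" by (rule borel_compact[OF compact_cube])
  have Qb: "bounded ?Q" by (rule compact_imp_bounded[OF compact_cube])
  obtain R where R: "0 < R" "?Q \<subseteq> ball 0 R"
    using bounded_subset_ballD[OF Qb, of 0] by blast
  define V where "V = unit_ball_vol (real DIM(real^'d))"
  have V: "0 \<le> V" by (simp add: V_def)
  \<comment> \<open>The first bound keeps balls around starting points inside the cube and makes
    \<open>2 * r\<close> at most 1; the second makes the volume of a ball of radius
    \<open>2 * r\<close> smaller than \<open>\<epsilon>\<close>, so a set of measure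
    \<open>\<epsilon>\<close> cannot fit into it up to null sets.\<close>
  define r where "r = min (1 / 8) (\<epsilon> / (4 * (V + 1)))"
  have "0 < \<epsilon> / (4 * (V + 1))" using eps V by simp
  then have r: "0 < r" "r \<le> 1 / 8" "r \<le> \<epsilon> / (4 * (V + 1))" unfolding r_def by linarith+
  have small: "emeasure lborel (cball z (2 * r)) < ennreal \<epsilon>" for z :: "real^'d"
  proof -
    have "(2 * r) ^ DIM(real^'d) \<le> (2 * r) ^ 1"
      using r DIM_positive[where 'a = "real^'d"] by (intro power_decreasing) auto
    then have "V * (2 * r) ^ DIM(real^'d) \<le> V * (2 * r)" using V by (intro mult_left_mono) auto
    also have "\<dots> \<le> V * (2 * (\<epsilon> / (4 * (V + 1))))" using V r by (intro mult_left_mono) auto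
    also have "\<dots> < \<epsilon>"
    proof -
      have "V * (2 * (\<epsilon> / (4 * (V + 1)))) = (V / (V + 1)) * (\<epsilon> / 2)" using V by (simp add: field_simps)
      also have "\<dots> \<le> 1 * (\<epsilon> / 2)" using V eps by (intro mult_right_mono) auto
      finally show ?thesis using eps by simp
    qed
    finally show ?thesis using emeasure_cball[of "2 * r" z] r V eps by (simp add: V_def ennreal_lessI)
  qed
  obtain c where c: "0 < c" "\<And>x A. \<lbrakk>cball x r \<subseteq> ball 0 R; A \<in> sets borel; A \<subseteq> ball 0 R - cball x r\<rbrakk> \<Longrightarrow>
      ennreal c * emeasure lborel A
        \<le> emeasure (P x) {\<omega> \<in> space M. X (enn2real (min (exit_time X (cball x r) \<omega>) 1)) \<omega> \<in> A}"
    using jump_density[of r R] r R by auto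
  assume neg: "\<not> ?thesis"
  \<comment> \<open>The bounds are chosen summable, and with the factor \<open>c\<close> so that the
    jump density can be divided out.\<close>
  have "\<forall>k::nat. \<exists>x B. x \<in> cube 0 (1 / 2) \<and> B \<subseteq> ?Q \<and> B \<in> sets borel \<and> \<epsilon> \<le> measure lborel B \<and>
      expected_occupation x B < ennreal (c * (1 / 2) ^ k)"
  proof
    fix k :: nat
    have "0 < c * (1 / 2) ^ k" using c(1) by simp
    with neg show "\<exists>x B. x \<in> cube 0 (1 / 2) \<and> B \<subseteq> ?Q \<and> B \<in> sets borel \<and> \<epsilon> \<le> measure lborel B \<and>
      expected_occupation x B < ennreal (c * (1 / 2) ^ k)"
      unfolding not_le[symmetric] by blast
  qed
  then obtain xs Bs where xB: "\<And>k. xs k \<in> cube 0 (1 / 2)" "\<And>k. Bs k \<subseteq> ?Q" "\<And>k. Bs k \<in> sets borel"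
      "\<And>k. \<epsilon> \<le> measure lborel (Bs k)" "\<And>k. expected_occupation (xs k) (Bs k) < ennreal (c * (1 / 2) ^ k)"
    unfolding choice_iff by blast
  \<comment> \<open>Convergence of starting points gives one target region \<open>W\<close> for all
    of them: the single ball of radius \<open>2 * r\<close> around \<open>l\<close> contains every
    small ball the process has to leave. Passing to a subsequence only improves the bounds, as
    \<open>s k\<close> is at least \<open>k\<close>.\<close>
  obtain l s where s: "strict_mono s" "(xs \<circ> s) \<longlonglongrightarrow> l"
    using seq_compactE[OF compact_cube[of 0 "1 / 2", unfolded compact_eq_seq_compact_metric], of xs] xB(1) by blast
  then obtain k0 where k0: "\<And>k. k0 \<le> k \<Longrightarrow> dist (xs (s k)) l < r"
    using r(1) unfolding lim_sequentially by (auto simp: o_def)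
  define x' where "x' k = xs (s (k + k0))" for k
  define B' where "B' k = Bs (s (k + k0))" for k
  have xl: "dist (x' k) l < r" for k using k0[of "k + k0"] by (simp add: x'_def)
  have xQ: "cball (x' k) r \<subseteq> ?Q" for k unfolding x'_def using xB(1) r by (intro cball_subset_cube) auto
  have B': "B' k \<subseteq> ?Q" "\<epsilon> \<le> measure lborel (B' k)" for k unfolding B'_def using xB by auto
  have B'm [measurable]: "B' k \<in> sets borel" for k unfolding B'_def using xB by auto
  define W where "W = ?Q - cball l (2 * r)"
  have Wm [measurable]: "W \<in> sets borel" unfolding W_def by measurable
  have WB: "W \<subseteq> ball 0 R - cball (x' k) r" for k
  proof
    fix z assume z: "z \<in> W"
    have "z \<notin> cball (x' k) r"
    proof
      assume "z \<in> cball (x' k) r"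
      then have "dist l z \<le> 2 * r" using xl[of k] dist_triangle[of l z "x' k"] by (simp add: dist_commute)
      then show False using z by (simp add: W_def)
    qed
    then show "z \<in> ball 0 R - cball (x' k) r" using z R(2) by (auto simp: W_def)
  qed
  have occW: "(\<integral>\<^sup>+y. indicator W y * occupation (B' k) y \<partial>lborel) \<le> ennreal ((1 / 2) ^ k)" for k
  proof -
    have "ennreal c * (\<integral>\<^sup>+y. indicator W y * occupation (B' k) y \<partial>lborel) \<le> expected_occupation (x' k) (B' k)"
    proof (rule target_lower_bound[OF xQ _ Wm B'm B'(1)])
      fix A assume "A \<in> sets borel" "A \<subseteq> W"
      then show "ennreal c * emeasure lborel A
        \<le> emeasure (P (x' k)) {\<omega> \<in> space M. X (enn2real (min (exit_time X (cball (x' k) r) \<omega>) 1)) \<omega> \<in> A}"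
        using WB[of k] xQ[of k] R(2) by (intro c(2)) auto
    qed
    also have "\<dots> \<le> ennreal (c * (1 / 2) ^ s (k + k0))" unfolding x'_def B'_def using xB(5) by (intro less_imp_le)
    also have "\<dots> \<le> ennreal (c * (1 / 2) ^ k)"
      using c(1) seq_suble[OF s(1), of "k + k0"] by (intro ennreal_leI mult_left_mono power_decreasing) auto
    also have "\<dots> = ennreal c * ennreal ((1 / 2) ^ k)" using c(1) by (simp add: ennreal_mult')
    finally show ?thesis using c(1) by (simp add: ennreal_mult_le_mult_iff)
  qed
  \<comment> \<open>A Borel-Cantelli argument for occupation: \<open>S\<close> is the upper limit of
    the sets \<open>B' k\<close>. Its measure is at least \<open>\<epsilon>\<close> by continuity
    from above inside the bounded cube, while subadditivity bounds the occupation of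
    \<open>S\<close>, integrated over \<open>W\<close>, by every tail of a geometric series.\<close>
  define V' where "V' m = (\<Union>k. B' (k + m))" for m
  define S where "S = (\<Inter>m. V' m)"
  have Um [measurable]: "V' m \<in> sets borel" for m unfolding V'_def by measurable
  have Sm [measurable]: "S \<in> sets borel" unfolding S_def by measurable
  have UQ: "V' m \<subseteq> ?Q" for m using B'(1) by (auto simp: V'_def)
  have SQ: "S \<subseteq> ?Q" using UQ by (auto simp: S_def)
  have Ufin: "emeasure lborel (V' m) \<noteq> \<infinity>" for m
    using emeasure_bounded_finite[OF bounded_subset[OF Qb UQ], of m] by simp
  have Seps: "ennreal \<epsilon> \<le> emeasure lborel S"
  proof -
    have "decseq V'"
    proof (rule decseq_SucI)
      fix m show "V' (Suc m) \<subseteq> V' m"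
      proof
        fix z assume "z \<in> V' (Suc m)"
        then obtain k where "z \<in> B' (k + Suc m)" by (auto simp: V'_def)
        then have "z \<in> B' (Suc k + m)" by simp
        then show "z \<in> V' m" unfolding V'_def by blast
      qed
    qed
    then have "(INF m. emeasure lborel (V' m)) = emeasure lborel S"
      unfolding S_def using Ufin by (intro INF_emeasure_decseq) auto
    moreover have "ennreal \<epsilon> \<le> emeasure lborel (V' m)" for m
    proof -
      have fin: "emeasure lborel (B' m) < \<infinity>"
        by (rule emeasure_bounded_finite[OF bounded_subset[OF Qb B'(1)]])
      have "ennreal \<epsilon> \<le> emeasure lborel (B' m)"
        using B'(2)[of m] fin by (subst emeasure_eq_ennreal_measure) (auto intro: ennreal_leI)
      also have "\<dots> \<le> emeasure lborel (V' m)" by (intro emeasure_mono) (auto simp: V'_def intro!: exI[of _ 0])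
      finally show ?thesis .
    qed
    ultimately show ?thesis by (metis INF_greatest)
  qed
  have om [measurable]: "occupation B \<in> borel_measurable borel" if "B \<in> sets borel" for B by (rule occupation_measurable[OF that])
  have Uocc: "(\<integral>\<^sup>+y. indicator W y * occupation (V' m) y \<partial>lborel) \<le> ennreal (2 * (1 / 2) ^ m)" for m
  proof -
    have "(\<integral>\<^sup>+y. indicator W y * occupation (V' m) y \<partial>lborel)
       \<le> (\<integral>\<^sup>+y. (\<Sum>k. indicator W y * occupation (B' (k + m)) y) \<partial>lborel)"
      unfolding V'_def by (intro nn_integral_mono) (simp add: mult_left_mono occupation_UN)
    also have "\<dots> = (\<Sum>k. \<integral>\<^sup>+y. indicator W y * occupation (B' (k + m)) y \<partial>lborel)"
      by (intro nn_integral_suminf) measurable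
    also have "\<dots> \<le> (\<Sum>k. ennreal ((1 / 2) ^ (k + m)))" by (intro suminf_le occW) auto
    also have "\<dots> = ennreal (\<Sum>k. (1 / 2) ^ (k + m))"
      by (intro suminf_ennreal2) (auto simp: power_add intro!: summable_mult2 summable_geometric)
    also have "(\<Sum>k. (1 / 2 :: real) ^ (k + m)) = 2 * (1 / 2) ^ m"
      by (simp add: power_add suminf_mult2[symmetric] summable_geometric suminf_geometric)
    finally show ?thesis .
  qed
  have "(\<integral>\<^sup>+y. indicator W y * occupation S y \<partial>lborel) \<le> 0"
  proof (rule LIMSEQ_le_const)
    have "(\<lambda>m. ennreal (2 * (1 / 2) ^ m)) \<longlonglongrightarrow> ennreal (2 * 0)"
      by (intro tendsto_intros LIMSEQ_power_zero) auto
    then show "(\<lambda>m. ennreal (2 * (1 / 2) ^ m)) \<longlonglongrightarrow> 0" by simp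
    have "(\<integral>\<^sup>+y. indicator W y * occupation S y \<partial>lborel) \<le> ennreal (2 * (1 / 2) ^ m)" for m
    proof -
      have "(\<integral>\<^sup>+y. indicator W y * occupation S y \<partial>lborel) \<le> (\<integral>\<^sup>+y. indicator W y * occupation (V' m) y \<partial>lborel)"
        by (intro nn_integral_mono mult_left_mono occupation_mono) (auto simp: S_def)
      then show ?thesis using Uocc[of m] by (rule order_trans)
    qed
    then show "\<exists>N. \<forall>m\<ge>N. (\<integral>\<^sup>+y. indicator W y * occupation S y \<partial>lborel) \<le> ennreal (2 * (1 / 2) ^ m)" by blast
  qed
  then have "(\<integral>\<^sup>+y. indicator W y * occupation S y \<partial>lborel) = 0" by simp
  then have AE0: "AE y in lborel. indicator W y * occupation S y = 0"
    by (subst (asm) nn_integral_0_iff_AE) auto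
  \<comment> \<open>Removing the ball takes less than \<open>\<epsilon>\<close> from
    \<open>S\<close>, the frontier of the cube is null by convexity, and occupation of
    \<open>S\<close> vanishes almost everywhere on \<open>W\<close>. What remains, \<open>Z\<close>,
    has positive measure and consists of bad points only. The interior is required so that small
    balls around the points stay in the cube.\<close>
  define Z where "Z = {y \<in> S \<inter> interior ?Q - cball l (2 * r). occupation S y = 0}"
  have Zm [measurable]: "Z \<in> sets borel"
  proof -
    have "{y \<in> space borel. occupation S y = 0} \<in> sets borel" by measurable
    then have "(S \<inter> interior ?Q - cball l (2 * r)) \<inter> {y. occupation S y = 0} \<in> sets borel" by simp
    then show ?thesis unfolding Z_def by (rule back_subst[of "\<lambda>S. S \<in> sets borel"]) auto
  qed
  have Zpos: "emeasure lborel Z \<noteq> 0"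
  proof
    assume "emeasure lborel Z = 0"
    then have "AE y in lborel. y \<notin> Z" by (intro AE_not_in) auto
    moreover have "AE y in lborel. y \<notin> frontier ?Q"
      using emeasure_lborel_frontier_convex[OF convex_cube] by (intro AE_not_in) (simp add: null_sets_def)
    ultimately have "AE y in lborel. y \<in> S \<longrightarrow> y \<in> cball l (2 * r)"
      using AE0
    proof eventually_elim
      fix y assume y: "y \<notin> Z" "y \<notin> frontier ?Q" "indicator W y * occupation S y = 0"
      show "y \<in> S \<longrightarrow> y \<in> cball l (2 * r)"
      proof (rule impI, rule ccontr)
        assume yS: "y \<in> S" and n: "y \<notin> cball l (2 * r)"
        then have "y \<in> ?Q" using SQ by auto
        then have "y \<in> interior ?Q" "y \<in> W"
          using y(2) n closure_subset[of ?Q] by (auto simp: frontier_def W_def)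
        then show False using y(1,3) yS n by (auto simp: Z_def)
      qed
    qed
    then have "emeasure lborel S \<le> emeasure lborel (cball l (2 * r))"
      by (intro emeasure_mono_AE) auto
    then show False using Seps small[of l] by (metis leD order_trans)
  qed
  have "\<exists>\<rho>. 0 < \<rho> \<and> \<rho> \<le> 1 \<and> cball y \<rho> \<subseteq> ?Q \<and> (\<forall>x\<in>cball y \<rho>. \<forall>h. h \<noteq> 0 \<and> norm h \<le> 1 \<longrightarrow> \<bar>n x h - n y h\<bar> \<le> 1)"
    if y: "y \<in> interior ?Q" for y
  proof -
    obtain e where e: "0 < e" "cball y e \<subseteq> ?Q" using y mem_interior_cball by blast
    obtain d where d: "0 < d" "\<And>x h. dist x y < d \<Longrightarrow> h \<noteq> 0 \<Longrightarrow> norm h \<le> 1 \<Longrightarrow> \<bar>n x h - n y h\<bar> \<le> 1"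
      using n_close[of 1 1 y] by auto
    show ?thesis
      by (rule exI[of _ "min 1 (min e (d / 2))"]) (use e d in \<open>auto simp: dist_commute subset_iff\<close>)
  qed
  then obtain \<rho> where rho: "\<And>y. y \<in> interior ?Q \<Longrightarrow> 0 < \<rho> y \<and> \<rho> y \<le> 1 \<and> cball y (\<rho> y) \<subseteq> ?Q \<and>
      (\<forall>x\<in>cball y (\<rho> y). \<forall>h. h \<noteq> 0 \<and> norm h \<le> 1 \<longrightarrow> \<bar>n x h - n y h\<bar> \<le> 1)"
    by metis
  \<comment> \<open>The kernel is close to its value at \<open>y\<close> only on a ball whose radius
    depends on \<open>y\<close>. Countably many such balls cover the interior, so one of them meets
    \<open>Z\<close> in positive measure. Halved radii leave the margin needed for positive
    occupation.\<close>
  obtain \<F> where F: "\<F> \<subseteq> (\<lambda>y. ball y (\<rho> y / 2)) ` interior ?Q" "countable \<F>"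
      "\<Union>\<F> = \<Union>((\<lambda>y. ball y (\<rho> y / 2)) ` interior ?Q)"
    by (rule Lindelof[of "(\<lambda>y. ball y (\<rho> y / 2)) ` interior ?Q"]) auto
  have "\<exists>b\<in>\<F>. emeasure lborel (Z \<inter> b) \<noteq> 0"
  proof (rule ccontr)
    assume no: "\<not> (\<exists>b\<in>\<F>. emeasure lborel (Z \<inter> b) \<noteq> 0)"
    have "(\<Union>b\<in>\<F>. Z \<inter> b) \<in> null_sets lborel"
    proof (rule null_sets_UN'[OF F(2)])
      fix b assume "b \<in> \<F>"
      moreover then have "open b" using F(1) by auto
      ultimately show "Z \<inter> b \<in> null_sets lborel" using no by (auto simp: null_sets_def)
    qed
    moreover have "Z \<subseteq> (\<Union>b\<in>\<F>. Z \<inter> b)"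
    proof
      fix z assume z: "z \<in> Z"
      then have "z \<in> interior ?Q" by (auto simp: Z_def)
      then have "z \<in> \<Union>((\<lambda>y. ball y (\<rho> y / 2)) ` interior ?Q)" using rho[of z] by (intro UN_I[of z]) auto
      then show "z \<in> (\<Union>b\<in>\<F>. Z \<inter> b)" using z unfolding F(3)[symmetric] by auto
    qed
    ultimately have "emeasure lborel Z = 0" using null_sets_subset[of _ lborel Z] Zm by (metis null_setsD1 sets_lborel)
    then show False using Zpos by simp
  qed
  then obtain y0 where y0: "y0 \<in> interior ?Q" "emeasure lborel (Z \<inter> ball y0 (\<rho> y0 / 2)) \<noteq> 0" using F(1) by auto
  have "emeasure lborel (Z \<inter> ball y0 (\<rho> y0 / 2)) = (SUP L\<in>{L. L \<subseteq> Z \<inter> ball y0 (\<rho> y0 / 2) \<and> compact L}. emeasure lborel L)"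
  proof (rule emeasure_lborel_inner_compact)
    show "Z \<inter> ball y0 (\<rho> y0 / 2) \<subseteq> ball 0 R" using R(2) SQ by (auto simp: Z_def)
  qed simp
  then have "0 < (SUP L\<in>{L. L \<subseteq> Z \<inter> ball y0 (\<rho> y0 / 2) \<and> compact L}. emeasure lborel L)"
    using y0(2) by (simp add: zero_less_iff_neq_zero)
  then obtain L where L: "L \<subseteq> Z \<inter> ball y0 (\<rho> y0 / 2)" "compact L" "emeasure lborel L \<noteq> 0"
    unfolding less_SUP_iff by auto
  have "\<exists>x\<in>L. occupation L x \<noteq> 0"
    using rho[OF y0(1)] L by (intro occupation_positive[of "\<rho> y0" y0]) auto
  then obtain x where x: "x \<in> L" "occupation L x \<noteq> 0" by blast
  have "occupation L x \<le> occupation S x" using L(1) by (intro occupation_mono) (auto simp: Z_def)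
  moreover have "occupation S x = 0" using x(1) L(1) by (auto simp: Z_def)
  ultimately show False using x(2) by simp
qed

end

theorem theorem4p7:
  fixes n :: "real^'d::finite \<Rightarrow> real^'d \<Rightarrow> real"
    and M :: "'w measure"
    and P :: "real^'d \<Rightarrow> 'w measure"
    and X :: "real \<Rightarrow> 'w \<Rightarrow> real^'d"
  assumes "stable_like_kernel n"
    and "strong_markov_process M P X"
    and "\<And>x. solves_martingale_problem (generator n) (P x) X x"
  shows "\<exists>\<phi> :: real \<Rightarrow> real.
    \<phi> ` {0<..<1} \<subseteq> {0<..<1} \<and> mono_on {0<..<1} \<phi> \<and>
    (\<forall>x B. x \<in> cube 0 (1/2) \<and> B \<subseteq> cube 0 1 \<and> B \<in> sets borel \<and> measure lborel B \<in> {0<..<1} \<longrightarrow>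
       (\<integral>\<^sup>+\<omega>. (\<integral>\<^sup>+s\<in>{s. 0 \<le> s \<and> ennreal s < exit_time X (cube 0 1) \<omega>}.
                  indicator B (X s \<omega>) \<partial>lborel) \<partial>P x)
       \<ge> ennreal (\<phi> (measure lborel B)))"
proof -
  obtain \<kappa> \<alpha> where "stable_like n \<kappa> \<alpha>" using stable_like_kernel_imp[OF assms(1)] by blast
  then interpret stable_like n \<kappa> \<alpha> .
  interpret stable_process n \<kappa> \<alpha> M P X by unfold_locales (use assms in auto)
  define good where "good e = {(x :: real^'d, B :: (real^'d) set). x \<in> cube 0 (1/2) \<and> B \<subseteq> cube 0 1 \<and> B \<in> sets borel \<and> e \<le> measure lborel B}" for e
  \<comment> \<open>The infimum runs over all sets of measure at least \<open>e\<close>, not exactly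
    \<open>e\<close>, so monotonicity is automatic. The cap 1/2 keeps values below 1 and finite, so
    that \<open>enn2real\<close> does not turn an infinite infimum into 0.\<close>
  define \<psi> where "\<psi> e = min (INF (x, B)\<in>good e. expected_occupation x B) (ennreal (1 / 2))" for e
  have psi_top: "\<psi> e < top" for e
    unfolding \<psi>_def by (rule le_less_trans[OF min.cobounded2 ennreal_less_top])
  have half: "enn2real (\<psi> e) \<le> 1 / 2" for e by (rule enn2real_leI) (auto simp: \<psi>_def)
  have pos: "0 < enn2real (\<psi> e)" if e: "0 < e" for e
  proof -
    obtain \<delta> where \<delta>: "0 < \<delta>" "\<And>x B. (x, B) \<in> good e \<Longrightarrow> ennreal \<delta> \<le> expected_occupation x B"
      using expected_occupation_uniform[OF e] unfolding good_def by blast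
    have "ennreal (min \<delta> (1 / 2)) \<le> \<psi> e" unfolding \<psi>_def
    proof (rule min.boundedI)
      show "ennreal (min \<delta> (1 / 2)) \<le> (INF (x, B)\<in>good e. expected_occupation x B)"
        using \<delta>(2) order_trans[OF ennreal_leI[OF min.cobounded1]] by (intro INF_greatest) fast
    qed (rule ennreal_leI, simp)
    then have "enn2real (ennreal (min \<delta> (1 / 2))) \<le> enn2real (\<psi> e)"
      by (intro enn2real_mono) (simp_all add: psi_top)
    then show ?thesis using \<delta>(1) by simp
  qed
  have mono: "enn2real (\<psi> e) \<le> enn2real (\<psi> e')" if "e \<le> e'" for e e'
  proof -
    have "good e' \<subseteq> good e" using that by (auto simp: good_def)
    then have "\<psi> e \<le> \<psi> e'" unfolding \<psi>_def by (intro min.mono INF_superset_mono) auto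
    then show ?thesis by (intro enn2real_mono) (simp_all add: psi_top)
  qed
  show ?thesis
  proof (intro exI[of _ "\<lambda>e. enn2real (\<psi> e)"] conjI allI impI)
    show "(\<lambda>e. enn2real (\<psi> e)) ` {0<..<1} \<subseteq> {0<..<1}"
      using pos le_less_trans[OF half, of 1] by auto
    show "mono_on {0<..<1} (\<lambda>e. enn2real (\<psi> e))" using mono by (auto intro!: mono_onI)
    fix x :: "real^'d" and B :: "(real^'d) set"
    assume "x \<in> cube 0 (1/2) \<and> B \<subseteq> cube 0 1 \<and> B \<in> sets borel \<and> measure lborel B \<in> {0<..<1}"
    then have "(x, B) \<in> good (measure lborel B)" by (auto simp: good_def)
    then have "\<psi> (measure lborel B) \<le> expected_occupation x B"
      unfolding \<psi>_def by (intro min.coboundedI1 INF_lower2[of "(x, B)"]) auto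
    then show "ennreal (enn2real (\<psi> (measure lborel B))) \<le> expected_occupation x B"
      by (simp only: ennreal_enn2real[OF psi_top])
  qed
qed

end
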